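(* Let $n_1,n_2\ge1$, masses $m_{i,j}>0$ and the function $\kappa$ be fixed as in the context, and consider the family of one-dimensional piston systems parameterized by $\varepsilon=M^{-1/2}>0$ and the smoothing parameter $\delta\ge0$ described in the context. Let $\mathcal V\subset\mathbb R^{n_1+n_2+2}$ be a compact set for which there exist compact sets $A\subset(0,1)$, $B\subset\mathbb R$, $K\subset(0,\kappa(0))$ such that every $h=(Q,W,E_{1,1},\dots,E_{1,n_1},E_{2,1},\dots,E_{2,n_2})\in\mathcal V$ satisfies $Q\in A$, $W\in B$ and $E_{i,j}\in K$ for all $i,j$. Put $T^\delta_\varepsilon=\inf\{\tau\ge0:\ \bar h^\delta(\tau)\notin\mathcal V\ \text{or}\ h^\delta_\varepsilon(\tau/\varepsilon)\notin\mathcal V\}$. Then there exists $\delta_0>0$ such that the averaged vector field $\bar H^\delta(h)$ is $\mathcal C^1$ (jointly in $(\delta,h)$) on $\{(\delta,h):0\le\delta\le\delta_0,\ h\in\mathcal V\}$. Furthermore, for each $T>0$, $$\sup_{0\le\delta\le\delta_0}\ \ \sup_{\substack{\text{initial conditions}\\ \text{s.t. }h^\delta_\varepsilon(0)\in\mathcal V}}\ \ \sup_{0\le\tau\le\min(T,T^\delta_\varepsilon)}\bigl|h^\delta_\varepsilon(\tau/\varepsilon)-\bar h^\delta(\tau)\bigr|=\mathcal O(\varepsilon)\qquad\text{as }\varepsilon=M^{-1/2}\to0.$$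
   Context: Setting. A piston (point particle of mass $M$) has position $Q$ and velocity $V=dQ/dt$; to its left are $n_1$ gas particles with positions $q_{1,j}$, velocities $v_{1,j}$, masses $m_{1,j}$, to its right $n_2$ gas particles with positions $q_{2,j}$, velocities $v_{2,j}$, masses $m_{2,j}$. Put $\varepsilon=M^{-1/2}$ and $W=V/\varepsilon$. Soft core dynamics ($\delta>0$). Let $\kappa:\mathbb R\to\mathbb R$ be $\mathcal C^2$ with $\kappa(x)=0$ for $x\ge1$ and $\kappa'(x)<0$ for $x<1$; put $\kappa_\delta(x)=\kappa(x/\delta)$. The system is the Hamiltonian system with the kinetic energy of all particles plus the potential $\sum_{j=1}^{n_1}[\kappa_\delta(q_{1,j})+\kappa_\delta(Q-q_{1,j})]+\sum_{j=1}^{n_2}[\kappa_\delta(q_{2,j}-Q)+\kappa_\delta(1-q_{2,j})]$. Energies: $E_{1,j}=\tfrac12m_{1,j}v_{1,j}^2+\kappa_\delta(q_{1,j})+\kappa_\delta(Q-q_{1,j})$ and $E_{2,j}=\tfrac12m_{2,j}v_{2,j}^2+\kappa_\delta(q_{2,j}-Q)+\kappa_\delta(1-q_{2,j})$. Hard core dynamics ($\delta=0$). By convention $\delta=0$ means: gas particles $0\le q_{1,j}\le Q\le q_{2,j}\le1$ move freely except for elastic collisions with the piston and with fixed walls at $0$ and $1$ (simultaneous collisions with the piston are performed one after another in a fixed order, e.g. left particles first; left continuity in time at collisions), and $E_{i,j}=\tfrac12m_{i,j}v_{i,j}^2$. The slow variables are $h=(Q,W,E_{1,1},\dots,E_{1,n_1},E_{2,1},\dots,E_{2,n_2})$;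 $h^\delta_\varepsilon(t)$ denotes their actual time evolution for the given $\varepsilon,\delta$, depending on the initial condition in phase space. Averaged vector field. For $\delta>0$ small let $T_{i,j}=T_{i,j}(Q,E_{i,j},\delta)$ be the period of the motion of the $j$th gas particle on side $i$ when the piston is held fixed at $Q$ (i.e. $\varepsilon=0$) and the particle has energy $E_{i,j}$; for $\delta=0$, $T_{1,j}=\sqrt{2m_{1,j}/E_{1,j}}\,Q$ and $T_{2,j}=\sqrt{2m_{2,j}/E_{2,j}}\,(1-Q)$. Then $\bar H^\delta(h)$ has $Q$-component $W$; $W$-component $\sum_{j=1}^{n_1}\frac{\sqrt{8m_{1,j}E_{1,j}}}{T_{1,j}}-\sum_{j=1}^{n_2}\frac{\sqrt{8m_{2,j}E_{2,j}}}{T_{2,j}}$; $E_{1,j}$-component $-W\frac{\sqrt{8m_{1,j}E_{1,j}}}{T_{1,j}}$; $E_{2,j}$-component $+W\frac{\sqrt{8m_{2,j}E_{2,j}}}{T_{2,j}}$. The function $\bar h^\delta(\tau)$ is the solution of $d\bar h^\delta/d\tau=\bar H^\delta(\bar h^\delta)$, $\bar h^\delta(0)=h^\delta_\varepsilon(0)$. The statement "$=\mathcal O(\varepsilon)$" means: there are $C<\infty$, $\varepsilon_1>0$ such that the left side is at most $C\varepsilon$ for all $0<\varepsilon\le\varepsilon_1$. *)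

theory Defs
  imports "HOL-Analysis.Analysis"
begin

text \<open>
  The gas particles on the left and on the right of the piston are indexed by two finite types
  \<open>'l\<close> and \<open>'r\<close>, so that \<open>n\<^sub>1 = CARD('l) \<ge> 1\<close> and \<open>n\<^sub>2 = CARD('r) \<ge> 1\<close>.
\<close>

record ('l, 'r) phase =
  piston_pos :: real
  piston_vel :: real
  pos1 :: "'l \<Rightarrow> real"
  vel1 :: "'l \<Rightarrow> real"
  pos2 :: "'r \<Rightarrow> real"
  vel2 :: "'r \<Rightarrow> real"

definition core_potential :: "(real \<Rightarrow> real) \<Rightarrow> bool" where
  "core_potential \<kappa> \<longleftrightarrow>
     (\<exists>\<kappa>' \<kappa>''.
        (\<forall>x. (\<kappa> has_real_derivative \<kappa>' x) (at x)) \<and>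
        (\<forall>x. (\<kappa>' has_real_derivative \<kappa>'' x) (at x)) \<and>
        continuous_on UNIV \<kappa>'' \<and>
        (\<forall>x\<ge>1. \<kappa> x = 0) \<and>
        (\<forall>x<1. \<kappa>' x < 0))"

text \<open>
  Potential energy of a gas particle at \<open>x\<close> between two walls at \<open>a\<close> and \<open>b\<close> (one of which is the
  piston).  For \<open>\<delta> = 0\<close> the walls are hard and there is no potential energy; the case distinction
  is needed because \<open>x / 0 = 0\<close>.
\<close>

definition well :: "(real \<Rightarrow> real) \<Rightarrow> real \<Rightarrow> real \<Rightarrow> real \<Rightarrow> real \<Rightarrow> real" where
  "well \<kappa> \<delta> a b x = (if \<delta> = 0 then 0 else \<kappa> ((x - a) / \<delta>) + \<kappa> ((b - x) / \<delta>))"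

definition energy1 ::
  "(real \<Rightarrow> real) \<Rightarrow> ('l \<Rightarrow> real) \<Rightarrow> real \<Rightarrow> ('l, 'r) phase \<Rightarrow> 'l \<Rightarrow> real" where
  "energy1 \<kappa> m1 \<delta> z j = m1 j * (vel1 z j)\<^sup>2 / 2 + well \<kappa> \<delta> 0 (piston_pos z) (pos1 z j)"

definition energy2 ::
  "(real \<Rightarrow> real) \<Rightarrow> ('r \<Rightarrow> real) \<Rightarrow> real \<Rightarrow> ('l, 'r) phase \<Rightarrow> 'r \<Rightarrow> real" where
  "energy2 \<kappa> m2 \<delta> z j = m2 j * (vel2 z j)\<^sup>2 / 2 + well \<kappa> \<delta> (piston_pos z) 1 (pos2 z j)"


subsection \<open>Soft core dynamics\<close>

definition potential ::
  "(real \<Rightarrow> real) \<Rightarrow> real \<Rightarrow> ('l::finite, 'r::finite) phase \<Rightarrow> real" where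
  "potential \<kappa> \<delta> z =
     (\<Sum>j\<in>UNIV. well \<kappa> \<delta> 0 (piston_pos z) (pos1 z j)) +
     (\<Sum>j\<in>UNIV. well \<kappa> \<delta> (piston_pos z) 1 (pos2 z j))"

text \<open>
  Hamilton's equations on the time interval \<open>[0, R]\<close>, written in positions and velocities:
  mass times acceleration is minus the partial derivative of the potential.
\<close>

definition soft_core_motion ::
  "(real \<Rightarrow> real) \<Rightarrow> real \<Rightarrow> ('l::finite \<Rightarrow> real) \<Rightarrow> ('r::finite \<Rightarrow> real) \<Rightarrow> real \<Rightarrow> real \<Rightarrow>
     (real \<Rightarrow> ('l, 'r) phase) \<Rightarrow> bool" where
  "soft_core_motion \<kappa> M m1 m2 \<delta> R z \<longleftrightarrow>
     (\<forall>t\<in>{0..R}.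
        ((\<lambda>s. piston_pos (z s)) has_real_derivative piston_vel (z t)) (at t within {0..R}) \<and>
        ((\<lambda>s. M * piston_vel (z s)) has_real_derivative
           - deriv (\<lambda>x. potential \<kappa> \<delta> ((z t)\<lparr>piston_pos := x\<rparr>)) (piston_pos (z t)))
           (at t within {0..R}) \<and>
        (\<forall>j. ((\<lambda>s. pos1 (z s) j) has_real_derivative vel1 (z t) j) (at t within {0..R}) \<and>
             ((\<lambda>s. m1 j * vel1 (z s) j) has_real_derivative
                - deriv (\<lambda>x. potential \<kappa> \<delta> ((z t)\<lparr>pos1 := (pos1 (z t))(j := x)\<rparr>)) (pos1 (z t) j))
                (at t within {0..R})) \<and>
        (\<forall>j. ((\<lambda>s. pos2 (z s) j) has_real_derivative vel2 (z t) j) (at t within {0..R}) \<and>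
             ((\<lambda>s. m2 j * vel2 (z s) j) has_real_derivative
                - deriv (\<lambda>x. potential \<kappa> \<delta> ((z t)\<lparr>pos2 := (pos2 (z t))(j := x)\<rparr>)) (pos2 (z t) j))
                (at t within {0..R})))"


subsection \<open>Hard core dynamics\<close>

definition admissible :: "('l, 'r) phase \<Rightarrow> bool" where
  "admissible z \<longleftrightarrow>
     (\<forall>j. 0 \<le> pos1 z j \<and> pos1 z j \<le> piston_pos z) \<and>
     (\<forall>j. piston_pos z \<le> pos2 z j \<and> pos2 z j \<le> 1)"

text \<open>Velocity of a point mass \<open>m\<close> after an elastic collision with a point mass \<open>m'\<close>.\<close>

definition elastic :: "real \<Rightarrow> real \<Rightarrow> real \<Rightarrow> real \<Rightarrow> real" where
  "elastic m m' v v' = ((m - m') * v + 2 * m' * v') / (m + m')"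

definition hits_piston :: "('l, 'r) phase \<Rightarrow> 'l + 'r \<Rightarrow> bool" where
  "hits_piston z i = (case i of
     Inl j \<Rightarrow> pos1 z j = piston_pos z \<and> vel1 z j > piston_vel z
   | Inr j \<Rightarrow> pos2 z j = piston_pos z \<and> vel2 z j < piston_vel z)"

definition hits_wall :: "('l, 'r) phase \<Rightarrow> 'l + 'r \<Rightarrow> bool" where
  "hits_wall z i = (case i of
     Inl j \<Rightarrow> pos1 z j = 0 \<and> vel1 z j < 0
   | Inr j \<Rightarrow> pos2 z j = 1 \<and> vel2 z j > 0)"

definition collide_piston ::
  "real \<Rightarrow> ('l \<Rightarrow> real) \<Rightarrow> ('r \<Rightarrow> real) \<Rightarrow> 'l + 'r \<Rightarrow> ('l, 'r) phase \<Rightarrow> ('l, 'r) phase" where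
  "collide_piston M m1 m2 i z =
     (if \<not> hits_piston z i then z else
      (case i of
         Inl j \<Rightarrow> z\<lparr>piston_vel := elastic M (m1 j) (piston_vel z) (vel1 z j),
                   vel1 := (vel1 z)(j := elastic (m1 j) M (vel1 z j) (piston_vel z))\<rparr>
       | Inr j \<Rightarrow> z\<lparr>piston_vel := elastic M (m2 j) (piston_vel z) (vel2 z j),
                   vel2 := (vel2 z)(j := elastic (m2 j) M (vel2 z j) (piston_vel z))\<rparr>))"

definition reflect_walls :: "('l, 'r) phase \<Rightarrow> ('l, 'r) phase" where
  "reflect_walls z =
     z\<lparr>vel1 := (\<lambda>j. if hits_wall z (Inl j) then - vel1 z j else vel1 z j),
       vel2 := (\<lambda>j. if hits_wall z (Inr j) then - vel2 z j else vel2 z j)\<rparr>"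

text \<open>
  The list \<open>ord\<close> enumerates all gas particles and fixes the order in which simultaneous collisions
  with the piston are performed.  One pass through it may push the piston back into a particle that
  has already been treated, so passes are repeated until nothing is about to collide.
\<close>

definition collision_pass ::
  "('l + 'r) list \<Rightarrow> real \<Rightarrow> ('l \<Rightarrow> real) \<Rightarrow> ('r \<Rightarrow> real) \<Rightarrow> ('l, 'r) phase \<Rightarrow> ('l, 'r) phase" where
  "collision_pass ord M m1 m2 z = reflect_walls (fold (collide_piston M m1 m2) ord z)"

definition after_collisions ::
  "('l + 'r) list \<Rightarrow> real \<Rightarrow> ('l \<Rightarrow> real) \<Rightarrow> ('r \<Rightarrow> real) \<Rightarrow> ('l, 'r) phase \<Rightarrow> ('l, 'r) phase \<Rightarrow> bool"
where
  "after_collisions ord M m1 m2 z z' \<longleftrightarrow>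
     (\<exists>k. z' = (collision_pass ord M m1 m2 ^^ k) z) \<and>
     (\<forall>i. \<not> hits_piston z' i \<and> \<not> hits_wall z' i)"

definition free_flight :: "real \<Rightarrow> ('l, 'r) phase \<Rightarrow> ('l, 'r) phase" where
  "free_flight s z =
     z\<lparr>piston_pos := piston_pos z + s * piston_vel z,
       pos1 := (\<lambda>j. pos1 z j + s * vel1 z j),
       pos2 := (\<lambda>j. pos2 z j + s * vel2 z j)\<rparr>"

text \<open>
  Velocities are left continuous: \<open>z t\<close> carries the velocities from before the collisions (if any)
  at time \<open>t\<close>.
\<close>

definition hard_core_motion ::
  "(('l + 'r) list) \<Rightarrow> real \<Rightarrow> ('l \<Rightarrow> real) \<Rightarrow> ('r \<Rightarrow> real) \<Rightarrow> real \<Rightarrow> (real \<Rightarrow> ('l, 'r) phase) \<Rightarrow> bool"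
where
  "hard_core_motion ord M m1 m2 R z \<longleftrightarrow>
     (\<forall>t\<in>{0..R}. admissible (z t)) \<and>
     (\<forall>t\<in>{0<..R}. \<exists>\<eta>>0. \<forall>s\<in>{0..<t}. t - \<eta> < s \<longrightarrow> z t = free_flight (t - s) (z s)) \<and>
     (\<forall>t\<in>{0..<R}. \<exists>z'. after_collisions ord M m1 m2 (z t) z' \<and>
        (\<exists>\<eta>>0. \<forall>s\<in>{t<..R}. s < t + \<eta> \<longrightarrow> z s = free_flight (s - t) z'))"

definition piston_motion ::
  "(real \<Rightarrow> real) \<Rightarrow> ('l::finite + 'r::finite) list \<Rightarrow> real \<Rightarrow> ('l \<Rightarrow> real) \<Rightarrow> ('r \<Rightarrow> real) \<Rightarrow> real \<Rightarrow>
     real \<Rightarrow> (real \<Rightarrow> ('l, 'r) phase) \<Rightarrow> bool" where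
  "piston_motion \<kappa> ord M m1 m2 \<delta> R z \<longleftrightarrow>
     (if \<delta> = 0 then hard_core_motion ord M m1 m2 R z
      else soft_core_motion \<kappa> M m1 m2 \<delta> R z)"


subsection \<open>Slow variables and the averaged vector field\<close>

type_synonym ('l, 'r) slow = "real \<times> real \<times> (real ^ 'l) \<times> (real ^ 'r)"

definition slow_vars ::
  "(real \<Rightarrow> real) \<Rightarrow> ('l::finite \<Rightarrow> real) \<Rightarrow> ('r::finite \<Rightarrow> real) \<Rightarrow> real \<Rightarrow> real \<Rightarrow>
     ('l, 'r) phase \<Rightarrow> ('l, 'r) slow" where
  "slow_vars \<kappa> m1 m2 \<epsilon> \<delta> z =
     (piston_pos z, piston_vel z / \<epsilon>, (\<chi> j. energy1 \<kappa> m1 \<delta> z j), (\<chi> j. energy2 \<kappa> m2 \<delta> z j))"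

text \<open>Motion, for all times, of one gas particle of mass \<open>m\<close> between soft walls held at \<open>a\<close> and \<open>b\<close>.\<close>

definition frozen_motion ::
  "(real \<Rightarrow> real) \<Rightarrow> real \<Rightarrow> real \<Rightarrow> real \<Rightarrow> real \<Rightarrow> (real \<Rightarrow> real) \<Rightarrow> (real \<Rightarrow> real) \<Rightarrow> bool" where
  "frozen_motion \<kappa> \<delta> a b m q v \<longleftrightarrow>
     (\<forall>t. (q has_real_derivative v t) (at t) \<and>
          ((\<lambda>s. m * v s) has_real_derivative - deriv (well \<kappa> \<delta> a b) (q t)) (at t))"

definition least_period :: "(real \<Rightarrow> 'a) \<Rightarrow> real \<Rightarrow> bool" where
  "least_period f p \<longleftrightarrow>
     p > 0 \<and> (\<forall>t. f (t + p) = f t) \<and> (\<forall>p'. 0 < p' \<and> p' < p \<longrightarrow> (\<exists>t. f (t + p') \<noteq> f t))"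

text \<open>
  For \<open>0 < E < \<kappa> 0\<close> and small \<open>\<delta> > 0\<close> the motions of energy \<open>E\<close> exist and agree up to a shift in
  time, so that the description below is proper.
\<close>

definition period ::
  "(real \<Rightarrow> real) \<Rightarrow> real \<Rightarrow> real \<Rightarrow> real \<Rightarrow> real \<Rightarrow> real \<Rightarrow> real" where
  "period \<kappa> \<delta> a b m E =
     (if \<delta> = 0 then sqrt (2 * m / E) * (b - a)
      else (THE p. \<exists>q v. frozen_motion \<kappa> \<delta> a b m q v \<and>
                         (\<forall>t. m * (v t)\<^sup>2 / 2 + well \<kappa> \<delta> a b (q t) = E) \<and>
                         least_period q p))"

definition averaged_field ::
  "(real \<Rightarrow> real) \<Rightarrow> ('l::finite \<Rightarrow> real) \<Rightarrow> ('r::finite \<Rightarrow> real) \<Rightarrow> real \<Rightarrow>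
     ('l, 'r) slow \<Rightarrow> ('l, 'r) slow" where
  "averaged_field \<kappa> m1 m2 \<delta> = (\<lambda>(Q, W, E1, E2).
     let F1 = (\<lambda>j. sqrt (8 * m1 j * E1 $ j) / period \<kappa> \<delta> 0 Q (m1 j) (E1 $ j));
         F2 = (\<lambda>j. sqrt (8 * m2 j * E2 $ j) / period \<kappa> \<delta> Q 1 (m2 j) (E2 $ j))
     in (W, (\<Sum>j\<in>UNIV. F1 j) - (\<Sum>j\<in>UNIV. F2 j), (\<chi> j. - W * F1 j), (\<chi> j. W * F2 j)))"

definition averaged_motion ::
  "(real \<Rightarrow> real) \<Rightarrow> ('l::finite \<Rightarrow> real) \<Rightarrow> ('r::finite \<Rightarrow> real) \<Rightarrow> real \<Rightarrow> real \<Rightarrow>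
     (real \<Rightarrow> ('l, 'r) slow) \<Rightarrow> bool" where
  "averaged_motion \<kappa> m1 m2 \<delta> S hbar \<longleftrightarrow>
     (\<forall>\<tau>\<in>{0..S}. (hbar has_vector_derivative averaged_field \<kappa> m1 m2 \<delta> (hbar \<tau>)) (at \<tau> within {0..S}))"

text \<open>
  Joint continuous differentiability of \<open>F \<delta> h\<close> on \<open>[0, d] \<times> V\<close>, where \<open>V\<close> need not be open: in \<open>h\<close>
  it is understood on a neighbourhood of \<open>V\<close>; at the end points of \<open>[0, d]\<close> it is one-sided in \<open>\<delta>\<close>.
\<close>

definition C1_jointly ::
  "(real \<Rightarrow> 'h::real_normed_vector \<Rightarrow> 'h) \<Rightarrow> real \<Rightarrow> 'h set \<Rightarrow> bool" where
  "C1_jointly F d V \<longleftrightarrow>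
     (\<exists>U. open U \<and> V \<subseteq> U \<and>
        (\<exists>D :: real \<times> 'h \<Rightarrow> (real \<times> 'h) \<Rightarrow>\<^sub>L 'h.
           (\<forall>p\<in>{0..d} \<times> U.
              ((\<lambda>(\<delta>, h). F \<delta> h) has_derivative blinfun_apply (D p)) (at p within {0..d} \<times> U)) \<and>
           continuous_on ({0..d} \<times> U) D))"

definition stopping_time :: "'h set \<Rightarrow> real \<Rightarrow> (real \<Rightarrow> 'h) \<Rightarrow> (real \<Rightarrow> 'h) \<Rightarrow> ereal" where
  "stopping_time V \<epsilon> hbar h =
     Inf {ereal \<tau> |\<tau>. \<tau> \<ge> 0 \<and> (hbar \<tau> \<notin> V \<or> h (\<tau> / \<epsilon>) \<notin> V)}"

end

theory Submission
  imports Defs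
begin

text \<open>
  In a box whose length \<open>l\<close> changes slowly, the virial \<open>m q v\<close> of a gas particle has derivative \<open>2 E\<close> minus
  \<open>l\<close> times the force on the moving wall.  Hence \<open>m q v / l\<close> is a corrector: up to \<open>O(\<epsilon>)\<close>, its derivative is
  the averaged force \<open>2 E / l\<close> minus the actual one.  For soft walls, \<open>m q v\<close> is replaced by \<open>2 E\<close> times the time
  elapsed since the turning point, a \<open>C\<^sup>1\<close> function of the state, and \<open>l\<close> by an effective length
  which exceeds \<open>l - 2 \<delta>\<close> by \<open>\<delta>\<close> times a \<open>C\<^sup>1\<close> function of \<open>E\<close>.  Wound onto the circle, the same time function shows
  that the period is proportional to the effective length, so the averaged field is \<open>C\<^sup>1\<close> up to \<open>\<delta> = 0\<close>.

  Adding \<open>\<epsilon>\<close> times the correctors to the slow variables removes the oscillation.  The squared distance to the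
  averaged solution then satisfies a Gronwall inequality whose coefficient contains the forces, which are not
  bounded as \<open>\<delta> \<rightarrow> 0\<close>; but their time integral is controlled by the corrector once more, and can be absorbed into an
  exponential weight.  The resulting functional decreases along the soft core flow as well as along free flights
  and across hard collisions, which gives the bound uniformly in \<open>\<delta>\<close>.
\<close>

subsection \<open>Calculus\<close>

text \<open>The obstacle is uniformity in \<open>\<delta>\<close>: near the piston the force
  \<open>f\<close> is of order \<open>1 / \<delta>\<close>, so it must never be replaced by a bound.
  Every error is kept in the form constant times \<open>\<epsilon> * (1 + f)\<close>. The derivative
  of a corrector contains \<open>- f\<close> while the corrector itself is bounded; subtracting
  twice the sum of the correctors from a multiple of time therefore gives a clock of rate at least
  one plus the sum of the forces, which still advances only by \<open>O(1 / \<epsilon>)\<close>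
  during times up to \<open>T / \<epsilon>\<close>. Adding \<open>\<epsilon>\<^sup>2\<close> to the
  squared distance absorbs terms linear in the distance.

  Hard walls show the same mechanism as a jump: at the piston the corrector drops by exactly the
  momentum transferred, and at a fixed wall it is zero. So collisions need not be counted, and no
  minimal time between them enters.

  The condition \<open>4 * \<delta> \<le> l\<close> makes a particle feel at most one wall at a
  time. In the force-free middle the descriptions from the two walls overlap and are matched; the
  constant of matching is half the period.\<close>

lemma real_antiderivative:
  fixes f :: "real \<Rightarrow> real"
  assumes "continuous_on UNIV f"
  obtains F where "\<And>x. (F has_real_derivative f x) (at x)"
proof -
  have "\<exists>F. \<forall>x::real. (F has_vector_derivative f x) (at x)"
    using einterval_antiderivative[of "-\<infinity>" "\<infinity>" f] assms
    by (auto simp: continuous_on_eq_continuous_at)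
  then show ?thesis
    using that by (auto simp: has_real_derivative_iff_has_vector_derivative)
qed

lemma continuous_on_compose_uncurried:
  assumes "continuous_on (A \<times> B) (\<lambda>(x, y). f x y)"
    and "continuous_on S g" "continuous_on S h"
    and "\<And>p. p \<in> S \<Longrightarrow> g p \<in> A" "\<And>p. p \<in> S \<Longrightarrow> h p \<in> B"
  shows "continuous_on S (\<lambda>p. f (g p) (h p))"
proof -
  have "continuous_on S (\<lambda>p. (\<lambda>(x, y). f x y) (g p, h p))"
    by (rule continuous_on_compose2[OF assms(1)]) (use assms in \<open>auto intro!: continuous_intros\<close>)
  then show ?thesis by simp
qed

text \<open>The integral of \<open>\<phi> _ E\<close> from \<open>0\<close> to \<open>x\<close>,
  rescaled to the fixed interval \<open>{0..1}\<close>: the upper limit becomes a parameter,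
  negative \<open>x\<close> needs no separate case, and theorems on integrals depending on a
  parameter apply.\<close>

definition pint :: "(real \<Rightarrow> real \<Rightarrow> real) \<Rightarrow> real \<Rightarrow> real \<Rightarrow> real" where
  "pint \<phi> x E = x * integral {0..1} (\<lambda>s. \<phi> (x * s) E)"

lemma pint_antiderivative:
  assumes F: "\<And>r. (F has_real_derivative \<phi> r E) (at r)"
  shows "pint \<phi> x E = F x - F 0"
proof -
  have "((\<lambda>s. F (x * s)) has_real_derivative \<phi> (x * s) E * x) (at s)" for s
    by (rule DERIV_chain2[OF F]) (auto intro!: derivative_eq_intros)
  then have "((\<lambda>s. F (x * s)) has_vector_derivative x * \<phi> (x * s) E) (at s within {0..1})" for s
    unfolding has_real_derivative_iff_has_vector_derivative[symmetric]
    by (metis has_field_derivative_at_within mult.commute)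
  then have "((\<lambda>s. x * \<phi> (x * s) E) has_integral F (x * 1) - F (x * 0)) {0..1}"
    by (intro fundamental_theorem_of_calculus) auto
  then show ?thesis
    unfolding pint_def by (simp add: has_integral_iff)
qed

lemma pint_has_real_derivative:
  assumes "continuous_on UNIV (\<lambda>r. \<phi> r E)"
  shows "((\<lambda>x. pint \<phi> x E) has_real_derivative \<phi> x E) (at x)"
proof -
  obtain F where F: "\<And>x. (F has_real_derivative \<phi> x E) (at x)"
    using real_antiderivative[OF assms] by blast
  have "(\<lambda>x. pint \<phi> x E) = (\<lambda>x. F x - F 0)"
    using pint_antiderivative[of F \<phi> E] F by auto
  then show ?thesis
    by (auto intro!: derivative_eq_intros F)
qed

lemma continuous_on_pint:
  assumes "continuous_on (UNIV \<times> U) (\<lambda>(r, E). \<phi> r E)"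
  shows "continuous_on (UNIV \<times> U) (\<lambda>(x, E). pint \<phi> x E)"
proof -
  have "continuous_on ((UNIV \<times> U) \<times> cbox 0 1) (\<lambda>(p, s). \<phi> (fst p * s) (snd p))"
    unfolding case_prod_beta'
    by (rule continuous_on_compose_uncurried[OF assms]) (auto intro!: continuous_intros)
  from integral_continuous_on_param[OF this]
  show ?thesis
    unfolding pint_def by (auto simp: case_prod_beta' intro!: continuous_intros)
qed

text \<open>The \<open>x\<close>-partial is the integrand, and the \<open>E\<close>-partial comes
  from differentiating under the integral, for which \<open>U\<close> is convex. Joint
  differentiability follows because the \<open>E\<close>-partial is jointly continuous.\<close>

lemma pint_has_derivative:
  assumes U: "open U" "convex U" "E \<in> U"
    and cont: "continuous_on (UNIV \<times> U) (\<lambda>(r, E). \<phi> r E)"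
    and deriv: "\<And>r E. E \<in> U \<Longrightarrow> ((\<lambda>E. \<phi> r E) has_real_derivative \<phi>' r E) (at E)"
    and cont': "continuous_on (UNIV \<times> U) (\<lambda>(r, E). \<phi>' r E)"
  shows "((\<lambda>(x, E). pint \<phi> x E) has_derivative
           (\<lambda>(dx, dE). \<phi> x E * dx + pint \<phi>' x E * dE)) (at (x, E))"
proof -
  have dE: "((\<lambda>E. pint \<phi> x E) has_real_derivative pint \<phi>' x E) (at E within U)"
    if E: "E \<in> U" for x E
  proof -
    have c1: "continuous_on (U \<times> cbox 0 1) (\<lambda>(E, s). \<phi>' (x * s) E)"
      unfolding case_prod_beta'
      by (rule continuous_on_compose_uncurried[OF cont']) (auto intro!: continuous_intros)
    have c2: "(\<lambda>s. \<phi> (x * s) E) integrable_on cbox 0 1" if "E \<in> U" for E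
      by (intro integrable_continuous continuous_on_compose_uncurried[OF cont])
        (use that in \<open>auto intro!: continuous_intros\<close>)
    have "((\<lambda>E. integral (cbox 0 1) (\<lambda>s. \<phi> (x * s) E)) has_real_derivative
           integral (cbox 0 1) (\<lambda>s. \<phi>' (x * s) E)) (at E within U)"
      by (rule leibniz_rule_field_derivative[OF _ _ c1 E U(2)])
        (use deriv c2 in \<open>auto intro: has_field_derivative_at_within\<close>)
    then show ?thesis
      unfolding pint_def by (auto intro!: derivative_eq_intros)
  qed
  have "((\<lambda>(x, E). pint \<phi> x E) has_derivative
      (\<lambda>(dx, dE). \<phi> x E * dx + blinfun_mult_right (pint \<phi>' x E) dE)) (at (x, E) within UNIV \<times> U)"
  proof (rule has_derivative_partialsI[where fy = "\<lambda>x E. blinfun_mult_right (pint \<phi>' x E)"])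
    have "continuous_on UNIV (\<lambda>r. \<phi> r E)"
      by (rule continuous_on_compose_uncurried[OF cont]) (use U(3) in \<open>auto intro!: continuous_intros\<close>)
    from pint_has_real_derivative[of \<phi> E, OF this]
    show "((\<lambda>x. pint \<phi> x E) has_derivative (*) (\<phi> x E)) (at x within UNIV)"
      by (simp add: has_field_derivative_def)
  next
    show "((\<lambda>E. pint \<phi> x E) has_derivative blinfun_apply (blinfun_mult_right (pint \<phi>' x E))) (at E within U)"
      if "E \<in> U" for x E
      using dE[OF that, of x] by (simp add: has_field_derivative_def)
  next
    have "continuous_on (UNIV \<times> U) (\<lambda>(x, E). blinfun_mult_right (pint \<phi>' x E))"
      using continuous_on_pint[OF cont'] 
      by (auto simp: case_prod_beta' intro!: continuous_intros bounded_linear.continuous_on[OF bounded_linear_blinfun_mult_right])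
    then show "continuous (at (x, E) within UNIV \<times> U) (\<lambda>(x, E). blinfun_mult_right (pint \<phi>' x E))"
      using U by (auto simp: continuous_on_eq_continuous_within)
  qed (use U in auto)
  moreover have "at (x, E) within UNIV \<times> U = at (x, E)"
    using U by (intro at_within_open) (auto simp: open_Times)
  ultimately show ?thesis
    by simp
qed

lemma pint_curve:
  assumes "open U" "convex U" 
    and "continuous_on (UNIV \<times> U) (\<lambda>(r, E). \<phi> r E)"
    and "\<And>r E. E \<in> U \<Longrightarrow> ((\<lambda>E. \<phi> r E) has_real_derivative \<phi>' r E) (at E)"
    and "continuous_on (UNIV \<times> U) (\<lambda>(r, E). \<phi>' r E)"
    and "E t \<in> U"
    and x: "(x has_real_derivative x') (at t within S)"
    and E: "(E has_real_derivative E') (at t within S)"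
  shows "((\<lambda>t. pint \<phi> (x t) (E t)) has_real_derivative
           \<phi> (x t) (E t) * x' + pint \<phi>' (x t) (E t) * E') (at t within S)"
proof -
  note d = pint_has_derivative[OF assms(1,2,6,3-5), of "x t"]
  have "((\<lambda>t. (x t, E t)) has_derivative (\<lambda>h. (x' * h, E' * h))) (at t within S)"
    using x E by (auto simp: has_field_derivative_def intro!: has_derivative_Pair)
  from has_derivative_in_compose[OF this has_derivative_at_withinI[OF d]]
  have "((\<lambda>t. pint \<phi> (x t) (E t)) has_derivative
      (\<lambda>h. \<phi> (x t) (E t) * (x' * h) + pint \<phi>' (x t) (E t) * (E' * h))) (at t within S)"
    by simp
  moreover have "(\<lambda>h. \<phi> (x t) (E t) * (x' * h) + pint \<phi>' (x t) (E t) * (E' * h))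
      = (*) (\<phi> (x t) (E t) * x' + pint \<phi>' (x t) (E t) * E')"
    by (auto simp: algebra_simps)
  ultimately show ?thesis
    by (simp add: has_field_derivative_def)
qed

lemma pint_abs_le:
  assumes "continuous_on UNIV (\<lambda>r. \<phi> r E)"
    and "\<And>r. \<bar>r\<bar> \<le> \<bar>x\<bar> \<Longrightarrow> \<bar>\<phi> r E\<bar> \<le> C"
  shows "\<bar>pint \<phi> x E\<bar> \<le> C * \<bar>x\<bar>"
proof -
  have "continuous_on (cbox 0 1) (\<lambda>s. \<phi> (x * s) E)"
    by (rule continuous_on_compose2[OF assms(1)]) (auto intro!: continuous_intros)
  then have "norm (integral {0..1} (\<lambda>s. \<phi> (x * s) E)) \<le> C * (1 - 0)"
    by (intro integral_bound) (auto intro!: assms simp: abs_mult mult_left_le)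
  then show ?thesis
    unfolding pint_def by (simp add: abs_mult mult_left_mono mult.commute[of C])
qed

lemma pint_nonneg:
  assumes "continuous_on UNIV (\<lambda>r. \<phi> r E)" "x \<ge> 0"
    and "\<And>r. 0 \<le> r \<Longrightarrow> r \<le> x \<Longrightarrow> 0 \<le> \<phi> r E"
  shows "0 \<le> pint \<phi> x E"
proof -
  have "continuous_on (cbox 0 1) (\<lambda>s. \<phi> (x * s) E)"
    by (rule continuous_on_compose2[OF assms(1)]) (auto intro!: continuous_intros)
  then have "0 \<le> integral {0..1} (\<lambda>s. \<phi> (x * s) E)"
    using assms(2) by (intro integral_nonneg integrable_continuous_interval)
      (auto intro!: assms mult_left_le)
  then show ?thesis
    unfolding pint_def using assms by auto
qed

lemma pint_eq_0:
  assumes "\<And>r. 0 \<le> r \<Longrightarrow> r \<le> x \<Longrightarrow> \<phi> r E = 0" "x \<ge> 0"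
  shows "pint \<phi> x E = 0"
proof -
  have "integral {0..1} (\<lambda>s. \<phi> (x * s) E) = integral {0..1} (\<lambda>s::real. 0)"
    using assms(2) by (intro Henstock_Kurzweil_Integration.integral_cong assms(1)) (auto simp: mult_left_le)
  then show ?thesis by (simp add: pint_def)
qed

text \<open>Only class \<open>C^1\<close> is asked for, so the normalised antiderivative of a
  continuous bump on \<open>{a..b}\<close> suffices.\<close>

lemma smooth_cutoff:
  fixes a b :: real
  assumes "a < b"
  obtains \<alpha> \<alpha>' where "\<And>x. (\<alpha> has_real_derivative \<alpha>' x) (at x)" "continuous_on UNIV \<alpha>'"
    "\<And>x. x \<le> a \<Longrightarrow> \<alpha> x = 0" "\<And>x. b \<le> x \<Longrightarrow> \<alpha> x = 1" "\<And>x. 0 \<le> \<alpha> x \<and> \<alpha> x \<le> 1"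
    "\<And>x. x \<le> a \<Longrightarrow> \<alpha>' x = 0"
proof -
  define \<rho> where "\<rho> = (\<lambda>x. max 0 ((x - a) * (b - x)))"
  have c: "continuous_on UNIV \<rho>"
    unfolding \<rho>_def by (intro continuous_intros)
  obtain R where R: "\<And>x. (R has_real_derivative \<rho> x) (at x)"
    using real_antiderivative[OF c] by blast
  have mono: "R x \<le> R y" if "x \<le> y" for x y
  proof (rule DERIV_nonneg_imp_nondecreasing[OF that])
    show "\<exists>D. (R has_real_derivative D) (at r) \<and> D \<ge> 0" for r
      using R[of r] by (intro exI[of _ "\<rho> r"]) (simp add: \<rho>_def)
  qed
  have zero: "\<rho> x = 0" if "x \<le> a \<or> b \<le> x" for x
  proof -
    have "(x - a) * (b - x) \<le> 0"
      using that assms by (auto simp: mult_le_0_iff)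
    then show ?thesis by (simp add: \<rho>_def)
  qed
  have low: "R x = R a" if "x \<le> a" for x
  proof (rule antisym)
    show "R a \<le> R x"
    proof (rule DERIV_nonpos_imp_nonincreasing[OF that])
      show "\<exists>D. (R has_real_derivative D) (at r) \<and> D \<le> 0" if "r \<le> a" for r
        using R[of r] zero[of r] that by auto
    qed
  qed (rule mono[OF that])
  have high: "R x = R b" if "b \<le> x" for x
  proof (rule antisym)
    show "R x \<le> R b"
    proof (rule DERIV_nonpos_imp_nonincreasing[OF that])
      show "\<exists>D. (R has_real_derivative D) (at r) \<and> D \<le> 0" if "b \<le> r" for r
        using R[of r] zero[of r] that by auto
    qed
  qed (rule mono[OF that])
  have "R a < R b"
  proof (rule DERIV_pos_imp_increasing_open[OF assms])
    show "\<exists>y. (R has_real_derivative y) (at x) \<and> 0 < y" if "a < x" "x < b" for x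
      using R[of x] that by (intro exI[of _ "\<rho> x"]) (auto simp: \<rho>_def max_def)
    show "continuous_on {a..b} R"
      by (rule DERIV_continuous_on[OF has_field_derivative_at_within[OF R]])
  qed
  define \<alpha> where "\<alpha> = (\<lambda>x. (R x - R a) / (R b - R a))"
  define \<alpha>' where "\<alpha>' = (\<lambda>x. \<rho> x / (R b - R a))"
  show ?thesis
  proof (rule that[of \<alpha> \<alpha>'])
    show "0 \<le> \<alpha> x \<and> \<alpha> x \<le> 1" for x
    proof -
      have "R a \<le> R x" "R x \<le> R b"
        using \<open>R a < R b\<close> mono[of a x] mono[of x b] low[of x] high[of x] by linarith+
      then show ?thesis using \<open>R a < R b\<close> by (simp add: \<alpha>_def)
    qed
    show "(\<alpha> has_real_derivative \<alpha>' x) (at x)" for x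
      unfolding \<alpha>_def \<alpha>'_def using \<open>R a < R b\<close> by (auto intro!: derivative_eq_intros R)
    show "continuous_on UNIV \<alpha>'"
      unfolding \<alpha>'_def using \<open>R a < R b\<close> by (intro continuous_intros c) auto
    show "\<alpha> x = 0" if "x \<le> a" for x
      using low[OF that] by (simp add: \<alpha>_def)
    show "\<alpha> x = 1" if "b \<le> x" for x
      using high[OF that] \<open>R a < R b\<close> by (simp add: \<alpha>_def)
    show "\<alpha>' x = 0" if "x \<le> a" for x
      using zero[of x] that by (simp add: \<alpha>'_def)
  qed
qed

text \<open>The supremum of the times up to which \<open>\<Phi>\<close> stays below
  \<open>\<Phi> a\<close> is itself such a time by \<open>left\<close>, and cannot be smaller than
  \<open>b\<close> by \<open>right\<close>. \<open>\<Phi>\<close> may be discontinuous and the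
  neighbourhoods may shrink without a lower bound, so collision times can be handled one by
  one.\<close>

lemma locally_antimono_imp_le:
  fixes \<Phi> :: "real \<Rightarrow> real"
  assumes "a \<le> b"
    and left: "\<And>t. a < t \<Longrightarrow> t \<le> b \<Longrightarrow> \<exists>\<eta>>0. \<forall>s\<in>{a..<t}. t - \<eta> < s \<longrightarrow> \<Phi> t \<le> \<Phi> s"
    and right: "\<And>t. a \<le> t \<Longrightarrow> t < b \<Longrightarrow> \<exists>\<eta>>0. \<forall>s\<in>{t<..b}. s < t + \<eta> \<longrightarrow> \<Phi> s \<le> \<Phi> t"
  shows "\<Phi> b \<le> \<Phi> a"
proof -
  define A where "A = {t \<in> {a..b}. \<forall>s\<in>{a..t}. \<Phi> s \<le> \<Phi> a}"
  have aA: "a \<in> A" using assms(1) by (auto simp: A_def)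
  have bdd: "bdd_above A" by (rule bdd_aboveI[of _ b]) (auto simp: A_def)
  define t where "t = Sup A"
  have at: "a \<le> t" unfolding t_def by (rule cSup_upper[OF aA bdd])
  have tb: "t \<le> b" unfolding t_def by (rule cSup_least) (use aA in \<open>auto simp: A_def\<close>)
  have below: "\<Phi> s \<le> \<Phi> a" if "a \<le> s" "s < t" for s
  proof -
    obtain u where "u \<in> A" "s < u"
      using \<open>s < t\<close> less_cSup_iff[of A s] aA bdd unfolding t_def by blast
    then show ?thesis using that by (auto simp: A_def)
  qed
  have at_t: "\<Phi> t \<le> \<Phi> a"
  proof (cases "a = t")
    case False
    then have "a < t" using at by simp
    then obtain \<eta> where "\<eta> > 0" and \<eta>: "\<And>s. a \<le> s \<Longrightarrow> s < t \<Longrightarrow> t - \<eta> < s \<Longrightarrow> \<Phi> t \<le> \<Phi> s"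
      using left[of t] tb by auto
    define s where "s = max a (t - \<eta> / 2)"
    have "a \<le> s" "s < t" "t - \<eta> < s"
      using \<open>\<eta> > 0\<close> \<open>a < t\<close> by (auto simp: s_def)
    then show ?thesis using \<eta>[of s] below[of s] by linarith
  qed auto
  show ?thesis
  proof (cases "t = b")
    case True
    then show ?thesis using at_t by simp
  next
    case False
    then have "t < b" using tb by simp
    then obtain \<eta> where "\<eta> > 0" and \<eta>: "\<And>s. t < s \<Longrightarrow> s \<le> b \<Longrightarrow> s < t + \<eta> \<Longrightarrow> \<Phi> s \<le> \<Phi> t"
      using right[of t] at by auto
    define s where "s = min b (t + \<eta> / 2)"
    have s: "t < s" "s \<le> b" "s < t + \<eta>"
      using \<open>\<eta> > 0\<close> \<open>t < b\<close> by (auto simp: s_def)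
    have "\<Phi> r \<le> \<Phi> a" if "a \<le> r" "r \<le> s" for r
      using that below[of r] at_t \<eta>[of r] s by (cases "r < t"; cases "r = t") auto
    then have "s \<in> A" using s at by (auto simp: A_def)
    then have "s \<le> t" unfolding t_def by (rule cSup_upper[OF _ bdd])
    then show ?thesis using s by simp
  qed
qed

subsection \<open>Newton's equation with a Lipschitz force\<close>

text \<open>The explicit formula is Cauchy's formula for the repeated integral, rescaled to
  \<open>{0..1}\<close>. It turns the second order equation into a single scalar fixed point
  equation for the position.\<close>

lemma antiderivative_twice:
  fixes f :: "real \<Rightarrow> real"
  assumes "continuous_on UNIV f"
  obtains G H where "\<And>t. (G has_real_derivative f t) (at t)" "\<And>t. (H has_real_derivative G t) (at t)"
    "G 0 = 0" "\<And>t. H t = t\<^sup>2 * integral {0..1} (\<lambda>r. (1 - r) * f (t * r))"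
proof -
  obtain G0 where G0: "\<And>t. (G0 has_real_derivative f t) (at t)"
    using real_antiderivative[OF assms] by blast
  define G where "G = (\<lambda>t. G0 t - G0 0)"
  have G: "(G has_real_derivative f t) (at t)" for t
    unfolding G_def by (auto intro!: derivative_eq_intros G0)
  have "continuous_on UNIV G"
    by (rule DERIV_continuous_on[OF has_field_derivative_at_within[OF G]])
  then obtain H0 where H0: "\<And>t. (H0 has_real_derivative G t) (at t)"
    using real_antiderivative by blast
  define H where "H = (\<lambda>t. H0 t - H0 0)"
  have H: "(H has_real_derivative G t) (at t)" for t
    unfolding H_def by (auto intro!: derivative_eq_intros H0)
  have 0: "G 0 = 0" "H 0 = 0"
    by (auto simp: G_def H_def)
  have "H t = t\<^sup>2 * integral {0..1} (\<lambda>r. (1 - r) * f (t * r))" for t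
  proof -
    have Gt: "((\<lambda>r. G (t * r)) has_real_derivative f (t * r) * t) (at r)" for r
      by (rule DERIV_chain2[OF G]) (auto intro!: derivative_eq_intros)
    have Ht: "((\<lambda>r. H (t * r)) has_real_derivative G (t * r) * t) (at r)" for r
      by (rule DERIV_chain2[OF H]) (auto intro!: derivative_eq_intros)
    \<comment> \<open>Integration by parts: the second summand is chosen so that the terms with
      \<open>G\<close> cancel in the derivative.\<close>
    have "((\<lambda>r. H (t * r) + (1 - r) * t * G (t * r)) has_real_derivative t\<^sup>2 * ((1 - r) * f (t * r))) (at r)" for r
      by (rule derivative_eq_intros Gt Ht refl)+ (simp add: algebra_simps power2_eq_square)
    then have "((\<lambda>r. H (t * r) + (1 - r) * t * G (t * r)) has_vector_derivative t\<^sup>2 * ((1 - r) * f (t * r))) (at r within {0..1})" for r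
      unfolding has_real_derivative_iff_has_vector_derivative[symmetric]
      by (rule has_field_derivative_at_within)
    then have "((\<lambda>r. t\<^sup>2 * ((1 - r) * f (t * r))) has_integral
        (H (t * 1) + (1 - 1) * t * G (t * 1)) - (H (t * 0) + (1 - 0) * t * G (t * 0))) {0..1}"
      by (intro fundamental_theorem_of_calculus) auto
    then show ?thesis
      using 0 by (simp add: has_integral_iff)
  qed
  with G H 0 show ?thesis using that by blast
qed

text \<open>For \<open>a > 0\<close> the integral equals \<open>(exp a - 1 - a) / a\<^sup>2\<close>.
  In the contraction estimate the weight removes the exponential, and the gain
  \<open>1 / a\<^sup>2\<close> remains.\<close>

lemma integral_weighted_exp_le:
  fixes a :: real
  assumes "0 \<le> a"
  shows "integral {0..1} (\<lambda>r. (1 - r) * exp (a * r)) * a\<^sup>2 \<le> exp a"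
proof (cases "a = 0")
  case False
  have "((\<lambda>r. (1 - r) * exp (a * r) / a + exp (a * r) / a\<^sup>2) has_real_derivative (1 - r) * exp (a * r)) (at r)" for r
    using False by (auto intro!: derivative_eq_intros simp: field_simps power2_eq_square)
  then have "((\<lambda>r. (1 - r) * exp (a * r) / a + exp (a * r) / a\<^sup>2) has_vector_derivative (1 - r) * exp (a * r)) (at r within {0..1})" for r
    unfolding has_real_derivative_iff_has_vector_derivative[symmetric]
    by (rule has_field_derivative_at_within)
  then have "((\<lambda>r. (1 - r) * exp (a * r)) has_integral
      ((1 - 1) * exp (a * 1) / a + exp (a * 1) / a\<^sup>2) - ((1 - 0) * exp (a * 0) / a + exp (a * 0) / a\<^sup>2)) {0..1}"
    by (intro fundamental_theorem_of_calculus) auto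
  then have "integral {0..1} (\<lambda>r. (1 - r) * exp (a * r)) = exp a / a\<^sup>2 - (1 / a + 1 / a\<^sup>2)"
    by (simp add: has_integral_iff)
  also have "\<dots> \<le> exp a / a\<^sup>2"
  proof -
    have "0 \<le> 1 / a + 1 / a\<^sup>2"
      using assms by (intro add_nonneg_nonneg) auto
    then show ?thesis by linarith
  qed
  finally show ?thesis
    using False by (simp add: field_simps)
qed auto

lemma square_le_exp_abs:
  fixes t :: real
  assumes "0 < \<mu>"
  shows "\<mu>\<^sup>2 * t\<^sup>2 \<le> 2 * exp (\<mu> * \<bar>t\<bar>)"
proof -
  have "(\<mu> * \<bar>t\<bar>)\<^sup>2 / 2 \<le> exp (\<mu> * \<bar>t\<bar>)"
    using exp_lower_Taylor_quadratic[of "\<mu> * \<bar>t\<bar>"] assms by (smt (verit) mult_nonneg_nonneg)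
  then show ?thesis by (simp add: power_mult_distrib)
qed

text \<open>
  Picard iteration in the exponentially weighted supremum norm, in which the integral operator is
  a contraction on the whole time axis.
\<close>

lemma newton_solution_exists:
  fixes F :: "real \<Rightarrow> real"
  assumes lip: "\<And>x y. \<bar>F x - F y\<bar> \<le> l * \<bar>x - y\<bar>" and bound: "\<And>x. \<bar>F x\<bar> \<le> B"
  obtains q v where "\<And>t. (q has_real_derivative v t) (at t)"
    "\<And>t. (v has_real_derivative F (q t)) (at t)" "q 0 = q0" "v 0 = 0"
proof -
  have "0 \<le> l" using lip[of 1 0] by auto
  have "0 \<le> B" using bound[of 0] by simp
  \<comment> \<open>In the weighted norm the operator has Lipschitz constant
    \<open>l / \<mu>\<^sup>2\<close>, which this choice makes at most \<open>1 / 2\<close>. The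
    summand \<open>1\<close> also gives \<open>1 \<le> \<mu>\<^sup>2\<close>, used for the
    boundedness of the image.\<close>
  define \<mu> where "\<mu> = sqrt (2 * l + 1)"
  have \<mu>: "0 < \<mu>" "\<mu>\<^sup>2 = 2 * l + 1"
    using \<open>0 \<le> l\<close> by (auto simp: \<mu>_def)
  have contF: "continuous_on UNIV F"
    by (rule lipschitz_on_continuous_on[of l], rule lipschitz_onI)
      (use lip \<open>0 \<le> l\<close> in \<open>auto simp: dist_real_def\<close>)
  \<comment> \<open>The unknown \<open>y\<close> is the displacement from \<open>q0\<close> divided
    by the exponential weight, hence a bounded continuous function on the whole line.\<close>
  define Q where "Q = (\<lambda>(y :: real \<Rightarrow>\<^sub>C real) t. q0 + exp (\<mu> * \<bar>t\<bar>) * apply_bcontfun y t)"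
  have contQ: "continuous_on UNIV (Q y)" for y
    unfolding Q_def by (intro continuous_intros continuous_on_apply_bcontfun)
  have contFQ: "continuous_on UNIV (\<lambda>t. F (Q y t))" for y
    by (rule continuous_on_compose2[OF contF contQ]) simp
  define J where "J = (\<lambda>y t. integral {0..1} (\<lambda>r. (1 - r) * F (Q y (t * r))))"
  have cont_integrand: "continuous_on (UNIV \<times> cbox 0 1) (\<lambda>(t, r). (1 - r) * F (Q y (t * r)))" for y
    by (auto simp: case_prod_beta' intro!: continuous_intros continuous_on_compose2[OF contFQ])
  have integrable: "(\<lambda>r. (1 - r) * F (Q y (t * r))) integrable_on cbox 0 1" for y t
    by (intro integrable_continuous continuous_intros continuous_on_compose2[OF contFQ]) auto
  have contJ: "continuous_on UNIV (J y)" for y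
    using integral_continuous_on_param[OF cont_integrand[of y]] by (simp add: J_def)
  have J_bound: "\<bar>J y t\<bar> \<le> B" for y t
  proof -
    have "norm (integral {0..1} (\<lambda>r. (1 - r) * F (Q y (t * r)))) \<le> B * (1 - 0)"
      by (intro integral_bound continuous_intros continuous_on_compose2[OF contFQ])
        (auto simp: abs_mult intro!: order_trans[OF mult_left_le_one_le bound])
    then show ?thesis by (simp add: J_def)
  qed
  define \<Psi> where "\<Psi> = (\<lambda>y t. exp (- \<mu> * \<bar>t\<bar>) * (t\<^sup>2 * J y t))"
  have weight: "\<mu>\<^sup>2 * (exp (- \<mu> * \<bar>t\<bar>) * t\<^sup>2) \<le> 2" for t
  proof -
    have "exp (- \<mu> * \<bar>t\<bar>) * (\<mu>\<^sup>2 * t\<^sup>2) \<le> exp (- \<mu> * \<bar>t\<bar>) * (2 * exp (\<mu> * \<bar>t\<bar>))"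
      by (intro mult_left_mono square_le_exp_abs \<mu>) simp
    also have "\<dots> = 2"
      by (simp add: exp_minus)
    finally show ?thesis by (simp add: algebra_simps)
  qed
  have "\<Psi> y \<in> bcontfun" for y
  proof -
    have "\<bar>\<Psi> y t\<bar> \<le> 2 * B" for t
    proof -
      have "exp (- \<mu> * \<bar>t\<bar>) * t\<^sup>2 \<le> \<mu>\<^sup>2 * (exp (- \<mu> * \<bar>t\<bar>) * t\<^sup>2)"
        using \<mu>(2) \<open>0 \<le> l\<close> mult_right_mono[of 1 "\<mu>\<^sup>2" "exp (- \<mu> * \<bar>t\<bar>) * t\<^sup>2"] by simp
      then have "exp (- \<mu> * \<bar>t\<bar>) * t\<^sup>2 \<le> 2"
        using weight[of t] by linarith
      then have "exp (- \<mu> * \<bar>t\<bar>) * t\<^sup>2 * \<bar>J y t\<bar> \<le> 2 * B"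
        by (intro mult_mono J_bound) auto
      then show ?thesis by (simp add: \<Psi>_def abs_mult mult.assoc)
    qed
    then have "bounded (range (\<Psi> y))"
      by (auto simp: bounded_iff)
    moreover have "continuous_on UNIV (\<Psi> y)"
      unfolding \<Psi>_def by (intro continuous_intros contJ)
    ultimately show ?thesis by (simp add: bcontfun_def)
  qed
  then have apply_\<Psi>: "apply_bcontfun (Bcontfun (\<Psi> y)) = \<Psi> y" for y
    by (rule Bcontfun_inverse)
  have contraction: "dist (Bcontfun (\<Psi> y)) (Bcontfun (\<Psi> z)) \<le> 1 / 2 * dist y z" for y z
  proof (rule dist_bound)
    fix t
    define a where "a = \<mu> * \<bar>t\<bar>"
    have a: "0 \<le> a" using \<mu> by (simp add: a_def)
    have "\<bar>J y t - J z t\<bar> = \<bar>integral {0..1} (\<lambda>r. (1 - r) * F (Q y (t * r)) - (1 - r) * F (Q z (t * r)))\<bar>"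
      unfolding J_def using integrable by (subst integral_diff) auto
    also have "\<dots> \<le> integral {0..1} (\<lambda>r. l * dist y z * ((1 - r) * exp (a * r)))"
    proof (rule integral_norm_bound_integral[where 'a = real, unfolded real_norm_def])
      show "(\<lambda>r. (1 - r) * F (Q y (t * r)) - (1 - r) * F (Q z (t * r))) integrable_on {0..1}"
        using integrable by (intro integrable_diff) auto
      show "(\<lambda>r. l * dist y z * ((1 - r) * exp (a * r))) integrable_on {0..1}"
        by (intro integrable_continuous_interval continuous_intros)
      fix r :: real
      assume r: "r \<in> {0..1}"
      have "\<bar>F (Q y (t * r)) - F (Q z (t * r))\<bar> \<le> l * \<bar>Q y (t * r) - Q z (t * r)\<bar>"
        by (rule lip)
      also have "Q y (t * r) - Q z (t * r) = exp (a * r) * (apply_bcontfun y (t * r) - apply_bcontfun z (t * r))"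
        using r by (simp add: Q_def a_def abs_mult algebra_simps)
      also have "l * \<bar>\<dots>\<bar> \<le> l * (exp (a * r) * dist y z)"
        using dist_bounded[of y "t * r" z] \<open>0 \<le> l\<close>
        by (intro mult_left_mono) (auto simp: abs_mult dist_real_def)
      finally have "(1 - r) * \<bar>F (Q y (t * r)) - F (Q z (t * r))\<bar> \<le> (1 - r) * (l * (exp (a * r) * dist y z))"
        using r by (intro mult_left_mono) auto
      moreover have "\<bar>(1 - r) * F (Q y (t * r)) - (1 - r) * F (Q z (t * r))\<bar>
          = (1 - r) * \<bar>F (Q y (t * r)) - F (Q z (t * r))\<bar>"
        using r by (simp add: abs_mult flip: right_diff_distrib)
      ultimately show "\<bar>(1 - r) * F (Q y (t * r)) - (1 - r) * F (Q z (t * r))\<bar>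
          \<le> l * dist y z * ((1 - r) * exp (a * r))"
        by (simp add: mult_ac)
    qed
    finally have *: "\<bar>J y t - J z t\<bar> \<le> l * dist y z * integral {0..1} (\<lambda>r. (1 - r) * exp (a * r))"
      by simp
    have "\<mu>\<^sup>2 * t\<^sup>2 * \<bar>J y t - J z t\<bar>
        \<le> \<mu>\<^sup>2 * t\<^sup>2 * (l * dist y z * integral {0..1} (\<lambda>r. (1 - r) * exp (a * r)))"
      by (rule mult_left_mono[OF *]) simp
    also have "\<mu>\<^sup>2 * t\<^sup>2 = a\<^sup>2"
      by (simp add: a_def power_mult_distrib)
    also have "a\<^sup>2 * (l * dist y z * integral {0..1} (\<lambda>r. (1 - r) * exp (a * r)))
        = l * dist y z * (integral {0..1} (\<lambda>r. (1 - r) * exp (a * r)) * a\<^sup>2)"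
      by (rule mult.commute[THEN trans]) (simp only: mult.assoc)
    also have "\<dots> \<le> l * dist y z * exp a"
      using \<open>0 \<le> l\<close> by (intro mult_left_mono integral_weighted_exp_le a) auto
    finally have "exp (- a) * (a\<^sup>2 * \<bar>J y t - J z t\<bar>) \<le> exp (- a) * (l * dist y z * exp a)"
      by (intro mult_left_mono) auto
    also have "\<dots> = l * dist y z"
      by (simp add: exp_minus)
    finally have "\<mu>\<^sup>2 * dist (\<Psi> y t) (\<Psi> z t) \<le> l * dist y z"
      unfolding \<Psi>_def dist_real_def right_diff_distrib[symmetric] abs_mult
      by (simp add: a_def power_mult_distrib mult_ac)
    also have "l * dist y z \<le> (2 * l + 1) * (1 / 2 * dist y z)"
      by (simp add: distrib_right)
    finally have "(2 * l + 1) * dist (\<Psi> y t) (\<Psi> z t) \<le> (2 * l + 1) * (1 / 2 * dist y z)"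
      unfolding \<mu>(2) .
    then have "dist (\<Psi> y t) (\<Psi> z t) \<le> 1 / 2 * dist y z"
      using \<open>0 \<le> l\<close> by (simp del: dist_commute add: mult_le_cancel_left_pos)
    then show "dist (apply_bcontfun (Bcontfun (\<Psi> y)) t) (apply_bcontfun (Bcontfun (\<Psi> z)) t) \<le> 1 / 2 * dist y z"
      by (simp add: apply_\<Psi>)
  qed
  obtain y where y: "Bcontfun (\<Psi> y) = y"
    using banach_fix_type[of "1/2" "\<lambda>y. Bcontfun (\<Psi> y)"] contraction by auto
  obtain G H where G: "\<And>t. (G has_real_derivative F (Q y t)) (at t)"
    and H: "\<And>t. (H has_real_derivative G t) (at t)" and "G 0 = 0"
    and H_eq: "\<And>t. H t = t\<^sup>2 * integral {0..1} (\<lambda>r. (1 - r) * F (Q y (t * r)))"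
    using antiderivative_twice[OF contFQ[of y]] by blast
  have "apply_bcontfun y t = exp (- \<mu> * \<bar>t\<bar>) * H t" for t
    using apply_\<Psi>[of y] unfolding y by (simp add: \<Psi>_def H_eq J_def)
  then have Q: "Q y t = q0 + H t" for t
    by (simp add: Q_def exp_minus)
  show ?thesis
  proof (rule that[of "Q y" G])
    show "(Q y has_real_derivative G t) (at t)" for t
    proof -
      have "Q y = (\<lambda>t. q0 + H t)" using Q by auto
      then show ?thesis by (auto intro!: derivative_eq_intros H)
    qed
    show "Q y 0 = q0" using Q[of 0] H_eq[of 0] by simp
  qed (fact G \<open>G 0 = 0\<close>)+
qed

subsection \<open>The time spent near a soft wall\<close>

text \<open>All energies lie between \<open>k0\<close> and \<open>k1\<close>: below
  \<open>\<kappa> 0\<close>, so that no wall is passed, and away from zero. Where the potential is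
  at most \<open>k0 / 2\<close>, the kinetic energy is at least \<open>k0 / 2\<close> and the
  velocity does not vanish; where it is at least \<open>k0 / 4\<close>, the slope
  \<open>\<kappa>'\<close> does not vanish. The cutoff \<open>\<alpha>\<close>, applied to the
  potential, switches between these two regimes.\<close>

locale soft_core =
  fixes \<kappa> \<kappa>' \<kappa>'' :: "real \<Rightarrow> real" and k0 k1 :: real and \<alpha> \<alpha>' :: "real \<Rightarrow> real"
  assumes \<kappa>_deriv: "(\<kappa> has_real_derivative \<kappa>' x) (at x)"
    and \<kappa>'_deriv: "(\<kappa>' has_real_derivative \<kappa>'' x) (at x)"
    and \<kappa>''_cont: "continuous_on UNIV \<kappa>''"
    and \<kappa>_zero: "1 \<le> x \<Longrightarrow> \<kappa> x = 0"
    and \<kappa>'_neg: "x < 1 \<Longrightarrow> \<kappa>' x < 0"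
    and k: "0 < k0" "k0 < k1" "k1 < \<kappa> 0"
    and \<alpha>_deriv: "(\<alpha> has_real_derivative \<alpha>' x) (at x)"
    and \<alpha>'_cont: "continuous_on UNIV \<alpha>'"
    and \<alpha>_low: "x \<le> k0 / 4 \<Longrightarrow> \<alpha> x = 0" and \<alpha>_high: "k0 / 2 \<le> x \<Longrightarrow> \<alpha> x = 1"
    and \<alpha>_bounds: "0 \<le> \<alpha> x" "\<alpha> x \<le> 1"
    and \<alpha>'_low: "x \<le> k0 / 4 \<Longrightarrow> \<alpha>' x = 0"
begin

lemma \<kappa>_cont: "continuous_on S \<kappa>"
  using DERIV_continuous_on[OF has_field_derivative_at_within[OF \<kappa>_deriv]] .

lemma \<kappa>'_cont: "continuous_on S \<kappa>'"
  using DERIV_continuous_on[OF has_field_derivative_at_within[OF \<kappa>'_deriv]] .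

lemma \<alpha>_cont: "continuous_on S \<alpha>"
  using DERIV_continuous_on[OF has_field_derivative_at_within[OF \<alpha>_deriv]] .

lemma \<kappa>_strict_antimono: "\<kappa> y < \<kappa> x" if "x < y" "y \<le> 1"
proof (rule DERIV_neg_imp_decreasing_open[OF that(1)])
  show "\<exists>D. (\<kappa> has_real_derivative D) (at z) \<and> D < 0" if "x < z" "z < y" for z
    using \<kappa>_deriv[of z] \<kappa>'_neg[of z] that \<open>y \<le> 1\<close> by fastforce
qed (rule \<kappa>_cont)

lemma \<kappa>_pos: "x < 1 \<Longrightarrow> 0 < \<kappa> x"
  using \<kappa>_strict_antimono[of x 1] \<kappa>_zero[of 1] by simp

lemma \<kappa>_nonneg: "0 \<le> \<kappa> x"
  using \<kappa>_pos[of x] \<kappa>_zero[of x] by (cases "x < 1") auto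

lemma \<kappa>_antimono: "x \<le> y \<Longrightarrow> \<kappa> y \<le> \<kappa> x"
  using \<kappa>_strict_antimono[of x y] \<kappa>_zero[of y] \<kappa>_nonneg[of x]
  by (cases "y \<le> 1"; cases "x = y") auto

text \<open>A nonnegative function has a minimum wherever it vanishes; this includes the point
  \<open>1\<close>, where \<open>\<kappa>\<close> is constant on one side only.\<close>

lemma \<kappa>'_zero: "1 \<le> x \<Longrightarrow> \<kappa>' x = 0"
  by (rule DERIV_local_min[OF \<kappa>_deriv, of 1]) (use \<kappa>_zero \<kappa>_nonneg in auto)

lemma \<kappa>'_nonpos: "\<kappa>' x \<le> 0"
  using \<kappa>'_neg[of x] \<kappa>'_zero[of x] by (cases "x < 1") auto

lemma \<kappa>_less_imp_pos: "\<kappa> x < \<kappa> 0 \<Longrightarrow> 0 < x"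
  using \<kappa>_antimono[of x 0] by (cases "0 < x") auto

section \<open>The time integral in the velocity variable: its weight\<close>

definition core_inv :: "real \<Rightarrow> real" where
  "core_inv = inv_into {0..1} \<kappa>"

lemma \<kappa>_inj: "inj_on \<kappa> {0..1}"
  by (rule linorder_inj_onI) (use \<kappa>_strict_antimono in force)+

lemma core_inv_\<kappa>: "0 \<le> x \<Longrightarrow> x \<le> 1 \<Longrightarrow> core_inv (\<kappa> x) = x"
  unfolding core_inv_def by (rule inv_into_f_f[OF \<kappa>_inj]) auto

lemma core_inv:
  assumes "0 < e" "e < \<kappa> 0"
  shows "0 < core_inv e" "core_inv e < 1" "\<kappa> (core_inv e) = e"
proof -
  have "\<exists>x\<ge>0. x \<le> 1 \<and> \<kappa> x = e"
    by (rule IVT2'[of \<kappa> 1 e 0]) (use assms \<kappa>_zero[of 1] \<kappa>_cont in auto)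
  then obtain x where x: "0 \<le> x" "x \<le> 1" "\<kappa> x = e" by auto
  then have "core_inv e = x" using core_inv_\<kappa> by auto
  moreover have "x \<noteq> 0" "x \<noteq> 1" using x assms \<kappa>_zero[of 1] by auto
  ultimately show "0 < core_inv e" "core_inv e < 1" "\<kappa> (core_inv e) = e"
    using x by auto
qed

lemma core_inv_deriv:
  assumes "0 < e" "e < \<kappa> 0"
  shows "(core_inv has_real_derivative inverse (\<kappa>' (core_inv e))) (at e)"
proof -
  have "\<kappa>' (core_inv e) \<noteq> 0"
    using \<kappa>'_neg[of "core_inv e"] core_inv[OF assms] by simp
  then have "(core_inv has_derivative (*) (inverse (\<kappa>' (core_inv e)))) (at (\<kappa> (core_inv e)))"
    by (intro has_derivative_inverse_strong[of "{0<..<1}" _ \<kappa> _ "(*) (\<kappa>' (core_inv e))"])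
      (use core_inv[OF assms] core_inv_\<kappa> \<kappa>_cont \<kappa>_deriv in \<open>auto simp: has_field_derivative_def fun_eq_iff\<close>)
  then show ?thesis
    using core_inv[OF assms] by (simp add: has_field_derivative_def)
qed

text \<open>At constant energy \<open>E = \<kappa> x + w\<^sup>2\<close> one has
  \<open>dx / w = 2 dw / (- \<kappa>' x)\<close>, and \<open>x\<close> is recovered from the
  potential energy \<open>e = E - w\<^sup>2\<close> by \<open>core_inv\<close>. The factor
  \<open>\<alpha>\<close> kills the singularity at \<open>e = 0\<close>, where
  \<open>\<kappa>'\<close> tends to zero, and extends the weight by zero to
  \<open>e \<le> 0\<close>, where the value of \<open>core_inv\<close> is meaningless.\<close>

definition gA :: "real \<Rightarrow> real" where
  "gA e = \<alpha> e / - \<kappa>' (core_inv e)"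

definition gA' :: "real \<Rightarrow> real" where
  "gA' e = \<alpha>' e / - \<kappa>' (core_inv e) + \<alpha> e * \<kappa>'' (core_inv e) / \<kappa>' (core_inv e) ^ 3"

lemma gA_low: "e \<le> k0 / 4 \<Longrightarrow> gA e = 0" "e \<le> k0 / 4 \<Longrightarrow> gA' e = 0"
  by (simp_all add: gA_def gA'_def \<alpha>_low \<alpha>'_low)

lemma gA_deriv:
  assumes "e < \<kappa> 0"
  shows "(gA has_real_derivative gA' e) (at e)"
proof (cases "0 < e")
  case True
  have "\<kappa>' (core_inv e) \<noteq> 0"
    using \<kappa>'_neg[of "core_inv e"] core_inv[OF True assms] by simp
  then show ?thesis
    unfolding gA_def[abs_def] gA'_def
    by (auto intro!: derivative_eq_intros \<alpha>_deriv DERIV_chain2[OF \<kappa>'_deriv core_inv_deriv[OF True assms]]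
        simp: field_simps power3_eq_cube)
next
  case False
  have "((\<lambda>_. 0) has_real_derivative gA' e) (at e)"
    using False k by (simp add: gA_low)
  then show ?thesis
    by (rule has_field_derivative_transform_within_open[of _ _ _ "{..<k0/4}"])
      (use False k gA_low in auto)
qed

lemma gA_cont: "continuous_on {..<\<kappa> 0} gA"
  by (rule DERIV_continuous_on[OF has_field_derivative_at_within[OF gA_deriv]]) auto

lemma gA'_cont: "continuous_on {..<\<kappa> 0} gA'"
proof -
  have "continuous_on {..<k0/4} gA'"
    by (rule continuous_on_eq[of _ "\<lambda>_. 0"]) (use gA_low in auto)
  moreover have "continuous_on {0<..<\<kappa> 0} gA'"
  proof -
    have c: "continuous_on {0<..<\<kappa> 0} core_inv"
      by (rule DERIV_continuous_on[OF has_field_derivative_at_within[OF core_inv_deriv]]) auto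
    have "\<kappa>' (core_inv e) \<noteq> 0" if "e \<in> {0<..<\<kappa> 0}" for e
      using \<kappa>'_neg[of "core_inv e"] core_inv[of e] that by simp
    then show ?thesis
      unfolding gA'_def
      by (intro continuous_intros continuous_on_compose2[OF \<kappa>''_cont c] continuous_on_compose2[OF \<kappa>'_cont c]
          continuous_on_subset[OF \<alpha>'_cont] \<alpha>_cont) auto
  qed
  ultimately have "continuous_on ({..<k0/4} \<union> {0<..<\<kappa> 0}) gA'"
    by (intro continuous_on_open_Un) auto
  then show ?thesis
    by (rule continuous_on_subset) (use k in auto)
qed

text \<open>In the integrals \<open>e = E - r\<^sup>2\<close> is unbounded below. Compactness of
  \<open>{0..k1}\<close> is enough, because both functions vanish for
  \<open>e \<le> k0 / 4\<close>.\<close>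

lemma gA_bounded:
  obtains C where "\<And>e. e \<le> k1 \<Longrightarrow> \<bar>gA e\<bar> \<le> C" "\<And>e. e \<le> k1 \<Longrightarrow> \<bar>gA' e\<bar> \<le> C"
proof -
  have "bounded (gA ` {0..k1})" "bounded (gA' ` {0..k1})"
    by (rule compact_imp_bounded[OF compact_continuous_image[OF continuous_on_subset]],
        (rule gA_cont gA'_cont), use k in auto)+
  then obtain C1 C2 where "\<forall>y\<in>gA ` {0..k1}. norm y \<le> C1" "\<forall>y\<in>gA' ` {0..k1}. norm y \<le> C2"
    unfolding bounded_iff by meson
  then have C: "\<And>e. e \<in> {0..k1} \<Longrightarrow> \<bar>gA e\<bar> \<le> C1" "\<And>e. e \<in> {0..k1} \<Longrightarrow> \<bar>gA' e\<bar> \<le> C2"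
    by auto
  have pos: "0 \<le> C1" "0 \<le> C2"
    using C[of 0] k by auto
  show ?thesis
  proof (rule that[of "max C1 C2"])
    fix e assume "e \<le> k1"
    then show "\<bar>gA e\<bar> \<le> max C1 C2" "\<bar>gA' e\<bar> \<le> max C1 C2"
      using C[of e] pos gA_low[of e] k by (cases "0 \<le> e"; simp add: le_max_iff_disj)+
  qed
qed

lemma gA_nonneg: "e \<le> k1 \<Longrightarrow> 0 \<le> gA e"
proof (cases "0 < e")
  case True
  assume "e \<le> k1"
  then show ?thesis
    using \<kappa>'_neg[of "core_inv e"] core_inv[of e] k \<alpha>_bounds[of e] True
    unfolding gA_def by (intro divide_nonneg_nonneg) auto
next
  case False
  then show ?thesis using gA_low[of e] k by simp
qed

text \<open>Along a motion the velocity integral therefore advances at the rate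
  \<open>\<alpha> (\<kappa> x)\<close>; the position integral contributes
  \<open>1 - \<alpha> (\<kappa> x)\<close> by \<open>\<phi>J_mult\<close>, and the two add up to
  one.\<close>

lemma gA_\<kappa>: "0 \<le> x \<Longrightarrow> gA (\<kappa> x) * - \<kappa>' x = \<alpha> (\<kappa> x)"
proof (cases "x < 1")
  case True
  assume "0 \<le> x"
  then show ?thesis
    using True \<kappa>'_neg[of x] core_inv_\<kappa>[of x] by (simp add: gA_def)
qed (use \<kappa>_zero \<kappa>'_zero \<alpha>_low k in auto)

section \<open>The two integrands of the split time integral and their dependence on the
  energy\<close>

abbreviation \<phi>I :: "real \<Rightarrow> real \<Rightarrow> real" where "\<phi>I r E \<equiv> gA (E - r\<^sup>2)"
abbreviation \<phi>I' :: "real \<Rightarrow> real \<Rightarrow> real" where "\<phi>I' r E \<equiv> gA' (E - r\<^sup>2)"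

text \<open>
  The minimum only matters where the numerator vanishes; it keeps the square root away from zero.
\<close>

definition \<phi>J :: "real \<Rightarrow> real \<Rightarrow> real" where
  "\<phi>J r E = (1 - \<alpha> (\<kappa> r)) / sqrt (E - min (\<kappa> r) (k0 / 2))"

definition \<phi>J' :: "real \<Rightarrow> real \<Rightarrow> real" where
  "\<phi>J' r E = - (1 - \<alpha> (\<kappa> r)) / (2 * (E - min (\<kappa> r) (k0 / 2)) * sqrt (E - min (\<kappa> r) (k0 / 2)))"

lemma \<phi>J_0: "k0 / 2 \<le> \<kappa> r \<Longrightarrow> \<phi>J r E = 0"
  by (simp add: \<phi>J_def \<alpha>_high)

lemma \<phi>J_mult: "\<phi>J r E * sqrt (E - \<kappa> r) = 1 - \<alpha> (\<kappa> r)" if "k0 < E"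
proof (cases "k0 / 2 \<le> \<kappa> r")
  case True
  then show ?thesis using \<phi>J_0[OF True] \<alpha>_high[OF True] by simp
next
  case False
  then show ?thesis using that k by (simp add: \<phi>J_def)
qed

lemma \<phi>J_1: "1 \<le> r \<Longrightarrow> \<phi>J r E = 1 / sqrt E"
  using k by (simp add: \<phi>J_def \<kappa>_zero \<alpha>_low)

lemma \<phi>J_nonneg: "k0 < E \<Longrightarrow> 0 \<le> \<phi>J r E"
  unfolding \<phi>J_def using \<alpha>_bounds k by (intro divide_nonneg_nonneg) (auto simp: min_def)

lemma sqrt_half_le: "k0 < E \<Longrightarrow> sqrt (k0 / 2) \<le> sqrt (E - min (\<kappa> r) (k0 / 2))"
  by (auto simp: min_def)

lemma \<phi>J_bound: "k0 < E \<Longrightarrow> \<bar>\<phi>J r E\<bar> \<le> 1 / sqrt (k0 / 2)"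
  unfolding \<phi>J_def abs_divide
  by (rule frac_le) (use \<alpha>_bounds[of "\<kappa> r"] sqrt_half_le[of E r] k in \<open>auto simp: abs_le_iff\<close>)

lemma \<phi>J'_bound: "k0 < E \<Longrightarrow> \<bar>\<phi>J' r E\<bar> \<le> 1 / (2 * (k0 / 2) * sqrt (k0 / 2))"
proof -
  assume E: "k0 < E"
  define u where "u = E - min (\<kappa> r) (k0 / 2)"
  have u: "k0 / 2 \<le> u" using E by (auto simp: u_def)
  have "2 * (k0 / 2) * sqrt (k0 / 2) \<le> 2 * u * sqrt u"
    using u k by (intro mult_mono) auto
  then have "\<bar>- (1 - \<alpha> (\<kappa> r))\<bar> / \<bar>2 * u * sqrt u\<bar> \<le> 1 / (2 * (k0 / 2) * sqrt (k0 / 2))"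
    by (intro frac_le) (use \<alpha>_bounds[of "\<kappa> r"] k u in \<open>auto simp: abs_le_iff abs_mult\<close>)
  then show ?thesis by (simp add: \<phi>J'_def u_def abs_divide)
qed

abbreviation "U \<equiv> {k0<..<k1}"

lemma continuous_\<phi>I: "continuous_on (UNIV \<times> U) (\<lambda>(r, E). \<phi>I r E)"
proof -
  have "E - r\<^sup>2 < \<kappa> 0" if "E < k1" for r E :: real
    using that k zero_le_power2[of r] by linarith
  then show ?thesis
    unfolding case_prod_beta'
    by (intro continuous_on_compose2[OF gA_cont] continuous_intros) auto
qed

lemma continuous_\<phi>I': "continuous_on (UNIV \<times> U) (\<lambda>(r, E). \<phi>I' r E)"
proof -
  have "E - r\<^sup>2 < \<kappa> 0" if "E < k1" for r E :: real
    using that k zero_le_power2[of r] by linarith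
  then show ?thesis
    unfolding case_prod_beta'
    by (intro continuous_on_compose2[OF gA'_cont] continuous_intros) auto
qed

lemma continuous_\<phi>J: "continuous_on (UNIV \<times> U) (\<lambda>(r, E). \<phi>J r E)"
  unfolding case_prod_beta' \<phi>J_def
  by (intro continuous_intros continuous_on_compose2[OF \<kappa>_cont[of UNIV]] continuous_on_compose2[OF \<alpha>_cont[of UNIV]])
    (use k in auto)

lemma continuous_\<phi>J': "continuous_on (UNIV \<times> U) (\<lambda>(r, E). \<phi>J' r E)"
  unfolding case_prod_beta' \<phi>J'_def
  by (intro continuous_intros continuous_on_compose2[OF \<kappa>_cont[of UNIV]] continuous_on_compose2[OF \<alpha>_cont[of UNIV]])
    (use k in auto)

lemma \<phi>I_deriv: "E \<in> U \<Longrightarrow> ((\<lambda>E. \<phi>I r E) has_real_derivative \<phi>I' r E) (at E)"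
proof -
  assume "E \<in> U"
  then have "E - r\<^sup>2 < \<kappa> 0"
    using k zero_le_power2[of r] by (simp, linarith)
  then have "((\<lambda>E. gA (E - r\<^sup>2)) has_real_derivative gA' (E - r\<^sup>2) * 1) (at E)"
    by (intro DERIV_chain2[OF gA_deriv]) (auto intro!: derivative_eq_intros)
  then show ?thesis by simp
qed

lemma \<phi>J_deriv: "E \<in> U \<Longrightarrow> ((\<lambda>E. \<phi>J r E) has_real_derivative \<phi>J' r E) (at E)"
proof -
  assume E: "E \<in> U"
  define c where "c = min (\<kappa> r) (k0 / 2)"
  have "0 < E - c" using E k by (auto simp: c_def min_def)
  then show ?thesis
    unfolding \<phi>J_def \<phi>J'_def c_def[symmetric]
    by (auto intro!: derivative_eq_intros simp: field_simps)
qed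

lemma continuous_fixed:
  assumes "E \<in> U"
  shows "continuous_on UNIV (\<lambda>r. \<phi>I r E)" "continuous_on UNIV (\<lambda>r. \<phi>I' r E)"
    "continuous_on UNIV (\<lambda>r. \<phi>J r E)" "continuous_on UNIV (\<lambda>r. \<phi>J' r E)"
  by (rule continuous_on_compose_uncurried[of UNIV U], (rule continuous_\<phi>I continuous_\<phi>I' continuous_\<phi>J continuous_\<phi>J'),
      use assms in \<open>auto intro!: continuous_intros\<close>)+

lemmas \<phi>I_curve = pint_curve[OF _ _ continuous_\<phi>I \<phi>I_deriv continuous_\<phi>I', simplified]
lemmas \<phi>J_curve = pint_curve[OF _ _ continuous_\<phi>J \<phi>J_deriv continuous_\<phi>J', simplified]

text \<open>The integration starts at the wall, which a particle of admissible energy never reaches;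
  nothing is lost, since the integrand vanishes as long as the potential is at least
  \<open>k0 / 2\<close>. In particular this part is zero near every turning point.\<close>

lemma pint_\<phi>J_0: "k0 / 2 \<le> \<kappa> x \<Longrightarrow> 0 \<le> x \<Longrightarrow> pint \<phi>J x E = 0"
  by (rule pint_eq_0) (use \<phi>J_0 \<kappa>_antimono order_trans in blast)+

lemma pint_\<phi>I_minus: "pint \<phi>I (- w) E = - pint \<phi>I w E"
  by (simp add: pint_def)

text \<open>Beyond the range of the wall the scaled speed is the constant \<open>sqrt E\<close>, so
  the elapsed time grows linearly.\<close>

lemma pint_\<phi>J_beyond:
  assumes "E \<in> U" "1 \<le> x"
  shows "pint \<phi>J x E = pint \<phi>J 1 E + (x - 1) / sqrt E"
proof -
  define c where "c = 1 / sqrt E"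
  have d: "((\<lambda>x. pint \<phi>J x E - x * c) has_real_derivative \<phi>J x E - c) (at x)" for x
    by (auto intro!: derivative_eq_intros pint_has_real_derivative continuous_fixed assms(1))
  have "pint \<phi>J x E - x * c = pint \<phi>J 1 E - 1 * c"
  proof (cases "x = 1")
    case False
    show ?thesis
    proof (rule DERIV_isconst2[of 1 x])
      show "continuous_on {1..x} (\<lambda>x. pint \<phi>J x E - x * c)"
        by (rule DERIV_continuous_on[OF has_field_derivative_at_within[OF d]])
      show "((\<lambda>x. pint \<phi>J x E - x * c) has_real_derivative 0) (at z)" if "1 < z" for z
        using d[of z] \<phi>J_1[of z E] that by (simp add: c_def)
    qed (use assms False in auto)
  qed simp
  then show ?thesis by (simp add: c_def diff_divide_distrib)
qed

text \<open>
  Up to the factor \<open>sqrt (m / 2)\<close>, this is the time since the turning point (negative on the way in) of a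
  particle of energy \<open>E = \<kappa> x + w\<^sup>2\<close> at scaled distance \<open>x\<close> from a soft wall, where \<open>w\<close> is its
  velocity divided by \<open>sqrt (2 / m)\<close>.  The cutoff splits the time integral: near the turning point the velocity serves
  as integration variable, elsewhere the position does; both integrands are regular.
\<close>

definition \<tau> :: "real \<Rightarrow> real \<Rightarrow> real \<Rightarrow> real" where
  "\<tau> x w E = 2 * pint \<phi>I w E + sgn w * pint \<phi>J x E"

definition \<tau>E :: "real \<Rightarrow> real \<Rightarrow> real \<Rightarrow> real" where
  "\<tau>E x w E = 2 * pint \<phi>I' w E + sgn w * pint \<phi>J' x E"

text \<open>The energy varies as well, because a moving wall does work; this produces the term with
  \<open>\<tau>E\<close>. The only point where \<open>sgn\<close> could spoil differentiability is a
  turning point. There the potential is the whole energy and exceeds \<open>k0 / 2\<close>, so the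
  summand that carries the sign vanishes identically nearby.\<close>

lemma \<tau>_curve:
  assumes "t \<in> S" "E t \<in> U"
    and x: "(x has_real_derivative x') (at t within S)"
    and w: "(w has_real_derivative w') (at t within S)"
    and E: "(E has_real_derivative E') (at t within S)"
    and energy: "\<And>s. s \<in> S \<Longrightarrow> \<kappa> (x s) + (w s)\<^sup>2 = E s"
    and pos: "\<And>s. s \<in> S \<Longrightarrow> 0 < x s"
  shows "((\<lambda>s. \<tau> (x s) (w s) (E s)) has_real_derivative
           2 * gA (\<kappa> (x t)) * w' + sgn (w t) * \<phi>J (x t) (E t) * x' + \<tau>E (x t) (w t) (E t) * E') (at t within S)"
proof -
  have Ew: "E t - (w t)\<^sup>2 = \<kappa> (x t)"
    using energy[OF assms(1)] by simp
  have I: "((\<lambda>s. 2 * pint \<phi>I (w s) (E s)) has_real_derivative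
      2 * gA (\<kappa> (x t)) * w' + 2 * pint \<phi>I' (w t) (E t) * E') (at t within S)"
    using DERIV_cmult[OF \<phi>I_curve[of E t, OF assms(2)[simplified] w E], of 2] unfolding Ew
    by (simp add: distrib_left mult.assoc)
  have J: "((\<lambda>s. sgn (w s) * pint \<phi>J (x s) (E s)) has_real_derivative
      sgn (w t) * \<phi>J (x t) (E t) * x' + sgn (w t) * pint \<phi>J' (x t) (E t) * E') (at t within S)"
  proof (cases "w t = 0")
    case True
    have "continuous (at t within S) (\<lambda>s. \<kappa> (x s))"
      by (rule DERIV_continuous[OF DERIV_chain2[OF \<kappa>_deriv x]])
    moreover have "\<kappa> (x t) > k0 / 2"
      using energy[OF assms(1)] True assms(2) k by simp
    ultimately obtain d where d: "0 < d" and near: "\<And>s. s \<in> S \<Longrightarrow> dist s t < d \<Longrightarrow>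
        dist (\<kappa> (x s)) (\<kappa> (x t)) < \<kappa> (x t) - k0 / 2"
      unfolding continuous_within_eps_delta by (meson diff_gt_0_iff_gt)
    have big: "k0 / 2 \<le> \<kappa> (x s)" if "s \<in> S" "dist s t < d" for s
      using near[OF that] by (auto simp: dist_real_def)
    have zero: "pint \<phi>J (x s) (E s) = 0" if "s \<in> S" "dist s t < d" for s
      by (rule pint_\<phi>J_0[OF big[OF that] less_imp_le[OF pos[OF that(1)]]])
    have "((\<lambda>_. 0) has_real_derivative 0) (at t within S)" by simp
    then have "((\<lambda>s. sgn (w s) * pint \<phi>J (x s) (E s)) has_real_derivative 0) (at t within S)"
      by (rule has_field_derivative_transform_within[OF _ d assms(1)])
        (simp add: zero)
    then show ?thesis using True by simp
  next
    case False
    have "continuous (at t within S) w"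
      by (rule DERIV_continuous[OF w])
    then obtain d where d: "0 < d" "\<And>s. s \<in> S \<Longrightarrow> dist s t < d \<Longrightarrow> dist (w s) (w t) < \<bar>w t\<bar>"
      using False unfolding continuous_within_eps_delta by (metis zero_less_abs_iff)
    have sgn: "sgn (w s) = sgn (w t)" if "s \<in> S" "dist s t < d" for s
      using d(2)[OF that] False by (auto simp: dist_real_def sgn_if abs_if split: if_splits)
    have "((\<lambda>s. sgn (w t) * pint \<phi>J (x s) (E s)) has_real_derivative
        sgn (w t) * \<phi>J (x t) (E t) * x' + sgn (w t) * pint \<phi>J' (x t) (E t) * E') (at t within S)"
      using DERIV_cmult[OF \<phi>J_curve[of E t, OF assms(2)[simplified] x E], of "sgn (w t)"]
      by (simp add: distrib_left mult.assoc)
    then show ?thesis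
      by (rule has_field_derivative_transform_within[OF _ d(1) assms(1)]) (simp add: sgn)
  qed
  show ?thesis
    using DERIV_add[OF I J] unfolding \<tau>_def \<tau>E_def by (simp add: algebra_simps)
qed

text \<open>The value of \<open>\<tau>\<close> at the edge of the core, where \<open>x = 1\<close>
  and \<open>w = sqrt E\<close>. In scaled variables it does not depend on
  \<open>\<delta>\<close>.\<close>

definition exit_time :: "real \<Rightarrow> real" where
  "exit_time E = 2 * pint \<phi>I (sqrt E) E + pint \<phi>J 1 E"

definition exit_time' :: "real \<Rightarrow> real" where
  "exit_time' E = 2 * pint \<phi>I' (sqrt E) E + pint \<phi>J' 1 E"

lemma exit_time_deriv:
  assumes "E \<in> U"
  shows "(exit_time has_real_derivative exit_time' E) (at E)"
proof -
  have s: "(sqrt has_real_derivative inverse (sqrt E) / 2) (at E)"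
    using DERIV_real_sqrt[of E] assms k by simp
  have "((\<lambda>E. 2 * pint \<phi>I (sqrt E) E + pint \<phi>J 1 E) has_real_derivative
      2 * (\<phi>I (sqrt E) E * (inverse (sqrt E) / 2) + pint \<phi>I' (sqrt E) E * 1) + (\<phi>J 1 E * 0 + pint \<phi>J' 1 E * 1)) (at E)"
    by (intro DERIV_add DERIV_cmult \<phi>I_curve[where E = "\<lambda>E. E"] \<phi>J_curve[where E = "\<lambda>E. E"]) 
      (use assms s in auto)
  \<comment> \<open>The moving upper limit \<open>sqrt E\<close> contributes nothing: there the
    potential energy \<open>E - r\<^sup>2\<close> is zero, and the weight with it.\<close>
  moreover have "\<phi>I (sqrt E) E = 0"
    using assms k gA_low[of 0] by simp
  ultimately show ?thesis
    unfolding exit_time_def[abs_def] exit_time'_def by simp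
qed

lemma exit_time'_cont: "continuous_on U exit_time'"
  unfolding exit_time'_def
  by (intro continuous_intros continuous_on_compose_uncurried[OF continuous_on_pint[OF continuous_\<phi>I']]
     continuous_on_compose_uncurried[OF continuous_on_pint[OF continuous_\<phi>J']]) auto

lemma exit_time_cont: "continuous_on U exit_time"
  by (rule DERIV_continuous_on[OF has_field_derivative_at_within[OF exit_time_deriv]])

lemma exit_time_nonneg: "E \<in> U \<Longrightarrow> 0 \<le> exit_time E"
proof -
  assume E: "E \<in> U"
  then have "E - r\<^sup>2 \<le> k1" for r
    using zero_le_power2[of r] by (simp, linarith)
  with E show ?thesis
    unfolding exit_time_def
    by (intro add_nonneg_nonneg mult_nonneg_nonneg pint_nonneg continuous_fixed gA_nonneg \<phi>J_nonneg) (use k in auto)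
qed

lemma \<tau>_beyond:
  assumes "E \<in> U" "1 \<le> x" "w\<^sup>2 = E"
  shows "\<tau> x w E = sgn w * ((x - 1) / sqrt E + exit_time E)"
proof -
  have "w = sgn w * sqrt E"
    using assms(3) by (auto simp: sgn_mult_abs simp flip: assms(3))
  moreover have "sgn w = 1 \<or> sgn w = -1"
    using assms k by (auto simp: sgn_if)
  ultimately have "pint \<phi>I w E = sgn w * pint \<phi>I (sqrt E) E"
    using pint_\<phi>I_minus[of "sqrt E" E] by auto
  then show ?thesis
    using pint_\<phi>J_beyond[OF assms(1,2)] by (simp add: \<tau>_def exit_time_def algebra_simps)
qed

text \<open>Growth linear in \<open>x\<close> is what \<open>\<theta>\<close> can afford: there
  these functions are evaluated at \<open>x / \<delta>\<close> and multiplied by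
  \<open>\<delta>\<close>, so for bounded distances the bounds become independent of
  \<open>\<delta>\<close>.\<close>

lemma \<tau>_bounds:
  obtains C where "0 \<le> C"
    "\<And>x w E. E \<in> U \<Longrightarrow> 0 < x \<Longrightarrow> w\<^sup>2 \<le> k1 \<Longrightarrow> \<bar>\<tau> x w E\<bar> \<le> C * (1 + x)"
    "\<And>x w E. E \<in> U \<Longrightarrow> 0 < x \<Longrightarrow> w\<^sup>2 \<le> k1 \<Longrightarrow> \<bar>\<tau>E x w E\<bar> \<le> C * (1 + x)"
proof -
  obtain G where G: "\<And>e. e \<le> k1 \<Longrightarrow> \<bar>gA e\<bar> \<le> G" "\<And>e. e \<le> k1 \<Longrightarrow> \<bar>gA' e\<bar> \<le> G"
    using gA_bounded by blast
  have "0 \<le> G" using G(1)[of k1] by simp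
  define H where "H = max (1 / sqrt (k0 / 2)) (1 / (2 * (k0 / 2) * sqrt (k0 / 2)))"
  have "0 \<le> H" using k by (auto simp: H_def le_max_iff_disj)
  define C where "C = 2 * (G * sqrt k1) + H"
  have main: "\<bar>2 * pint f w E + sgn w * pint g x E\<bar> \<le> C * (1 + x)"
    if E: "E \<in> U" "0 < x" "w\<^sup>2 \<le> k1"
      and f: "continuous_on UNIV (\<lambda>r. f r E)" "\<And>r. \<bar>f r E\<bar> \<le> G"
      and g: "continuous_on UNIV (\<lambda>r. g r E)" "\<And>r. \<bar>g r E\<bar> \<le> H" for f g x w E
  proof -
    have w: "\<bar>w\<bar> \<le> sqrt k1"
      using E(3) real_le_rsqrt[of "\<bar>w\<bar>" k1] by simp
    have "\<bar>pint f w E\<bar> \<le> G * \<bar>w\<bar>"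
      by (rule pint_abs_le) (use f in auto)
    also have "\<dots> \<le> G * sqrt k1"
      using w \<open>0 \<le> G\<close> by (rule mult_left_mono)
    finally have 1: "\<bar>pint f w E\<bar> \<le> G * sqrt k1" .
    have "\<bar>pint g x E\<bar> \<le> H * \<bar>x\<bar>"
      by (rule pint_abs_le) (use g in auto)
    then have 2: "\<bar>sgn w * pint g x E\<bar> \<le> H * x"
      using E by (cases "w = 0") (auto simp: abs_mult sgn_if \<open>0 \<le> H\<close>)
    have "\<bar>2 * pint f w E + sgn w * pint g x E\<bar> \<le> 2 * (G * sqrt k1) + H * x"
      using 1 2 by linarith
    also have "\<dots> \<le> C * (1 + x)"
      using \<open>0 \<le> G\<close> \<open>0 \<le> H\<close> E k by (simp add: C_def algebra_simps)
    finally show ?thesis .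
  qed
  show ?thesis
  proof (rule that[of C])
    show "0 \<le> C" using \<open>0 \<le> G\<close> \<open>0 \<le> H\<close> k by (simp add: C_def)
    fix x w E :: real
    assume E: "E \<in> U" "0 < x" "w\<^sup>2 \<le> k1"
    have le: "E - r\<^sup>2 \<le> k1" for r
      using E zero_le_power2[of r] by (simp, linarith)
    show "\<bar>\<tau> x w E\<bar> \<le> C * (1 + x)"
      unfolding \<tau>_def
      by (rule main[OF E]) (use continuous_fixed[OF E(1)] G le \<phi>J_bound E in \<open>auto simp: H_def le_max_iff_disj\<close>)
    show "\<bar>\<tau>E x w E\<bar> \<le> C * (1 + x)"
      unfolding \<tau>E_def
      by (rule main[OF E]) (use continuous_fixed[OF E(1)] G le \<phi>J'_bound[of E] E in \<open>auto simp: H_def le_max_iff_disj\<close>)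
  qed
qed

subsection \<open>The corrector\<close>

text \<open>
  \<open>\<theta> \<delta> m x s E\<close> is the time since the turning point of a particle of mass \<open>m\<close> and energy \<open>E\<close> at distance
  \<open>x\<close> from a soft wall, moving away from it with velocity \<open>s\<close>.
\<close>

definition \<theta> :: "real \<Rightarrow> real \<Rightarrow> real \<Rightarrow> real \<Rightarrow> real \<Rightarrow> real" where
  "\<theta> \<delta> m x s E = \<delta> * sqrt (m / 2) * \<tau> (x / \<delta>) (sqrt (m / 2) * s) E"

text \<open>In \<open>\<theta>_curve\<close>, \<open>p\<close> is the velocity with which the wall recedes.\<close>

lemma \<theta>_curve:
  assumes "0 < \<delta>" "0 < m" "t \<in> S" "E t \<in> U"
    and x: "(x has_real_derivative s t + p) (at t within S)"
    and s: "(s has_real_derivative s') (at t within S)" and s': "m * s' = - \<kappa>' (x t / \<delta>) / \<delta>"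
    and E: "(E has_real_derivative E') (at t within S)"
    and energy: "\<And>u. u \<in> S \<Longrightarrow> m * (s u)\<^sup>2 / 2 + \<kappa> (x u / \<delta>) = E u"
    and pos: "\<And>u. u \<in> S \<Longrightarrow> 0 < x u"
  shows "((\<lambda>u. \<theta> \<delta> m (x u) (s u) (E u)) has_real_derivative
     1 + sqrt (m / 2) * (sgn (s t) * \<phi>J (x t / \<delta>) (E t) * p + \<delta> * \<tau>E (x t / \<delta>) (sqrt (m / 2) * s t) (E t) * E'))
     (at t within S)"
proof -
  define \<mu> where "\<mu> = sqrt (m / 2)"
  have \<mu>: "0 < \<mu>" "\<mu>\<^sup>2 = m / 2" using \<open>0 < m\<close> by (auto simp: \<mu>_def)
  define \<xi> where "\<xi> = x t / \<delta>"
  have \<xi>: "0 < \<xi>" using pos assms by (simp add: \<xi>_def)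
  have energy': "\<kappa> (x u / \<delta>) + (\<mu> * s u)\<^sup>2 = E u" if "u \<in> S" for u
    using energy[OF that] by (simp add: power_mult_distrib \<mu>(2))
  have "((\<lambda>u. \<tau> (x u / \<delta>) (\<mu> * s u) (E u)) has_real_derivative
      2 * gA (\<kappa> (x t / \<delta>)) * (\<mu> * s') + sgn (\<mu> * s t) * \<phi>J (x t / \<delta>) (E t) * ((s t + p) / \<delta>)
        + \<tau>E (x t / \<delta>) (\<mu> * s t) (E t) * E') (at t within S)"
    by (rule \<tau>_curve[of t S E, OF assms(3,4)])
      (use energy' pos \<open>0 < \<delta>\<close> in \<open>auto intro!: DERIV_cdivide[OF x] DERIV_cmult[OF s] E\<close>)
  from DERIV_cmult[OF this, of "\<delta> * \<mu>"]
  have d: "((\<lambda>u. \<theta> \<delta> m (x u) (s u) (E u)) has_real_derivative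
      \<delta> * \<mu> * (2 * gA (\<kappa> \<xi>) * (\<mu> * s') + sgn (s t) * \<phi>J \<xi> (E t) * ((s t + p) / \<delta>)
        + \<tau>E \<xi> (\<mu> * s t) (E t) * E')) (at t within S)"
    using \<mu> by (simp add: \<theta>_def \<mu>_def[symmetric] \<xi>_def sgn_mult)
  have "\<delta> * \<mu> * (2 * gA (\<kappa> \<xi>) * (\<mu> * s')) = gA (\<kappa> \<xi>) * (\<delta> * (2 * \<mu>\<^sup>2 * s'))"
    by (simp add: power2_eq_square)
  also have "\<delta> * (2 * \<mu>\<^sup>2 * s') = - \<kappa>' \<xi>"
  proof -
    have "2 * \<mu>\<^sup>2 = m" using \<mu> by simp
    then show ?thesis unfolding \<open>2 * \<mu>\<^sup>2 = m\<close> s' using \<open>0 < \<delta>\<close> by (simp add: \<xi>_def)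
  qed
  \<comment> \<open>Newton's equation and \<open>2 * \<mu>\<^sup>2 = m\<close> turn the velocity
    part into the rate \<open>\<alpha>\<close>; the position part gives \<open>1 - \<alpha>\<close>,
    up to the term with the wall velocity \<open>p\<close>.\<close>
  finally have 1: "\<delta> * \<mu> * (2 * gA (\<kappa> \<xi>) * (\<mu> * s')) = \<alpha> (\<kappa> \<xi>)"
    using gA_\<kappa>[of \<xi>] \<xi> by simp
  have "\<mu> * sgn (s t) * s t = sqrt ((\<mu> * s t)\<^sup>2)"
    using \<mu> by (simp add: abs_mult) (simp add: abs_sgn mult_ac)
  also have "(\<mu> * s t)\<^sup>2 = E t - \<kappa> \<xi>"
    using energy'[OF assms(3)] by (simp add: \<xi>_def)
  finally have 2: "\<mu> * sgn (s t) * s t * \<phi>J \<xi> (E t) = 1 - \<alpha> (\<kappa> \<xi>)"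
    using \<phi>J_mult[of "E t" \<xi>] assms(4) by (simp add: mult.commute)
  have "\<delta> * \<mu> * (2 * gA (\<kappa> \<xi>) * (\<mu> * s') + sgn (s t) * \<phi>J \<xi> (E t) * ((s t + p) / \<delta>) + \<tau>E \<xi> (\<mu> * s t) (E t) * E')
     = \<delta> * \<mu> * (2 * gA (\<kappa> \<xi>) * (\<mu> * s')) + \<mu> * sgn (s t) * s t * \<phi>J \<xi> (E t)
       + \<mu> * (sgn (s t) * \<phi>J \<xi> (E t) * p + \<delta> * \<tau>E \<xi> (\<mu> * s t) (E t) * E')"
    using \<open>0 < \<delta>\<close> by (simp add: field_simps)
  also have "\<dots> = 1 + \<mu> * (sgn (s t) * \<phi>J \<xi> (E t) * p + \<delta> * \<tau>E \<xi> (\<mu> * s t) (E t) * E')"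
    unfolding 1 2 by simp
  finally show ?thesis
    using d unfolding \<mu>_def \<xi>_def by simp
qed

text \<open>The length of the box of hard walls in which the particle would have the same period.\<close>

definition eff_length :: "real \<Rightarrow> real \<Rightarrow> real \<Rightarrow> real" where
  "eff_length l \<delta> E = l - 2 * \<delta> + 2 * \<delta> * (sqrt E * exit_time E)"

text \<open>Away from both walls the two elapsed times are affine in \<open>r\<close>, and the
  dependence on \<open>r\<close> cancels. The right hand side is half the period with the sign of
  \<open>s\<close>: the time from one turning point to the other.\<close>

lemma \<theta>_match:
  assumes "0 < \<delta>" "0 < m" "E \<in> U" "\<delta> \<le> r" "r \<le> l - \<delta>" "m * s\<^sup>2 / 2 = E"
  shows "\<theta> \<delta> m r s E - \<theta> \<delta> m (l - r) (- s) E = sgn s * sqrt (m / 2) * eff_length l \<delta> E / sqrt E"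
proof -
  have \<mu>: "0 < sqrt (m / 2)" "(sqrt (m / 2))\<^sup>2 = m / 2" using \<open>0 < m\<close> by auto
  have E: "0 < sqrt E" "sqrt E * sqrt E = E" using assms(3) k by auto
  have "\<tau> (r / \<delta>) (sqrt (m / 2) * s) E = sgn (sqrt (m / 2) * s) * ((r / \<delta> - 1) / sqrt E + exit_time E)"
    by (rule \<tau>_beyond) (use assms \<mu> in \<open>auto simp: power_mult_distrib field_simps\<close>)
  moreover have "\<tau> ((l - r) / \<delta>) (sqrt (m / 2) * - s) E = sgn (sqrt (m / 2) * - s) * (((l - r) / \<delta> - 1) / sqrt E + exit_time E)"
    by (rule \<tau>_beyond) (use assms \<mu> in \<open>auto simp: power_mult_distrib field_simps\<close>)
  moreover have "\<delta> * \<mu> * (\<sigma> * ((r / \<delta> - 1) / a + B)) - \<delta> * \<mu> * (- \<sigma> * (((l - r) / \<delta> - 1) / a + B))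
      = \<sigma> * \<mu> * (l - 2 * \<delta> + 2 * \<delta> * (a * B)) / a" if "0 < a" for \<mu> \<sigma> a B :: real
    using that \<open>0 < \<delta>\<close> by (simp add: field_simps)
  ultimately show ?thesis
    using E \<mu> unfolding \<theta>_def eff_length_def by (simp add: sgn_mult sgn_minus)
qed

text \<open>Since \<open>m * \<bar>s\<bar> = 2 * sqrt (m / 2) * sqrt E\<close>, the product of
  \<open>2 * E\<close> and the half period of \<open>\<theta>_match\<close> is length times
  momentum. This explains the momentum term in the second case of \<open>virial\<close>.\<close>

lemma momentum_eq:
  assumes "0 < m" "m * s\<^sup>2 / 2 = E" "0 < E"
  shows "2 * E * (sgn s * sqrt (m / 2) * L / sqrt E) = L * (m * s)"
proof -
  have "sgn s * sqrt E = sgn s * sqrt ((sqrt (m / 2) * s)\<^sup>2)"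
    using assms by (simp add: power_mult_distrib mult.commute)
  also have "\<dots> = sqrt (m / 2) * s"
  proof -
    have "sgn s * \<bar>sqrt (m / 2) * s\<bar> = sqrt (m / 2) * (sgn s * \<bar>s\<bar>)"
      using assms by (simp add: abs_mult)
    then show ?thesis by (simp add: sgn_mult_abs)
  qed
  finally have 1: "sgn s * sqrt E = sqrt (m / 2) * s" .
  have 2: "E / sqrt E = sqrt E"
    using assms by (simp add: real_div_sqrt)
  have "2 * E * (sgn s * sqrt (m / 2) * L / sqrt E) = 2 * L * sqrt (m / 2) * (sgn s * (E / sqrt E))"
    by simp
  also have "\<dots> = 2 * L * (sqrt (m / 2) * sqrt (m / 2)) * s"
    unfolding 2 1 by simp
  also have "\<dots> = L * (m * s)"
    using assms by (simp add: real_sqrt_mult_self)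
  finally show ?thesis .
qed

definition energy :: "real \<Rightarrow> real \<Rightarrow> real \<Rightarrow> real \<Rightarrow> real \<Rightarrow> real" where
  "energy l \<delta> m r s = m * s\<^sup>2 / 2 + \<kappa> (r / \<delta>) + \<kappa> ((l - r) / \<delta>)"

text \<open>Each potential term is bounded by the energy, hence below \<open>\<kappa> 0\<close>,
  while \<open>\<kappa>\<close> is at least \<open>\<kappa> 0\<close> for nonpositive
  arguments.\<close>

lemma energy_confined:
  assumes "0 < \<delta>" "0 < m" "energy l \<delta> m r s \<in> U"
  shows "0 < r" "r < l"
proof -
  have "0 \<le> m * s\<^sup>2 / 2"
    using assms by simp
  then have "\<kappa> (r / \<delta>) < \<kappa> 0" "\<kappa> ((l - r) / \<delta>) < \<kappa> 0"
    using assms(3) k \<kappa>_nonneg[of "r / \<delta>"] \<kappa>_nonneg[of "(l - r) / \<delta>"]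
    unfolding energy_def greaterThanLessThan_iff by linarith+
  from this[THEN \<kappa>_less_imp_pos] show "0 < r" "r < l"
    using \<open>0 < \<delta>\<close> by (simp_all add: zero_less_divide_iff)
qed

text \<open>
  Up to a function of the slow variables, the virial \<open>m r s\<close> corrected for the thickness of the walls.
\<close>

definition virial :: "real \<Rightarrow> real \<Rightarrow> real \<Rightarrow> real \<Rightarrow> real \<Rightarrow> real" where
  "virial l \<delta> m r s = (let E = energy l \<delta> m r s in
     if r < l / 2 then 2 * E * \<theta> \<delta> m r s E
     else 2 * E * \<theta> \<delta> m (l - r) (- s) E + eff_length l \<delta> E * (m * s))"

text \<open>The threshold \<open>l / 2\<close> in \<open>virial\<close> is arbitrary: by
  \<open>\<theta>_match\<close> both formulas agree wherever neither wall is felt. Each may thus be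
  used on a full neighbourhood of any point out of reach of the opposite wall, as differentiation
  requires.\<close>

lemma virial_cases:
  assumes "0 < \<delta>" "0 < m" "4 * \<delta> \<le> l" and E: "E = energy l \<delta> m r s" "E \<in> U"
  shows "r \<le> l - \<delta> \<Longrightarrow> virial l \<delta> m r s = 2 * E * \<theta> \<delta> m r s E"
    and "\<delta> \<le> r \<Longrightarrow> virial l \<delta> m r s = 2 * E * \<theta> \<delta> m (l - r) (- s) E + eff_length l \<delta> E * (m * s)"
proof -
  have eq: "2 * E * \<theta> \<delta> m r s E = 2 * E * \<theta> \<delta> m (l - r) (- s) E + eff_length l \<delta> E * (m * s)"
    if "\<delta> \<le> r" "r \<le> l - \<delta>"
  proof -
    have *: "m * s\<^sup>2 / 2 = E"
      using that \<open>0 < \<delta>\<close> by (simp add: E energy_def \<kappa>_zero)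
    have "2 * E * (\<theta> \<delta> m r s E - \<theta> \<delta> m (l - r) (- s) E) = eff_length l \<delta> E * (m * s)"
      unfolding \<theta>_match[OF assms(1,2) E(2) that *]
      by (rule momentum_eq[OF assms(2) *]) (use E k in simp)
    then show ?thesis by (simp add: right_diff_distrib)
  qed
  show "r \<le> l - \<delta> \<Longrightarrow> virial l \<delta> m r s = 2 * E * \<theta> \<delta> m r s E"
    using eq assms(1,3) by (cases "r < l / 2") (auto simp: virial_def E Let_def)
  show "\<delta> \<le> r \<Longrightarrow> virial l \<delta> m r s = 2 * E * \<theta> \<delta> m (l - r) (- s) E + eff_length l \<delta> E * (m * s)"
    using eq assms(1,3) by (cases "r < l / 2") (auto simp: virial_def E Let_def)
qed

text \<open>The fixed wall does no work, and the exchange between kinetic and potential energy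
  cancels; only the displacement of the other wall at velocity \<open>p\<close> against the force
  \<open>f\<close> remains.\<close>

lemma energy_curve:
  assumes "0 < \<delta>"
    and l: "(l has_real_derivative p) (at t within S)"
    and r: "(r has_real_derivative s t) (at t within S)"
    and s: "((\<lambda>u. m * s u) has_real_derivative w - f) (at t within S)"
    and w: "w = - \<kappa>' (r t / \<delta>) / \<delta>" and f: "f = - \<kappa>' ((l t - r t) / \<delta>) / \<delta>" and "0 < m"
  shows "((\<lambda>u. energy (l u) \<delta> m (r u) (s u)) has_real_derivative - p * f) (at t within S)"
proof -
  have "((\<lambda>u. m * s u / m) has_real_derivative (w - f) / m) (at t within S)"
    by (rule DERIV_cdivide[OF s])
  then have s: "(s has_real_derivative (w - f) / m) (at t within S)"
    using \<open>0 < m\<close> by simp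
  have k1: "((\<lambda>u. \<kappa> (r u / \<delta>)) has_real_derivative \<kappa>' (r t / \<delta>) * (s t / \<delta>)) (at t within S)"
    by (rule DERIV_chain2[OF \<kappa>_deriv DERIV_cdivide[OF r]])
  have k2: "((\<lambda>u. \<kappa> ((l u - r u) / \<delta>)) has_real_derivative \<kappa>' ((l t - r t) / \<delta>) * ((p - s t) / \<delta>)) (at t within S)"
    by (rule DERIV_chain2[OF \<kappa>_deriv DERIV_cdivide[OF DERIV_diff[OF l r]]])
  have "((\<lambda>u. m * (s u)\<^sup>2 / 2) has_real_derivative m * (2 * s t * ((w - f) / m)) / 2) (at t within S)"
    by (auto intro!: derivative_eq_intros s)
  from DERIV_add[OF DERIV_add[OF this k1] k2]
  have "((\<lambda>u. m * (s u)\<^sup>2 / 2 + \<kappa> (r u / \<delta>) + \<kappa> ((l u - r u) / \<delta>)) has_real_derivative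
    m * (2 * s t * ((w - f) / m)) / 2 + \<kappa>' (r t / \<delta>) * (s t / \<delta>) + \<kappa>' ((l t - r t) / \<delta>) * ((p - s t) / \<delta>)) (at t within S)" .
  moreover have "m * (2 * s t * ((w - f) / m)) / 2 + \<kappa>' (r t / \<delta>) * (s t / \<delta>) + \<kappa>' ((l t - r t) / \<delta>) * ((p - s t) / \<delta>) = - p * f"
    using \<open>0 < \<delta>\<close> \<open>0 < m\<close> by (simp add: w f field_simps)
  ultimately show ?thesis unfolding energy_def by simp
qed

lemma exit_time_bounds:
  obtains C where "0 \<le> C" "\<And>E. E \<in> U \<Longrightarrow> sqrt E * exit_time E \<le> C"
    "\<And>E. E \<in> U \<Longrightarrow> ((\<lambda>E. sqrt E * exit_time E) has_real_derivative exit_time E / (2 * sqrt E) + sqrt E * exit_time' E) (at E)"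
    "\<And>E. E \<in> U \<Longrightarrow> \<bar>exit_time E / (2 * sqrt E) + sqrt E * exit_time' E\<bar> \<le> C"
proof -
  obtain C where C: "0 \<le> C"
    "\<And>x w E. E \<in> U \<Longrightarrow> 0 < x \<Longrightarrow> w\<^sup>2 \<le> k1 \<Longrightarrow> \<bar>\<tau> x w E\<bar> \<le> C * (1 + x)"
    "\<And>x w E. E \<in> U \<Longrightarrow> 0 < x \<Longrightarrow> w\<^sup>2 \<le> k1 \<Longrightarrow> \<bar>\<tau>E x w E\<bar> \<le> C * (1 + x)"
    using \<tau>_bounds by blast
  have exit_time: "\<bar>exit_time E\<bar> \<le> 2 * C" "\<bar>exit_time' E\<bar> \<le> 2 * C" if "E \<in> U" for E
  proof -
    have "exit_time E = \<tau> 1 (sqrt E) E" "exit_time' E = \<tau>E 1 (sqrt E) E"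
      using that k by (auto simp: exit_time_def exit_time'_def \<tau>_def \<tau>E_def)
    then show "\<bar>exit_time E\<bar> \<le> 2 * C" "\<bar>exit_time' E\<bar> \<le> 2 * C"
      using C(2)[of E 1 "sqrt E"] C(3)[of E 1 "sqrt E"] that k by auto
  qed
  define D where "D = 2 * C / (2 * sqrt k0) + sqrt k1 * (2 * C)"
  have D: "sqrt k1 * (2 * C) \<le> D"
    using C k by (simp add: D_def)
  show ?thesis
  proof (rule that[of D])
    show "0 \<le> D" using C k by (simp add: D_def)
    fix E assume E: "E \<in> U"
    have "sqrt E * exit_time E \<le> sqrt k1 * (2 * C)"
      using E exit_time[OF E] k exit_time_nonneg[OF E] by (intro mult_mono) auto
    then show "sqrt E * exit_time E \<le> D" using D by simp
    show "((\<lambda>E. sqrt E * exit_time E) has_real_derivative exit_time E / (2 * sqrt E) + sqrt E * exit_time' E) (at E)"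
      using E k by (auto intro!: derivative_eq_intros exit_time_deriv simp: field_simps)
    have 1: "\<bar>exit_time E / (2 * sqrt E)\<bar> \<le> 2 * C / (2 * sqrt k0)"
      unfolding abs_divide using exit_time[OF E] E k by (intro frac_le) auto
    have 2: "\<bar>sqrt E * exit_time' E\<bar> \<le> sqrt k1 * (2 * C)"
      unfolding abs_mult using exit_time[OF E] E k C by (intro mult_mono) auto
    show "\<bar>exit_time E / (2 * sqrt E) + sqrt E * exit_time' E\<bar> \<le> D"
      using 1 2 unfolding D_def by linarith
  qed
qed

lemma eff_length_ge: "0 \<le> \<delta> \<Longrightarrow> E \<in> U \<Longrightarrow> l - 2 * \<delta> \<le> eff_length l \<delta> E"
  using exit_time_nonneg[of E] k by (simp add: eff_length_def)

lemma velocity_bound: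
  assumes "0 < m" "m * s\<^sup>2 / 2 \<le> k1"
  shows "(sqrt (m / 2) * s)\<^sup>2 \<le> k1" "m * \<bar>s\<bar> \<le> 2 * (sqrt (m / 2) * sqrt k1)"
proof -
  show 1: "(sqrt (m / 2) * s)\<^sup>2 \<le> k1"
    using assms by (simp add: power_mult_distrib)
  have "m * \<bar>s\<bar> = 2 * sqrt (m / 2) * (sqrt (m / 2) * \<bar>s\<bar>)"
  proof -
    have "sqrt (m / 2) * sqrt (m / 2) = m / 2"
      using assms by simp
    then show ?thesis by (metis mult.assoc mult.commute mult_2 field_sum_of_halves)
  qed
  also have "sqrt (m / 2) * \<bar>s\<bar> \<le> sqrt k1"
    using real_le_rsqrt[of "sqrt (m / 2) * \<bar>s\<bar>" k1] 1 by (simp add: power_mult_distrib)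
  finally show "m * \<bar>s\<bar> \<le> 2 * (sqrt (m / 2) * sqrt k1)"
    using assms by (simp add: mult_left_mono)
qed

text \<open>Out of reach of the moving wall the energy is constant and the elapsed time has rate
  one, so the derivative is exactly \<open>2 * E\<close>. Otherwise the fixed wall is out of reach,
  the momentum changes at rate \<open>- f\<close>, and its product with the effective length yields
  the term with \<open>f\<close>. All other terms contain \<open>p\<close> or the energy change
  \<open>- p * f\<close>; the bound retains \<open>f\<close> because \<open>f\<close> is not bounded
  uniformly in \<open>\<delta>\<close>.\<close>

lemma virial_curve:
  assumes "0 < m" "0 < l0"
  obtains C where "0 \<le> C"
    and "\<And>l \<delta> r s. l0 \<le> l \<Longrightarrow> l \<le> 1 \<Longrightarrow> 0 < \<delta> \<Longrightarrow> 4 * \<delta> \<le> l0 \<Longrightarrow> energy l \<delta> m r s \<in> U \<Longrightarrow>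
      \<bar>virial l \<delta> m r s\<bar> \<le> C"
    and "\<And>l p \<delta> r s w f S t E.
      \<lbrakk>t \<in> S; \<And>u. u \<in> S \<Longrightarrow> l0 \<le> l u \<and> l u \<le> 1; 0 < \<delta>; 4 * \<delta> \<le> l0;
       \<And>u. u \<in> S \<Longrightarrow> energy (l u) \<delta> m (r u) (s u) \<in> U; E = energy (l t) \<delta> m (r t) (s t);
       (l has_real_derivative p) (at t within S); (r has_real_derivative s t) (at t within S);
       ((\<lambda>u. m * s u) has_real_derivative w - f) (at t within S);
       w = - \<kappa>' (r t / \<delta>) / \<delta>; f = - \<kappa>' ((l t - r t) / \<delta>) / \<delta>\<rbrakk> \<Longrightarrow>
      \<exists>D. ((\<lambda>u. virial (l u) \<delta> m (r u) (s u)) has_real_derivative D) (at t within S) \<and>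
          \<bar>D - (2 * E - eff_length (l t) \<delta> E * f)\<bar> \<le> C * \<bar>p\<bar> * (1 + f)"
proof -
  obtain C0 where C0: "0 \<le> C0"
    "\<And>x w E. E \<in> U \<Longrightarrow> 0 < x \<Longrightarrow> w\<^sup>2 \<le> k1 \<Longrightarrow> \<bar>\<tau> x w E\<bar> \<le> C0 * (1 + x)"
    "\<And>x w E. E \<in> U \<Longrightarrow> 0 < x \<Longrightarrow> w\<^sup>2 \<le> k1 \<Longrightarrow> \<bar>\<tau>E x w E\<bar> \<le> C0 * (1 + x)"
    using \<tau>_bounds by blast
  obtain C1 where C1: "0 \<le> C1" "\<And>E. E \<in> U \<Longrightarrow> sqrt E * exit_time E \<le> C1"
    "\<And>E. E \<in> U \<Longrightarrow> ((\<lambda>E. sqrt E * exit_time E) has_real_derivative exit_time E / (2 * sqrt E) + sqrt E * exit_time' E) (at E)"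
    "\<And>E. E \<in> U \<Longrightarrow> \<bar>exit_time E / (2 * sqrt E) + sqrt E * exit_time' E\<bar> \<le> C1"
    using exit_time_bounds by blast
  define \<mu> where "\<mu> = sqrt (m / 2)"
  have \<mu>: "0 < \<mu>" using assms by (simp add: \<mu>_def)
  define C\<theta> where "C\<theta> = 2 * C0 * \<mu>"
  define Cs where "Cs = 2 * (\<mu> * sqrt k1)"
  define CJ where "CJ = 1 / sqrt (k0 / 2)"
  have nonneg: "0 \<le> C\<theta>" "0 \<le> Cs" "0 \<le> CJ" using C0 \<mu> k by (auto simp: C\<theta>_def Cs_def CJ_def)
  have scale: "\<delta> * (C0 * (1 + x / \<delta>)) \<le> 2 * C0" if "0 < \<delta>" "\<delta> \<le> 1" "x \<le> 1" for \<delta> x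
  proof -
    have "\<delta> * (C0 * (1 + x / \<delta>)) = C0 * (\<delta> + x)"
      using that by (simp add: field_simps)
    also have "\<dots> \<le> C0 * 2"
      using that C0 by (intro mult_left_mono) auto
    finally show ?thesis by simp
  qed
  have kin: "m * s\<^sup>2 / 2 \<le> k1" if "energy l \<delta> m r s \<in> U" for l \<delta> r s
    using that \<kappa>_nonneg[of "r / \<delta>"] \<kappa>_nonneg[of "(l - r) / \<delta>"] unfolding energy_def greaterThanLessThan_iff
    by linarith
  have th: "\<bar>\<theta> \<delta> m x s E\<bar> \<le> C\<theta>" if "0 < \<delta>" "\<delta> \<le> 1" "0 < x" "x \<le> 1" "E \<in> U" "m * s\<^sup>2 / 2 \<le> k1" for \<delta> x s E
  proof -
    have "\<bar>\<tau> (x / \<delta>) (\<mu> * s) E\<bar> \<le> C0 * (1 + x / \<delta>)"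
      by (rule C0) (use that velocity_bound[OF assms(1)] in \<open>auto simp: \<mu>_def\<close>)
    then have "\<delta> * \<bar>\<tau> (x / \<delta>) (\<mu> * s) E\<bar> \<le> 2 * C0"
      using mult_left_mono[of "\<bar>\<tau> (x / \<delta>) (\<mu> * s) E\<bar>" "C0 * (1 + x / \<delta>)" \<delta>] scale[of \<delta> x] that by linarith
    then have "\<mu> * (\<delta> * \<bar>\<tau> (x / \<delta>) (\<mu> * s) E\<bar>) \<le> \<mu> * (2 * C0)"
      using \<mu> by (intro mult_left_mono) auto
    moreover have "\<bar>\<theta> \<delta> m x s E\<bar> = \<mu> * (\<delta> * \<bar>\<tau> (x / \<delta>) (\<mu> * s) E\<bar>)"
      using \<mu> that by (simp add: \<theta>_def abs_mult flip: \<mu>_def)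
    ultimately show ?thesis by (simp add: C\<theta>_def mult_ac)
  qed
  have th': "\<bar>\<delta> * \<tau>E (x / \<delta>) (\<mu> * s) E\<bar> \<le> 2 * C0" if "0 < \<delta>" "\<delta> \<le> 1" "0 < x" "x \<le> 1" "E \<in> U" "m * s\<^sup>2 / 2 \<le> k1" for \<delta> x s E
  proof -
    have "\<bar>\<tau>E (x / \<delta>) (\<mu> * s) E\<bar> \<le> C0 * (1 + x / \<delta>)"
      by (rule C0) (use that velocity_bound[OF assms(1)] in \<open>auto simp: \<mu>_def\<close>)
    then have "\<delta> * \<bar>\<tau>E (x / \<delta>) (\<mu> * s) E\<bar> \<le> 2 * C0"
      using mult_left_mono[of "\<bar>\<tau>E (x / \<delta>) (\<mu> * s) E\<bar>" "C0 * (1 + x / \<delta>)" \<delta>] scale[of \<delta> x] that by linarith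
    then show ?thesis using that by (simp add: abs_mult)
  qed
  have L_le: "\<bar>eff_length l \<delta> E\<bar> \<le> 1 + 2 * C1" if "0 < \<delta>" "\<delta> \<le> 1" "l \<le> 1" "2 * \<delta> \<le> l" "E \<in> U" for l \<delta> E
  proof -
    have "0 \<le> \<delta> * (sqrt E * exit_time E)"
      using that exit_time_nonneg[of E] k by (intro mult_nonneg_nonneg) auto
    moreover have "\<delta> * (sqrt E * exit_time E) \<le> 1 * C1"
      using that C1 exit_time_nonneg[of E] k by (intro mult_mono) auto
    ultimately show ?thesis
      using that unfolding eff_length_def by linarith
  qed
  have ms: "\<bar>m * s\<bar> \<le> Cs" if "m * s\<^sup>2 / 2 \<le> k1" for s
    using velocity_bound(2)[OF assms(1) that] assms(1) by (simp add: Cs_def \<mu>_def abs_mult)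
  have Eab: "\<bar>E\<bar> \<le> k1" if "E \<in> U" for E using that k by auto
  \<comment> \<open>\<open>CY\<close> bounds the virial. The three summands of \<open>Ce\<close>
    bound the contributions of the changing energy, of the altered rate of \<open>\<theta>\<close>
    and of the changing effective length.\<close>
  define CY where "CY = 2 * (k1 * C\<theta>) + (1 + 2 * C1) * Cs"
  define Ce where "Ce = 2 * C\<theta> + 2 * (k1 * (\<mu> * (CJ + 2 * C0))) + (1 + 2 * C1) * Cs"
  have "0 \<le> CY" using nonneg C1 k by (simp add: CY_def)
  show ?thesis
  proof (rule that[of "max CY Ce"])
    show "0 \<le> max CY Ce" using \<open>0 \<le> CY\<close> by (simp add: le_max_iff_disj)
  next
    fix l \<delta> r s :: real
    assume l: "l0 \<le> l" "l \<le> 1" and \<delta>: "0 < \<delta>" "4 * \<delta> \<le> l0" and E: "energy l \<delta> m r s \<in> U"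
    define e where "e = energy l \<delta> m r s"
    have eU: "e \<in> U" using E by (simp add: e_def)
    note r = energy_confined[OF \<delta>(1) assms(1) E]
    have 1: "\<bar>2 * e * \<theta> \<delta> m x s' e\<bar> \<le> 2 * (k1 * C\<theta>)" if "0 < x" "x \<le> 1" "s'\<^sup>2 = s\<^sup>2" for x s'
    proof -
      have "\<bar>e\<bar> * \<bar>\<theta> \<delta> m x s' e\<bar> \<le> k1 * C\<theta>"
        using that kin[OF E] l \<delta> eU k by (intro mult_mono Eab th) auto
      then show ?thesis by (simp add: abs_mult)
    qed
    have 2: "\<bar>eff_length l \<delta> e * (m * s)\<bar> \<le> (1 + 2 * C1) * Cs"
      unfolding abs_mult[of "eff_length l \<delta> e"] using l \<delta> eU C1 kin[OF E] by (intro mult_mono L_le ms) auto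
    have "0 \<le> (1 + 2 * C1) * Cs" using C1 nonneg by simp
    then have "\<bar>virial l \<delta> m r s\<bar> \<le> CY"
      using 1[of r s] 1[of "l - r" "- s"] 2 r l unfolding virial_def e_def[symmetric] Let_def CY_def
      by (auto split: if_splits)
    then show "\<bar>virial l \<delta> m r s\<bar> \<le> max CY Ce" by simp
  next
    fix l r s :: "real \<Rightarrow> real" and p \<delta> w f t E S
    assume tS: "t \<in> S" and l0: "\<And>u. u \<in> S \<Longrightarrow> l0 \<le> l u \<and> l u \<le> 1" and \<delta>: "0 < \<delta>" "4 * \<delta> \<le> l0"
      and EU: "\<And>u. u \<in> S \<Longrightarrow> energy (l u) \<delta> m (r u) (s u) \<in> U" and E_def: "E = energy (l t) \<delta> m (r t) (s t)"
      and l: "(l has_real_derivative p) (at t within S)" and r: "(r has_real_derivative s t) (at t within S)"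
      and s: "((\<lambda>u. m * s u) has_real_derivative w - f) (at t within S)"
      and w: "w = - \<kappa>' (r t / \<delta>) / \<delta>" and f: "f = - \<kappa>' ((l t - r t) / \<delta>) / \<delta>"
    define e where "e = (\<lambda>u. energy (l u) \<delta> m (r u) (s u))"
    have e: "(e has_real_derivative - p * f) (at t within S)" "e t = E" "E \<in> U"
      using energy_curve[OF \<delta>(1) l r s w f assms(1)] EU[OF tS] by (auto simp: e_def E_def)
    have conf: "0 < r u" "r u < l u" if "u \<in> S" for u
      using energy_confined[OF \<delta>(1) assms(1) EU[OF that]] by auto
    have "((\<lambda>u. m * s u / m) has_real_derivative (w - f) / m) (at t within S)"
      by (rule DERIV_cdivide[OF s])
    then have s1: "(s has_real_derivative (w - f) / m) (at t within S)"
      using \<open>0 < m\<close> by simp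
    have f0: "0 \<le> f" using \<kappa>'_nonpos[of "(l t - r t) / \<delta>"] \<delta> by (simp add: f divide_nonpos_pos)
    have kinE: "m * (s t)\<^sup>2 / 2 \<le> k1" using kin[OF EU[OF tS]] .
    have \<delta>1: "\<delta> \<le> 1" "2 * \<delta> \<le> l t" "4 * \<delta> \<le> l t" "l t \<le> 1"
      using \<delta> l0[OF tS] by auto
    have cont: "continuous (at t within S) (\<lambda>u. l u - r u)" "continuous (at t within S) r"
      by (rule DERIV_continuous[OF DERIV_diff[OF l r]] DERIV_continuous[OF r])+
    have near: "\<exists>T. open T \<and> t \<in> T \<and> (\<forall>u\<in>S \<inter> T. \<delta> < g u)" if "continuous (at t within S) g" "\<delta> < g t" for g :: "real \<Rightarrow> real"
    proof -
      have "\<forall>\<^sub>F u in at t within S. \<delta> < g u"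
        using that by (simp add: continuous_within order_tendstoD)
      then obtain T where "open T" "t \<in> T" "\<And>u. u \<in> T \<Longrightarrow> u \<noteq> t \<Longrightarrow> u \<in> S \<Longrightarrow> \<delta> < g u"
        unfolding eventually_at_topological by blast
      then show ?thesis using that(2) by (intro exI[of _ T]) (metis IntD1 IntD2)
    qed
    \<comment> \<open>At least one wall is out of reach. The inequalities are strict, so that the
      same wall stays out of reach nearby.\<close>
    have "\<delta> < l t - r t \<or> \<delta> < r t" using \<delta>1 \<delta> by linarith
    then show "\<exists>D. ((\<lambda>u. virial (l u) \<delta> m (r u) (s u)) has_real_derivative D) (at t within S) \<and>
          \<bar>D - (2 * E - eff_length (l t) \<delta> E * f)\<bar> \<le> max CY Ce * \<bar>p\<bar> * (1 + f)"
    proof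
      assume far: "\<delta> < l t - r t"
      obtain T where T: "open T" "t \<in> T" "\<And>u. u \<in> S \<inter> T \<Longrightarrow> \<delta> < l u - r u"
        using near[OF cont(1) far] by blast
      have within: "at t within S = at t within (S \<inter> T)"
        by (rule at_within_nhd[OF T(2,1)]) auto
      have f_0: "f = 0" using far \<delta> by (simp add: f \<kappa>'_zero)
      have e0: "(e has_real_derivative 0) (at t within S \<inter> T)"
        using e f_0 unfolding within by simp
      have "((\<lambda>u. \<theta> \<delta> m (r u) (s u) (e u)) has_real_derivative
         1 + sqrt (m / 2) * (sgn (s t) * \<phi>J (r t / \<delta>) (e t) * 0 + \<delta> * \<tau>E (r t / \<delta>) (sqrt (m / 2) * s t) (e t) * 0))
         (at t within S \<inter> T)"
      proof (rule \<theta>_curve[OF \<delta>(1) assms(1) _ _ _ s1[unfolded within] _ e0])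
        show "m * ((w - f) / m) = - \<kappa>' (r t / \<delta>) / \<delta>"
          using assms(1) by (simp add: f_0 w)
        show "m * (s u)\<^sup>2 / 2 + \<kappa> (r u / \<delta>) = e u" if "u \<in> S \<inter> T" for u
        proof -
          have "\<kappa> ((l u - r u) / \<delta>) = 0"
            by (rule \<kappa>_zero) (use T(3)[OF that] \<delta> in simp)
          then show ?thesis by (simp add: e_def energy_def)
        qed
      qed (use tS T e r conf within in auto)
      from DERIV_mult[OF DERIV_cmult[OF e0, of 2] this]
      have "((\<lambda>u. 2 * e u * \<theta> \<delta> m (r u) (s u) (e u)) has_real_derivative 2 * E) (at t within S)"
        using e within by simp
      then have "((\<lambda>u. virial (l u) \<delta> m (r u) (s u)) has_real_derivative 2 * E) (at t within S \<inter> T)"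
        unfolding within
      proof (rule has_field_derivative_transform_within[where d = 1])
        fix u assume u: "u \<in> S \<inter> T"
        then have "virial (l u) \<delta> m (r u) (s u) = 2 * e u * \<theta> \<delta> m (r u) (s u) (e u)"
          using T(3)[OF u] EU[of u] l0[of u] \<delta> by (intro virial_cases(1) assms(1)) (auto simp: e_def)
        then show "2 * e u * \<theta> \<delta> m (r u) (s u) (e u) = virial (l u) \<delta> m (r u) (s u)" ..
      qed (use tS T in auto)
      then show ?thesis
        unfolding within by (intro exI[of _ "2 * E"]) (use f_0 \<open>0 \<le> CY\<close> in \<open>auto simp: le_max_iff_disj\<close>)
    next
      assume far: "\<delta> < r t"
      obtain T where T: "open T" "t \<in> T" "\<And>u. u \<in> S \<inter> T \<Longrightarrow> \<delta> < r u"
        using near[OF cont(2) far] by blast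
      have within: "at t within S = at t within (S \<inter> T)"
        by (rule at_within_nhd[OF T(2,1)]) auto
      have w_0: "w = 0" using far \<delta> by (simp add: w \<kappa>'_zero)
      \<comment> \<open>Deviation of the rate of \<open>\<theta>\<close> from one: the wall recedes
        with velocity \<open>p\<close>, and the energy changes at rate
        \<open>- p * f\<close>.\<close>
      define \<rho> where "\<rho> = \<mu> * (sgn (- s t) * \<phi>J ((l t - r t) / \<delta>) E * p + \<delta> * \<tau>E ((l t - r t) / \<delta>) (\<mu> * - s t) E * (- p * f))"
      have "((\<lambda>u. \<theta> \<delta> m (l u - r u) (- s u) (e u)) has_real_derivative
         1 + sqrt (m / 2) * (sgn (- s t) * \<phi>J ((l t - r t) / \<delta>) (e t) * p + \<delta> * \<tau>E ((l t - r t) / \<delta>) (sqrt (m / 2) * - s t) (e t) * (- p * f)))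
         (at t within S \<inter> T)"
      proof (rule \<theta>_curve[where s = "\<lambda>u. - s u", OF \<delta>(1) assms(1) _ _ _ DERIV_minus[OF s1[unfolded within]] _ e(1)[unfolded within]])
        show "m * - ((w - f) / m) = - \<kappa>' ((l t - r t) / \<delta>) / \<delta>"
          using assms(1) by (simp add: w_0 f)
        show "m * (- s u)\<^sup>2 / 2 + \<kappa> ((l u - r u) / \<delta>) = e u" if "u \<in> S \<inter> T" for u
        proof -
          have "\<kappa> (r u / \<delta>) = 0"
            by (rule \<kappa>_zero) (use T(3)[OF that] \<delta> in simp)
          then show ?thesis by (simp add: e_def energy_def)
        qed
        show "((\<lambda>u. l u - r u) has_real_derivative - s t + p) (at t within S \<inter> T)"
          using DERIV_diff[OF l r] unfolding within by (simp add: algebra_simps)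
      qed (use tS T e conf in auto)
      then have th_d: "((\<lambda>u. \<theta> \<delta> m (l u - r u) (- s u) (e u)) has_real_derivative 1 + \<rho>) (at t within S)"
        using e(2) within by (simp add: \<rho>_def \<mu>_def)
      define c' where "c' = exit_time E / (2 * sqrt E) + sqrt E * exit_time' E"
      have "((\<lambda>u. sqrt (e u) * exit_time (e u)) has_real_derivative c' * (- p * f)) (at t within S)"
        by (rule DERIV_chain2[OF C1(3) e(1), THEN DERIV_cong]) (use e in \<open>auto simp: c'_def\<close>)
      from DERIV_add[OF DERIV_diff[OF l DERIV_const] DERIV_cmult[OF this, of "2 * \<delta>"], of "2 * \<delta>"]
    have L_d: "((\<lambda>u. eff_length (l u) \<delta> (e u)) has_real_derivative p + 2 * \<delta> * (c' * (- p * f))) (at t within S)"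
        by (simp add: eff_length_def)
      define D where "D = (2 * (- p * f)) * \<theta> \<delta> m (l t - r t) (- s t) E + (1 + \<rho>) * (2 * E)
        + ((p + 2 * \<delta> * (c' * (- p * f))) * (m * s t) + (w - f) * eff_length (l t) \<delta> E)"
      have "((\<lambda>u. 2 * e u * \<theta> \<delta> m (l u - r u) (- s u) (e u) + eff_length (l u) \<delta> (e u) * (m * s u)) has_real_derivative D) (at t within S)"
        unfolding D_def
        using DERIV_add[OF DERIV_mult[OF DERIV_cmult[OF e(1), of 2] th_d] DERIV_mult[OF L_d s]] e(2) by simp
      then have "((\<lambda>u. virial (l u) \<delta> m (r u) (s u)) has_real_derivative D) (at t within S \<inter> T)"
        unfolding within
      proof (rule has_field_derivative_transform_within[where d = 1])
        fix u assume u: "u \<in> S \<inter> T"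
        then have "virial (l u) \<delta> m (r u) (s u) = 2 * e u * \<theta> \<delta> m (l u - r u) (- s u) (e u) + eff_length (l u) \<delta> (e u) * (m * s u)"
          using T(3)[OF u] EU[of u] l0[of u] \<delta> by (intro virial_cases(2) assms(1)) (auto simp: e_def)
        then show "2 * e u * \<theta> \<delta> m (l u - r u) (- s u) (e u) + eff_length (l u) \<delta> (e u) * (m * s u) = virial (l u) \<delta> m (r u) (s u)" ..
      qed (use tS T in auto)
      moreover have "\<bar>D - (2 * E - eff_length (l t) \<delta> E * f)\<bar> \<le> Ce * (\<bar>p\<bar> * (1 + f))"
      proof -
        have x: "0 < l t - r t" "l t - r t \<le> 1" using conf[OF tS] \<delta>1 by auto
        have pf: "0 \<le> \<bar>p\<bar> * (1 + f)" "\<bar>p * f\<bar> \<le> \<bar>p\<bar> * (1 + f)" "\<bar>p\<bar> \<le> \<bar>p\<bar> * (1 + f)"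
          using f0 by (simp_all add: abs_mult distrib_left)
        have 1: "\<bar>p * f * \<theta> \<delta> m (l t - r t) (- s t) E\<bar> \<le> (\<bar>p\<bar> * (1 + f)) * C\<theta>"
          unfolding abs_mult[of "p * f"] using x \<delta> \<delta>1 e kinE pf nonneg by (intro mult_mono th) auto
        have 2: "\<bar>\<rho>\<bar> \<le> \<mu> * ((CJ + 2 * C0) * (\<bar>p\<bar> * (1 + f)))"
        proof -
          have j: "\<bar>sgn (- s t) * \<phi>J ((l t - r t) / \<delta>) E\<bar> \<le> CJ"
            unfolding abs_mult CJ_def using \<phi>J_bound[of E "(l t - r t) / \<delta>"] e k
            by (cases "s t = 0") (auto simp: sgn_if)
          have "\<bar>sgn (- s t) * \<phi>J ((l t - r t) / \<delta>) E * p\<bar> \<le> CJ * (\<bar>p\<bar> * (1 + f))"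
            unfolding abs_mult[of _ p] using j pf nonneg by (intro mult_mono) auto
          moreover have "\<bar>\<delta> * \<tau>E ((l t - r t) / \<delta>) (\<mu> * - s t) E * (- p * f)\<bar> \<le> 2 * C0 * (\<bar>p\<bar> * (1 + f))"
            unfolding abs_mult[of _ "- p * f"] using x \<delta> \<delta>1 e kinE pf C0 by (intro mult_mono th') auto
          ultimately have "\<bar>sgn (- s t) * \<phi>J ((l t - r t) / \<delta>) E * p + \<delta> * \<tau>E ((l t - r t) / \<delta>) (\<mu> * - s t) E * (- p * f)\<bar>
              \<le> (CJ + 2 * C0) * (\<bar>p\<bar> * (1 + f))"
            unfolding distrib_right by linarith
          then show ?thesis
            unfolding \<rho>_def abs_mult[of \<mu>] using \<mu> by (simp add: mult_left_mono)
        qed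
        have 3: "\<bar>\<rho> * E\<bar> \<le> k1 * (\<mu> * ((CJ + 2 * C0) * (\<bar>p\<bar> * (1 + f))))"
          unfolding abs_mult mult.commute[of "\<bar>\<rho>\<bar>"] using 2 Eab[OF e(3)] k by (intro mult_mono) auto
        have 4: "\<bar>(p + 2 * \<delta> * (c' * (- p * f))) * (m * s t)\<bar> \<le> (1 + 2 * C1) * (\<bar>p\<bar> * (1 + f)) * Cs"
        proof -
          have "\<bar>c' * (- p * f)\<bar> \<le> C1 * (\<bar>p\<bar> * (1 + f))"
            unfolding abs_mult[of c'] using C1(4)[OF e(3)] pf C1(1) by (intro mult_mono) (auto simp: c'_def)
          then have "\<bar>\<delta> * (c' * (- p * f))\<bar> \<le> 1 * (C1 * (\<bar>p\<bar> * (1 + f)))"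
            unfolding abs_mult[of \<delta>] using \<delta> \<delta>1 by (intro mult_mono) auto
          then have "\<bar>p + 2 * \<delta> * (c' * (- p * f))\<bar> \<le> (1 + 2 * C1) * (\<bar>p\<bar> * (1 + f))"
            using pf unfolding distrib_right mult.assoc by linarith
          then show ?thesis
            unfolding abs_mult[of "p + 2 * \<delta> * (c' * (- p * f))"] using ms[OF kinE] pf C1(1) by (intro mult_mono) auto
        qed
        have "D - (2 * E - eff_length (l t) \<delta> E * f) = - (2 * (p * f * \<theta> \<delta> m (l t - r t) (- s t) E)) + 2 * (\<rho> * E)
            + (p + 2 * \<delta> * (c' * (- p * f))) * (m * s t)"
          unfolding D_def w_0 by (simp add: algebra_simps)
        then have "\<bar>D - (2 * E - eff_length (l t) \<delta> E * f)\<bar> \<le> 2 * ((\<bar>p\<bar> * (1 + f)) * C\<theta>)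
            + 2 * (k1 * (\<mu> * ((CJ + 2 * C0) * (\<bar>p\<bar> * (1 + f))))) + (1 + 2 * C1) * (\<bar>p\<bar> * (1 + f)) * Cs"
          using 1 3 4 by linarith
        also have "\<dots> = Ce * (\<bar>p\<bar> * (1 + f))"
          by (simp add: Ce_def algebra_simps)
        finally show ?thesis .
      qed
      moreover have "Ce * (\<bar>p\<bar> * (1 + f)) \<le> max CY Ce * (\<bar>p\<bar> * (1 + f))"
        using f0 by (intro mult_right_mono) auto
      ultimately show ?thesis
        unfolding within by (intro exI[of _ D]) (auto simp: mult.assoc)
    qed
  qed
qed

text \<open>
  \<open>corrector\<close> oscillates with the gas particle; its time derivative is the averaged force on the
  moving wall minus the actual one, up to an error proportional to the speed of the wall.
\<close>

definition corrector :: "real \<Rightarrow> real \<Rightarrow> real \<Rightarrow> real \<Rightarrow> real \<Rightarrow> real" where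
  "corrector l \<delta> m r s = virial l \<delta> m r s / eff_length l \<delta> (energy l \<delta> m r s)"

text \<open>Packaged as a predicate so that a constant can be chosen for every particle at
  once.\<close>

definition corrector_bound :: "real \<Rightarrow> real \<Rightarrow> real \<Rightarrow> bool" where
  "corrector_bound m l0 C \<longleftrightarrow>
    (\<forall>l \<delta> r s. l0 \<le> l \<longrightarrow> l \<le> 1 \<longrightarrow> 0 < \<delta> \<longrightarrow> 4 * \<delta> \<le> l0 \<longrightarrow> energy l \<delta> m r s \<in> U \<longrightarrow>
      \<bar>corrector l \<delta> m r s\<bar> \<le> C) \<and>
    (\<forall>l p \<delta> r s w f S t E. t \<in> S \<longrightarrow> (\<forall>u\<in>S. l0 \<le> l u \<and> l u \<le> 1) \<longrightarrow> 0 < \<delta> \<longrightarrow> 4 * \<delta> \<le> l0 \<longrightarrow>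
      (\<forall>u\<in>S. energy (l u) \<delta> m (r u) (s u) \<in> U) \<longrightarrow> E = energy (l t) \<delta> m (r t) (s t) \<longrightarrow>
      (l has_real_derivative p) (at t within S) \<longrightarrow> (r has_real_derivative s t) (at t within S) \<longrightarrow>
      ((\<lambda>u. m * s u) has_real_derivative w - f) (at t within S) \<longrightarrow>
      w = - \<kappa>' (r t / \<delta>) / \<delta> \<longrightarrow> f = - \<kappa>' ((l t - r t) / \<delta>) / \<delta> \<longrightarrow>
      (\<exists>D. ((\<lambda>u. corrector (l u) \<delta> m (r u) (s u)) has_real_derivative D) (at t within S) \<and>
          \<bar>D - (2 * E / eff_length (l t) \<delta> E - f)\<bar> \<le> C * \<bar>p\<bar> * (1 + f)))"

text \<open>Dividing by the effective length, which is at least \<open>l0 / 2\<close>, isolates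
  \<open>- f\<close>. The length itself changes at a rate of order
  \<open>\<bar>p\<bar> * (1 + f)\<close>, so the quotient rule adds only an error of the kind
  already present.\<close>

lemma corrector_bound_exists:
  assumes "0 < m" "0 < l0"
  shows "\<exists>C\<ge>0. corrector_bound m l0 C"
proof -
  obtain C0 where C0: "0 \<le> C0"
    "\<And>l \<delta> r s. l0 \<le> l \<Longrightarrow> l \<le> 1 \<Longrightarrow> 0 < \<delta> \<Longrightarrow> 4 * \<delta> \<le> l0 \<Longrightarrow> energy l \<delta> m r s \<in> U \<Longrightarrow>
      \<bar>virial l \<delta> m r s\<bar> \<le> C0"
    "\<And>l p \<delta> r s w f S t E.
      \<lbrakk>t \<in> S; \<And>u. u \<in> S \<Longrightarrow> l0 \<le> l u \<and> l u \<le> 1; 0 < \<delta>; 4 * \<delta> \<le> l0;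
       \<And>u. u \<in> S \<Longrightarrow> energy (l u) \<delta> m (r u) (s u) \<in> U; E = energy (l t) \<delta> m (r t) (s t);
       (l has_real_derivative p) (at t within S); (r has_real_derivative s t) (at t within S);
       ((\<lambda>u. m * s u) has_real_derivative w - f) (at t within S);
       w = - \<kappa>' (r t / \<delta>) / \<delta>; f = - \<kappa>' ((l t - r t) / \<delta>) / \<delta>\<rbrakk> \<Longrightarrow>
      \<exists>D. ((\<lambda>u. virial (l u) \<delta> m (r u) (s u)) has_real_derivative D) (at t within S) \<and>
          \<bar>D - (2 * E - eff_length (l t) \<delta> E * f)\<bar> \<le> C0 * \<bar>p\<bar> * (1 + f)"
    using virial_curve[OF assms] by blast
  obtain C1 where C1: "0 \<le> C1" "\<And>E. E \<in> U \<Longrightarrow> sqrt E * exit_time E \<le> C1"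
    "\<And>E. E \<in> U \<Longrightarrow> ((\<lambda>E. sqrt E * exit_time E) has_real_derivative exit_time E / (2 * sqrt E) + sqrt E * exit_time' E) (at E)"
    "\<And>E. E \<in> U \<Longrightarrow> \<bar>exit_time E / (2 * sqrt E) + sqrt E * exit_time' E\<bar> \<le> C1"
    using exit_time_bounds by blast
  have L: "l0 / 2 \<le> eff_length l \<delta> E" if "l0 \<le> l" "0 < \<delta>" "4 * \<delta> \<le> l0" "E \<in> U" for l \<delta> E
    using eff_length_ge[of \<delta> E l] that by simp
  define A where "A = C0 / (l0 / 2)"
  define B where "B = A + C0 * (1 + 2 * C1) / (l0 / 2)\<^sup>2"
  have "0 \<le> A" using C0 assms by (simp add: A_def)
  have "A \<le> B" using C0 C1 assms by (simp add: B_def)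
  show ?thesis
    unfolding corrector_bound_def
  proof (rule exI[of _ B], intro conjI allI impI)
    show "0 \<le> B" using \<open>0 \<le> A\<close> \<open>A \<le> B\<close> by simp
  next
    fix l \<delta> r s :: real
    assume l: "l0 \<le> l" "l \<le> 1" and \<delta>: "0 < \<delta>" "4 * \<delta> \<le> l0" and E: "energy l \<delta> m r s \<in> U"
    have "\<bar>corrector l \<delta> m r s\<bar> \<le> A"
      unfolding corrector_def abs_divide A_def
      by (rule frac_le) (use C0(2)[OF l \<delta> E] C0(1) assms L[OF l(1) \<delta> E] in auto)
    then show "\<bar>corrector l \<delta> m r s\<bar> \<le> B" using \<open>A \<le> B\<close> by simp
  next
    fix l r s :: "real \<Rightarrow> real" and p \<delta> w f t E S
    assume tS: "t \<in> S" and l0': "\<forall>u\<in>S. l0 \<le> l u \<and> l u \<le> 1" and \<delta>: "0 < \<delta>" "4 * \<delta> \<le> l0"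
      and EU': "\<forall>u\<in>S. energy (l u) \<delta> m (r u) (s u) \<in> U" and E_def: "E = energy (l t) \<delta> m (r t) (s t)"
      and l: "(l has_real_derivative p) (at t within S)" and r: "(r has_real_derivative s t) (at t within S)"
      and s: "((\<lambda>u. m * s u) has_real_derivative w - f) (at t within S)"
      and w: "w = - \<kappa>' (r t / \<delta>) / \<delta>" and f: "f = - \<kappa>' ((l t - r t) / \<delta>) / \<delta>"
    note l0 = l0'[rule_format] and EU = EU'[rule_format]
    define e where "e = (\<lambda>u. energy (l u) \<delta> m (r u) (s u))"
    have e: "(e has_real_derivative - p * f) (at t within S)" "e t = E" "E \<in> U"
      using energy_curve[OF \<delta>(1) l r s w f assms(1)] EU[OF tS] by (auto simp: e_def E_def)
    have f0: "0 \<le> f" using \<kappa>'_nonpos[of "(l t - r t) / \<delta>"] \<delta> by (simp add: f divide_nonpos_pos)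
    have lt: "l0 \<le> l t" "l t \<le> 1" using l0[OF tS] by auto
    obtain D where D: "((\<lambda>u. virial (l u) \<delta> m (r u) (s u)) has_real_derivative D) (at t within S)"
      "\<bar>D - (2 * E - eff_length (l t) \<delta> E * f)\<bar> \<le> C0 * \<bar>p\<bar> * (1 + f)"
      using C0(3)[OF tS l0 \<delta> EU E_def l r s w f] by blast
    define c' where "c' = exit_time E / (2 * sqrt E) + sqrt E * exit_time' E"
    have "((\<lambda>u. sqrt (e u) * exit_time (e u)) has_real_derivative c' * (- p * f)) (at t within S)"
      by (rule DERIV_chain2[OF C1(3) e(1), THEN DERIV_cong]) (use e in \<open>auto simp: c'_def\<close>)
    from DERIV_add[OF DERIV_diff[OF l DERIV_const] DERIV_cmult[OF this, of "2 * \<delta>"], of "2 * \<delta>"]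
    have L_d: "((\<lambda>u. eff_length (l u) \<delta> (e u)) has_real_derivative p + 2 * \<delta> * (c' * (- p * f))) (at t within S)"
      by (simp add: eff_length_def)
    define N where "N = eff_length (l t) \<delta> E"
    define Y where "Y = virial (l t) \<delta> m (r t) (s t)"
    define L' where "L' = p + 2 * \<delta> * (c' * (- p * f))"
    have N: "l0 / 2 \<le> N" unfolding N_def using L[OF lt(1) \<delta> e(3)] .
    then have "0 < N" using assms by simp
    have "((\<lambda>u. corrector (l u) \<delta> m (r u) (s u)) has_real_derivative (D * N - Y * L') / (N * N)) (at t within S)"
      unfolding corrector_def using DERIV_divide[OF D(1) L_d[unfolded e_def]] \<open>0 < N\<close> e(2)
      by (simp add: N_def Y_def L'_def e_def)
    moreover have "\<bar>(D * N - Y * L') / (N * N) - (2 * E / N - f)\<bar> \<le> B * \<bar>p\<bar> * (1 + f)"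
    proof -
      have pf: "0 \<le> \<bar>p\<bar> * (1 + f)" "\<bar>p * f\<bar> \<le> \<bar>p\<bar> * (1 + f)" "\<bar>p\<bar> \<le> \<bar>p\<bar> * (1 + f)"
        using f0 by (simp_all add: abs_mult distrib_left)
      have "(D * N - Y * L') / (N * N) - (2 * E / N - f) = (D - (2 * E - N * f)) / N - Y * L' / N\<^sup>2"
        using \<open>0 < N\<close> by (simp add: field_simps power2_eq_square)
      moreover have "\<bar>(D - (2 * E - N * f)) / N\<bar> \<le> C0 * \<bar>p\<bar> * (1 + f) / (l0 / 2)"
        unfolding abs_divide using D(2) N assms C0(1) f0 by (intro frac_le) (auto simp: N_def)
      moreover have "\<bar>Y * L' / N\<^sup>2\<bar> \<le> C0 * ((1 + 2 * C1) * (\<bar>p\<bar> * (1 + f))) / (l0 / 2)\<^sup>2"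
      proof -
        have "\<bar>c' * (- p * f)\<bar> \<le> C1 * (\<bar>p\<bar> * (1 + f))"
          unfolding abs_mult[of c'] using C1(4)[OF e(3)] pf C1(1) by (intro mult_mono) (auto simp: c'_def)
        then have "\<bar>\<delta> * (c' * (- p * f))\<bar> \<le> 1 * (C1 * (\<bar>p\<bar> * (1 + f)))"
          unfolding abs_mult[of \<delta>] using \<delta> lt by (intro mult_mono) auto
        then have L': "\<bar>L'\<bar> \<le> (1 + 2 * C1) * (\<bar>p\<bar> * (1 + f))"
          using pf unfolding L'_def distrib_right mult.assoc by linarith
        have "\<bar>Y\<bar> \<le> C0" unfolding Y_def by (rule C0(2)[OF lt \<delta> EU[OF tS]])
        then have "\<bar>Y * L'\<bar> \<le> C0 * ((1 + 2 * C1) * (\<bar>p\<bar> * (1 + f)))"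
          unfolding abs_mult using L' C0(1) by (intro mult_mono) auto
        moreover have "(l0 / 2)\<^sup>2 \<le> \<bar>N\<^sup>2\<bar>"
          using N assms by (simp add: power_mono)
        ultimately show ?thesis
          unfolding abs_divide using assms C0(1) C1(1) pf by (intro frac_le) auto
      qed
      ultimately have "\<bar>(D * N - Y * L') / (N * N) - (2 * E / N - f)\<bar>
          \<le> C0 * \<bar>p\<bar> * (1 + f) / (l0 / 2) + C0 * ((1 + 2 * C1) * (\<bar>p\<bar> * (1 + f))) / (l0 / 2)\<^sup>2"
        by (metis (no_types, lifting) order_trans[OF abs_triangle_ineq4 add_mono])
      also have "\<dots> = B * \<bar>p\<bar> * (1 + f)"
        by (simp add: B_def A_def algebra_simps add_divide_distrib)
      finally show ?thesis .
    qed
    ultimately show "\<exists>D. ((\<lambda>u. corrector (l u) \<delta> m (r u) (s u)) has_real_derivative D) (at t within S) \<and>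
          \<bar>D - (2 * E / eff_length (l t) \<delta> E - f)\<bar> \<le> B * \<bar>p\<bar> * (1 + f)"
      unfolding N_def by blast
  qed
qed

subsection \<open>The period\<close>

text \<open>The absolute value of \<open>\<tau>\<close> on the energy surface, as a function of the
  position alone.\<close>

definition \<tau>_pos :: "real \<Rightarrow> real \<Rightarrow> real" where
  "\<tau>_pos E x = 2 * pint \<phi>I (sqrt (E - \<kappa> x)) E + pint \<phi>J x E"

lemma \<tau>_eq_\<tau>_pos:
  assumes "E \<in> U" "\<kappa> x + w\<^sup>2 = E" "0 < x"
  shows "0 \<le> w \<Longrightarrow> \<tau> x w E = \<tau>_pos E x" "w \<le> 0 \<Longrightarrow> \<tau> x w E = - \<tau>_pos E x"
proof -
  have "E - \<kappa> x = w\<^sup>2" using assms by simp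
  then have w: "sqrt (E - \<kappa> x) = \<bar>w\<bar>" by simp
  have 0: "pint \<phi>J x E = 0" if "w = 0"
    by (rule pint_\<phi>J_0) (use assms k that in auto)
  show "0 \<le> w \<Longrightarrow> \<tau> x w E = \<tau>_pos E x"
    using 0 by (cases "w = 0") (auto simp: \<tau>_def \<tau>_pos_def w)
  show "w \<le> 0 \<Longrightarrow> \<tau> x w E = - \<tau>_pos E x"
    using 0 pint_\<phi>I_minus[of w E] by (cases "w = 0") (auto simp: \<tau>_def \<tau>_pos_def w)
qed

lemma \<tau>_pos_nonneg:
  assumes "E \<in> U" "\<kappa> x \<le> E" "0 < x"
  shows "0 \<le> \<tau>_pos E x"
proof -
  have "E - r\<^sup>2 \<le> k1" for r
    using assms zero_le_power2[of r] by (simp, linarith)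
  with assms show ?thesis
    unfolding \<tau>_pos_def
    by (intro add_nonneg_nonneg mult_nonneg_nonneg pint_nonneg continuous_fixed gA_nonneg \<phi>J_nonneg) auto
qed

text \<open>The cutoff disappears from the derivative: the two parts add up to
  \<open>1 / sqrt (E - \<kappa> z)\<close>, the positive integrand of the unsplit time
  integral.\<close>

lemma \<tau>_pos_strict_mono:
  assumes "E \<in> U" "\<kappa> x \<le> E" "0 < x" "x < y"
  shows "\<tau>_pos E x < \<tau>_pos E y"
proof (rule DERIV_pos_imp_increasing_open[OF \<open>x < y\<close>])
  have cI: "continuous_on UNIV (\<lambda>w. pint \<phi>I w E)" and cJ: "continuous_on UNIV (\<lambda>x. pint \<phi>J x E)"
    by (rule DERIV_continuous_on[OF has_field_derivative_at_within[OF pint_has_real_derivative]],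
        rule continuous_fixed[OF assms(1)])+
  show "continuous_on {x..y} (\<tau>_pos E)"
    unfolding \<tau>_pos_def
    by (intro continuous_intros continuous_on_compose2[OF cI] continuous_on_subset[OF cJ] \<kappa>_cont) auto
  fix z assume z: "x < z" "z < y"
  have "\<kappa> z < E"
  proof (cases "z < 1")
    case True
    then show ?thesis using \<kappa>_strict_antimono[OF z(1)] assms(2) by simp
  next
    case False
    then show ?thesis using \<kappa>_zero[of z] assms(1) k by simp
  qed
  define u where "u = sqrt (E - \<kappa> z)"
  have u: "0 < u" "u\<^sup>2 = E - \<kappa> z" using \<open>\<kappa> z < E\<close> by (auto simp: u_def)
  have "((\<lambda>z. sqrt (E - \<kappa> z)) has_real_derivative - \<kappa>' z / (2 * u)) (at z)"
    using \<open>\<kappa> z < E\<close> by (auto intro!: derivative_eq_intros \<kappa>_deriv simp: u_def field_simps)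
  from DERIV_chain2[OF pint_has_real_derivative[of \<phi>I E, OF continuous_fixed(1)[OF assms(1)]] this]
  have "((\<lambda>z. pint \<phi>I (sqrt (E - \<kappa> z)) E) has_real_derivative gA (\<kappa> z) * (- \<kappa>' z / (2 * u))) (at z)"
    using \<open>\<kappa> z < E\<close> by simp
  from DERIV_add[OF DERIV_cmult[OF this, of 2] pint_has_real_derivative[of \<phi>J E, OF continuous_fixed(3)[OF assms(1)]]]
  have d: "(\<tau>_pos E has_real_derivative 2 * (gA (\<kappa> z) * (- \<kappa>' z / (2 * u))) + \<phi>J z E) (at z)"
    unfolding \<tau>_pos_def by simp
  have "2 * (gA (\<kappa> z) * (- \<kappa>' z / (2 * u))) = gA (\<kappa> z) * - \<kappa>' z / u"
    by simp
  also have "gA (\<kappa> z) * - \<kappa>' z = \<alpha> (\<kappa> z)"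
    by (rule gA_\<kappa>) (use z assms in simp)
  finally have 1: "2 * (gA (\<kappa> z) * (- \<kappa>' z / (2 * u))) = \<alpha> (\<kappa> z) / u" .
  have 2: "\<phi>J z E = (1 - \<alpha> (\<kappa> z)) / u"
    using \<phi>J_mult[of E z] assms(1) u(1) by (simp add: u_def field_simps)
  have "(\<tau>_pos E has_real_derivative 1 / u) (at z)"
    using d unfolding 1 2 by (simp flip: add_divide_distrib)
  then show "\<exists>D. (\<tau>_pos E has_real_derivative D) (at z) \<and> 0 < D"
    using u(1) by (intro exI[of _ "1 / u"]) simp
qed

text \<open>The sign of \<open>\<tau>\<close> tells the way in from the way out, and its absolute
  value \<open>\<tau>_pos\<close> determines the distance.\<close>

lemma \<tau>_inj:
  assumes "E \<in> U" and 1: "\<kappa> x1 + w1\<^sup>2 = E" "0 < x1" and 2: "\<kappa> x2 + w2\<^sup>2 = E" "0 < x2"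
    and eq: "\<tau> x1 w1 E = \<tau> x2 w2 E"
  shows "x1 = x2"
proof -
  have le: "\<kappa> x1 \<le> E" "\<kappa> x2 \<le> E"
    using 1 2 zero_le_power2[of w1] zero_le_power2[of w2] by linarith+
  have inj: "x1 = x2" if "\<tau>_pos E x1 = \<tau>_pos E x2"
    using that \<tau>_pos_strict_mono[OF assms(1) le(1) 1(2), of x2] \<tau>_pos_strict_mono[OF assms(1) le(2) 2(2), of x1]
    by (cases x1 x2 rule: linorder_cases) auto
  have nonneg: "0 \<le> \<tau>_pos E x1" "0 \<le> \<tau>_pos E x2"
    using \<tau>_pos_nonneg[OF assms(1)] le 1 2 by auto
  note t1 = \<tau>_eq_\<tau>_pos[OF assms(1) 1] and t2 = \<tau>_eq_\<tau>_pos[OF assms(1) 2]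
  have "\<tau>_pos E x1 = \<tau>_pos E x2"
    using t1 t2 eq nonneg by (cases "0 \<le> w1"; cases "0 \<le> w2") auto
  then show ?thesis by (rule inj)
qed

lemma \<tau>_abs_less:
  assumes "E \<in> U" "\<kappa> x + w\<^sup>2 = E" "0 < x" "1 \<le> y"
  shows "x < y \<Longrightarrow> \<bar>\<tau> x w E\<bar> < (y - 1) / sqrt E + exit_time E" "x \<le> y \<Longrightarrow> \<bar>\<tau> x w E\<bar> \<le> (y - 1) / sqrt E + exit_time E"
proof -
  have le: "\<kappa> x \<le> E" using assms(2) zero_le_power2[of w] by linarith
  have "\<bar>\<tau> x w E\<bar> = \<tau>_pos E x"
    using \<tau>_eq_\<tau>_pos[OF assms(1-3)] \<tau>_pos_nonneg[OF assms(1) le assms(3)] by (cases "0 \<le> w") auto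
  moreover have "\<tau>_pos E y = (y - 1) / sqrt E + exit_time E"
    using pint_\<phi>J_beyond[OF assms(1,4)] \<kappa>_zero[OF assms(4)] by (simp add: \<tau>_pos_def exit_time_def)
  ultimately show "x < y \<Longrightarrow> \<bar>\<tau> x w E\<bar> < (y - 1) / sqrt E + exit_time E" "x \<le> y \<Longrightarrow> \<bar>\<tau> x w E\<bar> \<le> (y - 1) / sqrt E + exit_time E"
    using \<tau>_pos_strict_mono[OF assms(1) le assms(3), of y] by (auto simp: le_less)
qed

text \<open>The round trip time \<open>2 * L / sqrt (2 * E / m)\<close> of a free particle in a hard
  box of length \<open>L = eff_length l \<delta> E\<close>.\<close>

definition period_of :: "real \<Rightarrow> real \<Rightarrow> real \<Rightarrow> real \<Rightarrow> real" where
  "period_of l \<delta> m E = 2 * sqrt (m / 2) * eff_length l \<delta> E / sqrt E"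

text \<open>Elapsed time wound onto the unit circle, one period being one turn. The two turning
  points go to \<open>1\<close> and \<open>-1\<close>; the minus sign accounts for the half period
  between them. On the circle the descriptions from the two walls fit together, which the elapsed
  times do only up to a period.\<close>

definition phase_map :: "real \<Rightarrow> real \<Rightarrow> real \<Rightarrow> real \<Rightarrow> real \<Rightarrow> real \<Rightarrow> complex" where
  "phase_map l \<delta> m E r s = (let \<omega> = 2 * pi / period_of l \<delta> m E in
     if r < l / 2 then cis (\<omega> * \<theta> \<delta> m r s E) else - cis (\<omega> * \<theta> \<delta> m (l - r) (- s) E))"

context
  fixes l \<delta> m E :: real
  assumes \<delta>: "0 < \<delta>" "4 * \<delta> \<le> l" and m: "0 < m" and E: "E \<in> U"
begin

private definition "\<omega> = 2 * pi / period_of l \<delta> m E"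

private lemma period_pos: "0 < period_of l \<delta> m E"
  using eff_length_ge[of \<delta> E l] \<delta> m E k by (auto simp: period_of_def intro!: divide_pos_pos mult_pos_pos)

private lemma \<omega>_pos: "0 < \<omega>"
  using period_pos by (simp add: \<omega>_def)

private lemma \<omega>_period: "\<omega> * period_of l \<delta> m E = 2 * pi"
  using period_pos by (simp add: \<omega>_def)

text \<open>In the middle the two elapsed times differ by plus or minus half a period, and either
  sign gives the factor \<open>-1\<close> on the circle.\<close>

private lemma phase_map_cases:
  assumes "energy l \<delta> m r s = E"
  shows "r \<le> l - \<delta> \<Longrightarrow> phase_map l \<delta> m E r s = cis (\<omega> * \<theta> \<delta> m r s E)"
    and "\<delta> \<le> r \<Longrightarrow> phase_map l \<delta> m E r s = - cis (\<omega> * \<theta> \<delta> m (l - r) (- s) E)"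
proof -
  have eq: "cis (\<omega> * \<theta> \<delta> m r s E) = - cis (\<omega> * \<theta> \<delta> m (l - r) (- s) E)" if "\<delta> \<le> r" "r \<le> l - \<delta>"
  proof -
    have *: "m * s\<^sup>2 / 2 = E"
      using that \<delta> assms by (simp add: energy_def \<kappa>_zero)
    then have "s \<noteq> 0" using E k by auto
    have "\<theta> \<delta> m r s E = \<theta> \<delta> m (l - r) (- s) E + sgn s * (period_of l \<delta> m E / 2)"
      using \<theta>_match[OF \<delta>(1) m E that *] by (simp add: period_of_def)
    then have "\<omega> * \<theta> \<delta> m r s E = \<omega> * \<theta> \<delta> m (l - r) (- s) E + sgn s * (\<omega> * period_of l \<delta> m E / 2)"
      by (simp add: distrib_left)
    also have "\<dots> = \<omega> * \<theta> \<delta> m (l - r) (- s) E + sgn s * pi"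
      unfolding \<omega>_period by simp
    finally show ?thesis
      using \<open>s \<noteq> 0\<close> by (auto simp: sgn_if complex_eq_iff)
  qed
  show "r \<le> l - \<delta> \<Longrightarrow> phase_map l \<delta> m E r s = cis (\<omega> * \<theta> \<delta> m r s E)"
    using eq \<delta> by (cases "r < l / 2") (auto simp: phase_map_def \<omega>_def Let_def)
  show "\<delta> \<le> r \<Longrightarrow> phase_map l \<delta> m E r s = - cis (\<omega> * \<theta> \<delta> m (l - r) (- s) E)"
    using eq \<delta> by (cases "r < l / 2") (auto simp: phase_map_def \<omega>_def Let_def)
qed

private lemma energy_left:
  "energy l \<delta> m r s = E \<Longrightarrow> r \<le> l - \<delta> \<Longrightarrow> \<kappa> (r / \<delta>) + (sqrt (m / 2) * s)\<^sup>2 = E"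
  using \<delta> m by (simp add: energy_def power_mult_distrib \<kappa>_zero)

private lemma energy_right:
  "energy l \<delta> m r s = E \<Longrightarrow> \<delta> \<le> r \<Longrightarrow> \<kappa> ((l - r) / \<delta>) + (sqrt (m / 2) * - s)\<^sup>2 = E"
  using \<delta> m by (simp add: energy_def power_mult_distrib \<kappa>_zero)

text \<open>The elapsed time increases strictly with the distance from the wall, and at the midpoint
  of the box it is a quarter of the period.\<close>

private lemma \<theta>_quarter:
  assumes "0 < x" "\<kappa> (x / \<delta>) + (sqrt (m / 2) * s)\<^sup>2 = E"
  shows "x < l / 2 \<Longrightarrow> \<bar>\<omega> * \<theta> \<delta> m x s E\<bar> < pi / 2" "x \<le> l / 2 \<Longrightarrow> \<bar>\<omega> * \<theta> \<delta> m x s E\<bar> \<le> pi / 2"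
proof -
  have \<mu>: "0 < \<omega> * (\<delta> * sqrt (m / 2))" using \<omega>_pos \<delta> m by simp
  have 0: "0 < sqrt E" using E k by auto
  have p4: "\<delta> * sqrt (m / 2) * ((l / 2 / \<delta> - 1) / sqrt E + exit_time E) = period_of l \<delta> m E / 4"
    using \<delta> 0 by (simp add: period_of_def eff_length_def field_simps)
  have q: "\<omega> * (\<delta> * sqrt (m / 2)) * ((l / 2 / \<delta> - 1) / sqrt E + exit_time E) = pi / 2"
    unfolding mult.assoc[of \<omega>] p4 using \<omega>_period by simp
  have a: "\<bar>\<omega> * \<theta> \<delta> m x s E\<bar> = \<omega> * (\<delta> * sqrt (m / 2)) * \<bar>\<tau> (x / \<delta>) (sqrt (m / 2) * s) E\<bar>"
    using \<mu> \<omega>_pos \<delta> m by (simp add: \<theta>_def abs_mult)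
  have x: "0 < x / \<delta>" "1 \<le> l / 2 / \<delta>" using assms \<delta> by auto
  note t = \<tau>_abs_less[OF E assms(2) x]
  show "x < l / 2 \<Longrightarrow> \<bar>\<omega> * \<theta> \<delta> m x s E\<bar> < pi / 2"
    unfolding a q[symmetric] using \<delta>
    by (intro mult_strict_left_mono[OF t(1) \<mu>] divide_strict_right_mono)
  show "x \<le> l / 2 \<Longrightarrow> \<bar>\<omega> * \<theta> \<delta> m x s E\<bar> \<le> pi / 2"
    unfolding a q[symmetric] using \<delta>
    by (intro mult_left_mono[OF t(2) less_imp_le[OF \<mu>]] divide_right_mono) auto
qed

private lemma \<theta>_inj:
  assumes "0 < x1" "\<kappa> (x1 / \<delta>) + (sqrt (m / 2) * s1)\<^sup>2 = E" "x1 \<le> l / 2"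
    and "0 < x2" "\<kappa> (x2 / \<delta>) + (sqrt (m / 2) * s2)\<^sup>2 = E" "x2 \<le> l / 2"
    and "sin (\<omega> * \<theta> \<delta> m x1 s1 E) = sin (\<omega> * \<theta> \<delta> m x2 s2 E)"
  shows "x1 = x2"
proof -
  have "\<bar>\<omega> * \<theta> \<delta> m x1 s1 E\<bar> \<le> pi / 2" "\<bar>\<omega> * \<theta> \<delta> m x2 s2 E\<bar> \<le> pi / 2"
    using \<theta>_quarter(2)[OF assms(1-3)] \<theta>_quarter(2)[OF assms(4-6)] .
  then have "\<omega> * \<theta> \<delta> m x1 s1 E = \<omega> * \<theta> \<delta> m x2 s2 E"
    unfolding abs_le_iff by (intro sin_inj_pi[OF _ _ _ _ assms(7)]) linarith+
  then have eq: "\<tau> (x1 / \<delta>) (sqrt (m / 2) * s1) E = \<tau> (x2 / \<delta>) (sqrt (m / 2) * s2) E"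
    using \<omega>_pos \<delta> m by (simp add: \<theta>_def)
  have "0 < x1 / \<delta>" "0 < x2 / \<delta>" using assms \<delta> by auto
  from \<tau>_inj[OF E assms(2) this(1) assms(5) this(2) eq]
  have "x1 / \<delta> = x2 / \<delta>" .
  then show ?thesis using \<delta> by simp
qed

text \<open>The real part of the phase tells in which half of the box the particle is. Within one
  half the angle stays in \<open>{- pi / 2..pi / 2}\<close>, where its sine determines it, and with
  it the position.\<close>

private lemma phase_map_inj:
  assumes 1: "energy l \<delta> m r1 s1 = E" and 2: "energy l \<delta> m r2 s2 = E"
    and eq: "phase_map l \<delta> m E r1 s1 = phase_map l \<delta> m E r2 s2"
  shows "r1 = r2"
proof -
  have conf: "0 < r1" "r1 < l" "0 < r2" "r2 < l"
    using energy_confined[OF \<delta>(1) m, of l r1 s1] energy_confined[OF \<delta>(1) m, of l r2 s2] 1 2 E by auto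
  have left: "0 < Re (phase_map l \<delta> m E r s)" if "energy l \<delta> m r s = E" "0 < r" "r < l / 2" for r s
  proof -
    have "r \<le> l - \<delta>" using that \<delta> by simp
    then show ?thesis
      using phase_map_cases(1)[OF that(1)] \<theta>_quarter(1)[OF that(2) energy_left[OF that(1)] that(3)]
      by (simp add: cos_gt_zero_pi abs_less_iff)
  qed
  have right: "Re (phase_map l \<delta> m E r s) \<le> 0" if "energy l \<delta> m r s = E" "r < l" "l / 2 \<le> r" for r s
  proof -
    have "\<delta> \<le> r" using that \<delta> by simp
    then have "\<bar>\<omega> * \<theta> \<delta> m (l - r) (- s) E\<bar> \<le> pi / 2"
      using \<theta>_quarter(2)[of "l - r" "- s"] energy_right[OF that(1)] that by simp
    then have "0 \<le> cos (\<omega> * \<theta> \<delta> m (l - r) (- s) E)"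
      by (intro cos_ge_zero) auto
    then show ?thesis
      using phase_map_cases(2)[OF that(1) \<open>\<delta> \<le> r\<close>] by simp
  qed
  show ?thesis
  proof (cases "r1 < l / 2")
    case True
    then have "r2 < l / 2"
      using left[OF 1] right[OF 2] conf eq by (cases "r2 < l / 2") auto
    with True show ?thesis
      using eq phase_map_cases(1)[OF 1] phase_map_cases(1)[OF 2] conf \<delta>
      by (intro \<theta>_inj[OF conf(1) energy_left[OF 1] _ conf(3) energy_left[OF 2]]) (auto simp: complex_eq_iff)
  next
    case False
    then have "\<not> r2 < l / 2"
      using left[OF 2] right[OF 1] conf eq by (cases "r2 < l / 2") auto
    with False have "l - r1 = l - r2"
      using eq phase_map_cases(2)[OF 1] phase_map_cases(2)[OF 2] conf \<delta>
      by (intro \<theta>_inj[OF _ energy_right[OF 1] _ _ energy_right[OF 2]]) (auto simp: complex_eq_iff)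
    then show ?thesis by simp
  qed
qed

text \<open>Between frozen walls the elapsed times have rate exactly one, so the phase solves
  \<open>c' = \<omega> * \<i> * c\<close> near either wall. This linear equation is integrated by
  multiplying with \<open>cis (\<omega> * - t)\<close>.\<close>

private lemma phase_map_rotates:
  assumes r: "\<And>t. (r has_real_derivative s t) (at t)"
    and s: "\<And>t. ((\<lambda>t. m * s t) has_real_derivative - \<kappa>' (r t / \<delta>) / \<delta> + \<kappa>' ((l - r t) / \<delta>) / \<delta>) (at t)"
    and en: "\<And>t. energy l \<delta> m (r t) (s t) = E"
  shows "phase_map l \<delta> m E (r t) (s t) = phase_map l \<delta> m E (r 0) (s 0) * cis (\<omega> * t)"
proof -
  define c where "c = (\<lambda>t. phase_map l \<delta> m E (r t) (s t))"
  have s1: "(s has_real_derivative (- \<kappa>' (r t / \<delta>) / \<delta> + \<kappa>' ((l - r t) / \<delta>) / \<delta>) / m) (at t)" for t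
    using DERIV_cdivide[OF s[of t], of m] m by simp
  have conf: "0 < r t" "r t < l" for t
    using energy_confined[OF \<delta>(1) m, of l "r t" "s t"] en E by auto
  have cont: "continuous_on UNIV r"
    by (rule DERIV_continuous_on[OF has_field_derivative_at_within[OF r]])
  have cis_d: "((\<lambda>t. cis (\<omega> * g t)) has_vector_derivative \<omega> *\<^sub>R (\<i> * cis (\<omega> * g t))) (at t)"
    if "(g has_real_derivative 1) (at t)" for g :: "real \<Rightarrow> real" and t
    unfolding has_vector_derivative_complex_iff using that by (auto intro!: derivative_eq_intros)
  have d: "(c has_vector_derivative \<omega> *\<^sub>R (\<i> * c t)) (at t)" for t
  proof (cases "r t < l - \<delta>")
    case True
    have op: "open (r -` {..<l - \<delta>})" by (rule open_vimage[OF _ cont]) auto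
    have "((\<lambda>u. \<theta> \<delta> m (r u) (s u) E) has_real_derivative
      1 + sqrt (m / 2) * (sgn (s t) * \<phi>J (r t / \<delta>) E * 0 + \<delta> * \<tau>E (r t / \<delta>) (sqrt (m / 2) * s t) E * 0))
      (at t within r -` {..<l - \<delta>})"
    proof (rule \<theta>_curve[where E = "\<lambda>_. E", OF \<delta>(1) m])
      show "(s has_real_derivative - \<kappa>' (r t / \<delta>) / \<delta> / m) (at t within r -` {..<l - \<delta>})"
        using s1[of t] \<kappa>'_zero[of "(l - r t) / \<delta>"] True \<delta> by (auto intro: has_field_derivative_at_within)
      show "m * (s u)\<^sup>2 / 2 + \<kappa> (r u / \<delta>) = E" if "u \<in> r -` {..<l - \<delta>}" for u
        using en[of u] \<kappa>_zero[of "(l - r u) / \<delta>"] that \<delta> by (simp add: energy_def)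
    qed (use E True m r conf in \<open>auto intro: has_field_derivative_at_within\<close>)
    then have "((\<lambda>u. \<theta> \<delta> m (r u) (s u) E) has_real_derivative 1) (at t)"
      using at_within_open[of t "r -` {..<l - \<delta>}"] op True by simp
    from cis_d[OF this]
    have "(c has_vector_derivative \<omega> *\<^sub>R (\<i> * cis (\<omega> * \<theta> \<delta> m (r t) (s t) E))) (at t)"
      by (rule has_vector_derivative_transform_within_open[OF _ op])
        (use True phase_map_cases(1)[OF en] in \<open>auto simp: c_def\<close>)
    then show ?thesis
      using phase_map_cases(1)[OF en, of t] True by (simp add: c_def)
  next
    case False
    then have rt: "\<delta> < r t" using \<delta> by simp
    have op: "open (r -` {\<delta><..})" by (rule open_vimage[OF _ cont]) auto
    have "((\<lambda>u. \<theta> \<delta> m (l - r u) (- s u) E) has_real_derivative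
      1 + sqrt (m / 2) * (sgn (- s t) * \<phi>J ((l - r t) / \<delta>) E * 0 + \<delta> * \<tau>E ((l - r t) / \<delta>) (sqrt (m / 2) * - s t) E * 0))
      (at t within r -` {\<delta><..})"
    proof (rule \<theta>_curve[where E = "\<lambda>_. E" and s = "\<lambda>u. - s u", OF \<delta>(1) m])
      show "((\<lambda>u. - s u) has_real_derivative - (\<kappa>' ((l - r t) / \<delta>) / \<delta> / m)) (at t within r -` {\<delta><..})"
        using s1[of t] \<kappa>'_zero[of "r t / \<delta>"] rt \<delta> by (auto intro!: has_field_derivative_at_within DERIV_minus)
      show "m * (- s u)\<^sup>2 / 2 + \<kappa> ((l - r u) / \<delta>) = E" if "u \<in> r -` {\<delta><..}" for u
        using en[of u] \<kappa>_zero[of "r u / \<delta>"] that \<delta> by (simp add: energy_def)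
      show "((\<lambda>u. l - r u) has_real_derivative - s t + 0) (at t within r -` {\<delta><..})"
        using DERIV_diff[OF DERIV_const r] by (auto intro: has_field_derivative_at_within)
    qed (use E rt m conf in auto)
    then have "((\<lambda>u. \<theta> \<delta> m (l - r u) (- s u) E) has_real_derivative 1) (at t)"
      using at_within_open[of t "r -` {\<delta><..}"] op rt by simp
    from has_vector_derivative_minus[OF cis_d[OF this]]
    have "(c has_vector_derivative - (\<omega> *\<^sub>R (\<i> * cis (\<omega> * \<theta> \<delta> m (l - r t) (- s t) E)))) (at t)"
      by (rule has_vector_derivative_transform_within_open[OF _ op])
        (use rt phase_map_cases(2)[OF en] in \<open>auto simp: c_def\<close>)
    then show ?thesis
      using phase_map_cases(2)[OF en, of t] rt by (simp add: c_def)
  qed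
  have "((\<lambda>t. c t * cis (\<omega> * - t)) has_vector_derivative 0) (at t)" for t
  proof -
    have "((\<lambda>t. cis (- (\<omega> * t))) has_vector_derivative - (\<omega> *\<^sub>R (\<i> * cis (- (\<omega> * t))))) (at t)"
      unfolding has_vector_derivative_complex_iff by (auto intro!: derivative_eq_intros)
    from has_vector_derivative_mult[OF d this]
    show ?thesis by (simp add: mult_ac)
  qed
  then obtain C where C: "\<And>t. c t * cis (\<omega> * - t) = C"
    using has_vector_derivative_zero_constant[of UNIV "\<lambda>t. c t * cis (\<omega> * - t)"] by auto
  have "c t = c t * cis (\<omega> * - t) * cis (\<omega> * t)"
    by (simp add: mult.assoc cis_mult)
  also have "\<dots> = c 0 * cis (\<omega> * t)"
    using C[of t] C[of 0] by simp
  finally show ?thesis by (simp add: c_def)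
qed

text \<open>A full turn restores the phase, and the phase determines the position. Conversely, a
  period of the position is one of the velocity, by uniqueness of derivatives, hence one of the
  phase, so it is at least a full turn.\<close>

lemma least_period_of:
  assumes r: "\<And>t. (r has_real_derivative s t) (at t)"
    and s: "\<And>t. ((\<lambda>t. m * s t) has_real_derivative - \<kappa>' (r t / \<delta>) / \<delta> + \<kappa>' ((l - r t) / \<delta>) / \<delta>) (at t)"
    and en: "\<And>t. energy l \<delta> m (r t) (s t) = E"
  shows "least_period r (period_of l \<delta> m E)"
proof -
  define c where "c = (\<lambda>t. phase_map l \<delta> m E (r t) (s t))"
  have c: "c t = c 0 * cis (\<omega> * t)" for t
    unfolding c_def by (rule phase_map_rotates[OF r s en])
  have "c 0 \<noteq> 0" by (simp add: c_def phase_map_def Let_def)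
  have shift: "c (t + p) = c t * cis (\<omega> * p)" for t p
    unfolding c[of "t + p"] c[of t] by (simp add: distrib_left cis_mult mult.assoc)
  have "r (t + period_of l \<delta> m E) = r t" for t
    by (rule phase_map_inj[OF en en]) (use shift[of t "period_of l \<delta> m E"] \<omega>_period in \<open>simp add: c_def\<close>)
  moreover have "\<exists>t. r (t + p) \<noteq> r t" if p: "0 < p" "p < period_of l \<delta> m E" for p
  proof (rule ccontr)
    assume "\<nexists>t. r (t + p) \<noteq> r t"
    then have eq: "r (t + p) = r t" for t by blast
    have "((\<lambda>t. r (t + p)) has_real_derivative s (0 + p)) (at 0)"
      using r[of p] DERIV_shift[of r "s p" 0 p] by simp
    then have "s p = s 0"
      using DERIV_unique[OF r[of 0], of "s p"] eq by simp
    then have "c (0 + p) = c 0" using eq[of 0] by (simp add: c_def)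
    then have "cis (\<omega> * p) = 1" using shift[of 0 p] \<open>c 0 \<noteq> 0\<close> by simp
    then have "cos (\<omega> * p) = 1" by (simp add: complex_eq_iff)
    then obtain n :: int where n: "\<omega> * p = real_of_int n * 2 * pi"
      unfolding cos_one_2pi_int by blast
    have "0 < \<omega> * p" "\<omega> * p < 2 * pi"
      using p \<omega>_pos mult_strict_left_mono[OF p(2) \<omega>_pos] \<omega>_period by auto
    then have "0 < real_of_int n" "real_of_int n < 1"
      unfolding n by (simp_all add: zero_less_mult_iff mult_less_cancel_right2)
    then show False by simp
  qed
  ultimately show ?thesis
    using period_pos by (simp add: least_period_def)
qed

end

section \<open>Existence of frozen motions and identification of the period\<close>

lemma well_deriv:
  assumes "\<delta> \<noteq> 0"
  shows "(well \<kappa> \<delta> a c has_real_derivative \<kappa>' ((x - a) / \<delta>) / \<delta> - \<kappa>' ((c - x) / \<delta>) / \<delta>) (at x)"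
proof -
  have "((\<lambda>x. \<kappa> ((x - a) / \<delta>)) has_real_derivative \<kappa>' ((x - a) / \<delta>) * (1 / \<delta>)) (at x)"
    by (rule DERIV_chain2[OF \<kappa>_deriv]) (use assms in \<open>auto intro!: derivative_eq_intros\<close>)
  moreover have "((\<lambda>x. \<kappa> ((c - x) / \<delta>)) has_real_derivative \<kappa>' ((c - x) / \<delta>) * (- 1 / \<delta>)) (at x)"
    by (rule DERIV_chain2[OF \<kappa>_deriv]) (use assms in \<open>auto intro!: derivative_eq_intros\<close>)
  ultimately have "((\<lambda>x. \<kappa> ((x - a) / \<delta>) + \<kappa> ((c - x) / \<delta>)) has_real_derivative
      \<kappa>' ((x - a) / \<delta>) * (1 / \<delta>) + \<kappa>' ((c - x) / \<delta>) * (- 1 / \<delta>)) (at x)"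
    by (rule DERIV_add)
  moreover have "well \<kappa> \<delta> a c = (\<lambda>x. \<kappa> ((x - a) / \<delta>) + \<kappa> ((c - x) / \<delta>))"
    using assms by (auto simp: well_def)
  ultimately show ?thesis by simp
qed

lemma frozen_motion_iff:
  assumes "\<delta> \<noteq> 0"
  shows "frozen_motion \<kappa> \<delta> a c m q v \<longleftrightarrow> (\<forall>t. (q has_real_derivative v t) (at t) \<and>
    ((\<lambda>s. m * v s) has_real_derivative - \<kappa>' ((q t - a) / \<delta>) / \<delta> + \<kappa>' ((c - q t) / \<delta>) / \<delta>) (at t))"
  unfolding frozen_motion_def DERIV_imp_deriv[OF well_deriv[OF assms]] by simp

text \<open>
  Linear continuation of the potential beyond the wall makes the force globally Lipschitz; energy
  conservation keeps the motion where nothing was changed.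
\<close>

lemma extended_core:
  obtains \<kappa>e l B where "\<And>x. (\<kappa>e has_real_derivative \<kappa>' (max x 0)) (at x)"
    "\<And>x. 0 \<le> x \<Longrightarrow> \<kappa>e x = \<kappa> x" "\<And>x. x < 0 \<Longrightarrow> \<kappa> 0 \<le> \<kappa>e x" "\<And>x. 0 \<le> \<kappa>e x"
    "\<And>x y. \<bar>\<kappa>' (max x 0) - \<kappa>' (max y 0)\<bar> \<le> l * \<bar>x - y\<bar>" "\<And>x. \<bar>\<kappa>' (max x 0)\<bar> \<le> B"
proof -
  have cont: "continuous_on UNIV (\<lambda>x. \<kappa>' (max x 0))"
    by (rule continuous_on_compose2[OF \<kappa>'_cont[of UNIV]]) (auto intro!: continuous_intros)
  obtain G where G: "\<And>x. (G has_real_derivative \<kappa>' (max x 0)) (at x)"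
    using real_antiderivative[OF cont] by blast
  define \<kappa>e where "\<kappa>e = (\<lambda>x. G x - G 0 + \<kappa> 0)"
  have d: "(\<kappa>e has_real_derivative \<kappa>' (max x 0)) (at x)" for x
    unfolding \<kappa>e_def by (auto intro!: derivative_eq_intros G)
  have eq: "\<kappa>e x = \<kappa> x" if "0 \<le> x" for x
  proof (cases "x = 0")
    case False
    have dd: "((\<lambda>x. \<kappa>e x - \<kappa> x) has_real_derivative \<kappa>' (max z 0) - \<kappa>' z) (at z)" for z
      by (rule DERIV_diff[OF d \<kappa>_deriv])
    have "\<kappa>e x - \<kappa> x = \<kappa>e 0 - \<kappa> 0"
    proof (rule DERIV_isconst2[of 0 x])
      show "continuous_on {0..x} (\<lambda>x. \<kappa>e x - \<kappa> x)"
        by (rule DERIV_continuous_on[OF has_field_derivative_at_within[OF dd]])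
      show "((\<lambda>x. \<kappa>e x - \<kappa> x) has_real_derivative 0) (at z)" if "0 < z" for z
        using dd[of z] that by (simp add: max_def)
    qed (use False that in auto)
    then show ?thesis by (simp add: \<kappa>e_def)
  qed (simp add: \<kappa>e_def)
  have neg: "\<kappa> 0 \<le> \<kappa>e x" if "x < 0" for x
  proof -
    have "\<kappa>e 0 \<le> \<kappa>e x"
    proof (rule DERIV_nonpos_imp_nonincreasing[of x 0])
      show "\<exists>D. (\<kappa>e has_real_derivative D) (at z) \<and> D \<le> 0" for z
        using d[of z] \<kappa>'_nonpos[of "max z 0"] by blast
    qed (use that in simp)
    then show ?thesis by (simp add: \<kappa>e_def)
  qed
  have pos: "0 \<le> \<kappa>e x" for x
    using eq[of x] neg[of x] \<kappa>_nonneg[of x] \<kappa>_nonneg[of 0] by (cases "x < 0") auto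
  have "bounded (\<kappa>'' ` {0..1})" "bounded (\<kappa>' ` {0..1})"
    by (intro compact_imp_bounded compact_continuous_image continuous_on_subset[OF \<kappa>''_cont] \<kappa>'_cont; simp)+
  then obtain l B where l: "\<forall>y\<in>\<kappa>'' ` {0..1}. norm y \<le> l" and B: "\<forall>y\<in>\<kappa>' ` {0..1}. norm y \<le> B"
    unfolding bounded_iff by meson
  have "0 \<le> l" using l by force
  have clamp: "\<kappa>' (max x 0) = \<kappa>' (min 1 (max x 0))" for x
    using \<kappa>'_zero[of "max x 0"] \<kappa>'_zero[of 1] by (auto simp: min_def)
  show ?thesis
  proof (rule that[of \<kappa>e l B, OF d eq neg pos])
    fix x y :: real
    have "norm (\<kappa>' (min 1 (max x 0)) - \<kappa>' (min 1 (max y 0))) \<le> l * norm (min 1 (max x 0) - min 1 (max y 0))"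
      by (rule field_differentiable_bound[of "{0..1}" _ \<kappa>''])
        (use l \<kappa>'_deriv in \<open>auto intro: has_field_derivative_at_within\<close>)
    also have "\<dots> \<le> l * \<bar>x - y\<bar>"
      using \<open>0 \<le> l\<close> by (intro mult_left_mono) (auto simp: min_def max_def)
    finally show "\<bar>\<kappa>' (max x 0) - \<kappa>' (max y 0)\<bar> \<le> l * \<bar>x - y\<bar>"
      unfolding clamp[symmetric] by simp
    show "\<bar>\<kappa>' (max x 0)\<bar> \<le> B"
      unfolding clamp[of x] using B by auto
  qed auto
qed

text \<open>The definite description in \<open>period\<close> needs a witness. The motion starts at
  rest at the turning point \<open>\<delta> * core_inv E\<close>, where the near potential equals
  \<open>E\<close> and the far wall is out of reach.\<close>

lemma frozen_motion_exists:
  assumes \<delta>: "0 < \<delta>" "4 * \<delta> \<le> c - a" and m: "0 < m" and E: "E \<in> U"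
  obtains q v where "frozen_motion \<kappa> \<delta> a c m q v" "\<And>t. m * (v t)\<^sup>2 / 2 + well \<kappa> \<delta> a c (q t) = E"
proof -
  define l where "l = c - a"
  obtain \<kappa>e lip B where \<kappa>e: "\<And>x. (\<kappa>e has_real_derivative \<kappa>' (max x 0)) (at x)"
    "\<And>x. 0 \<le> x \<Longrightarrow> \<kappa>e x = \<kappa> x" "\<And>x. x < 0 \<Longrightarrow> \<kappa> 0 \<le> \<kappa>e x" "\<And>x. 0 \<le> \<kappa>e x"
    and lip: "\<And>x y. \<bar>\<kappa>' (max x 0) - \<kappa>' (max y 0)\<bar> \<le> lip * \<bar>x - y\<bar>" and B: "\<And>x. \<bar>\<kappa>' (max x 0)\<bar> \<le> B"
    by (rule extended_core) (erule that; assumption)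
  define F where "F = (\<lambda>x. (\<kappa>' (max ((l - x) / \<delta>) 0) - \<kappa>' (max (x / \<delta>) 0)) / (\<delta> * m))"
  have "\<bar>F x - F y\<bar> \<le> 2 * lip / \<delta> / (\<delta> * m) * \<bar>x - y\<bar>" for x y
  proof -
    have 1: "\<bar>\<kappa>' (max ((l - x) / \<delta>) 0) - \<kappa>' (max ((l - y) / \<delta>) 0)\<bar> \<le> lip / \<delta> * \<bar>x - y\<bar>"
    proof -
      have "(l - x) / \<delta> - (l - y) / \<delta> = (y - x) / \<delta>" by (simp add: diff_divide_distrib)
      then show ?thesis
        using lip[of "(l - x) / \<delta>" "(l - y) / \<delta>"] \<delta> by (simp add: abs_minus_commute[of y x])
    qed
    have 2: "\<bar>\<kappa>' (max (x / \<delta>) 0) - \<kappa>' (max (y / \<delta>) 0)\<bar> \<le> lip / \<delta> * \<bar>x - y\<bar>"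
    proof -
      have "x / \<delta> - y / \<delta> = (x - y) / \<delta>" by (simp add: diff_divide_distrib)
      then show ?thesis
        using lip[of "x / \<delta>" "y / \<delta>"] \<delta> by simp
    qed
    have "\<bar>(\<kappa>' (max ((l - x) / \<delta>) 0) - \<kappa>' (max (x / \<delta>) 0)) - (\<kappa>' (max ((l - y) / \<delta>) 0) - \<kappa>' (max (y / \<delta>) 0))\<bar>
      \<le> 2 * (lip / \<delta> * \<bar>x - y\<bar>)"
      using 1 2 by (simp only: abs_le_iff) linarith
    then have "\<bar>(\<kappa>' (max ((l - x) / \<delta>) 0) - \<kappa>' (max (x / \<delta>) 0)) - (\<kappa>' (max ((l - y) / \<delta>) 0) - \<kappa>' (max (y / \<delta>) 0))\<bar> / (\<delta> * m)
      \<le> 2 * (lip / \<delta> * \<bar>x - y\<bar>) / (\<delta> * m)"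
      using \<delta> m by (intro divide_right_mono) auto
    moreover have "\<bar>F x - F y\<bar> = \<bar>(\<kappa>' (max ((l - x) / \<delta>) 0) - \<kappa>' (max (x / \<delta>) 0)) - (\<kappa>' (max ((l - y) / \<delta>) 0) - \<kappa>' (max (y / \<delta>) 0))\<bar> / (\<delta> * m)"
      using \<delta> m by (simp add: F_def abs_divide abs_mult flip: diff_divide_distrib)
    ultimately show ?thesis by simp
  qed
  note F_lip = this
  have F_bound: "\<bar>F x\<bar> \<le> 2 * B / (\<delta> * m)" for x
    using B[of "(l - x) / \<delta>"] B[of "x / \<delta>"] \<delta> m
    by (auto simp: F_def abs_divide abs_mult intro!: divide_right_mono)
  obtain q v where q: "\<And>t. (q has_real_derivative v t) (at t)"
    and v: "\<And>t. (v has_real_derivative F (q t)) (at t)" and init: "q 0 = \<delta> * core_inv E" "v 0 = 0"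
    by (rule newton_solution_exists[OF F_lip F_bound, of "\<delta> * core_inv E"]) (erule that; assumption)
  have y: "0 < core_inv E" "core_inv E < 1" "\<kappa> (core_inv E) = E"
    using core_inv[of E] E k by auto
  define H where "H = (\<lambda>t. m * (v t)\<^sup>2 / 2 + \<kappa>e (q t / \<delta>) + \<kappa>e ((l - q t) / \<delta>))"
  have "(H has_real_derivative 0) (at t)" for t
  proof -
    have 1: "((\<lambda>t. m * (v t)\<^sup>2 / 2) has_real_derivative m * (2 * v t * F (q t)) / 2) (at t)"
      by (auto intro!: derivative_eq_intros v)
    have 2: "((\<lambda>t. \<kappa>e (q t / \<delta>)) has_real_derivative \<kappa>' (max (q t / \<delta>) 0) * (v t / \<delta>)) (at t)"
      by (rule DERIV_chain2[OF \<kappa>e(1) DERIV_cdivide[OF q]])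
    have 3: "((\<lambda>t. \<kappa>e ((l - q t) / \<delta>)) has_real_derivative \<kappa>' (max ((l - q t) / \<delta>) 0) * ((0 - v t) / \<delta>)) (at t)"
      by (rule DERIV_chain2[OF \<kappa>e(1) DERIV_cdivide[OF DERIV_diff[OF DERIV_const q]]])
    have "m * (2 * v t * F (q t)) / 2 + \<kappa>' (max (q t / \<delta>) 0) * (v t / \<delta>) + \<kappa>' (max ((l - q t) / \<delta>) 0) * ((0 - v t) / \<delta>) = 0"
      using \<delta> m by (simp add: F_def field_simps)
    then show ?thesis
      using DERIV_add[OF DERIV_add[OF 1 2] 3] by (simp add: H_def)
  qed
  then have "H t = H 0" for t
    by (rule DERIV_isconst_all[rule_format, of H]) 
  moreover have "H 0 = E"
  proof -
    have "\<delta> * core_inv E < \<delta>" using y \<delta> by simp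
    then have "\<delta> \<le> l - \<delta> * core_inv E" using \<delta> unfolding l_def by linarith
    then have "1 \<le> (l - \<delta> * core_inv E) / \<delta>" using \<delta> by (simp add: pos_le_divide_eq)
    then show ?thesis
      using \<kappa>e(2)[of "(l - \<delta> * core_inv E) / \<delta>"] \<kappa>e(2)[of "core_inv E"] y \<delta> \<kappa>_zero
      by (simp add: H_def init)
  qed
  ultimately have H: "H t = E" for t by simp
  \<comment> \<open>Beyond a wall the extended potential is at least \<open>\<kappa> 0\<close>, more
    than the conserved energy, so the extension is never felt.\<close>
  have in_box: "0 \<le> q t / \<delta>" "0 \<le> (l - q t) / \<delta>" for t
  proof -
    have "0 \<le> m * (v t)\<^sup>2 / 2" using m by simp
    then have "\<kappa>e (q t / \<delta>) < \<kappa> 0" "\<kappa>e ((l - q t) / \<delta>) < \<kappa> 0"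
      using H[of t] \<kappa>e(4)[of "q t / \<delta>"] \<kappa>e(4)[of "(l - q t) / \<delta>"] E k
      unfolding H_def greaterThanLessThan_iff by linarith+
    then show "0 \<le> q t / \<delta>" "0 \<le> (l - q t) / \<delta>"
      using \<kappa>e(3)[of "q t / \<delta>"] \<kappa>e(3)[of "(l - q t) / \<delta>"] by argo+
  qed
  show ?thesis
  proof (rule that[of "\<lambda>t. q t + a" v])
    show "frozen_motion \<kappa> \<delta> a c m (\<lambda>t. q t + a) v"
    proof -
      have e: "c - (q t + a) = l - q t" for t by (simp add: l_def)
      have mF: "m * F (q t) = - \<kappa>' (q t / \<delta>) / \<delta> + \<kappa>' ((l - q t) / \<delta>) / \<delta>" for t
        using in_box[of t] \<delta> m by (simp add: F_def max_absorb1 right_diff_distrib diff_divide_distrib)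
      have "((\<lambda>t. q t + a) has_real_derivative v t) (at t)" for t
        by (auto intro!: derivative_eq_intros q)
      moreover have "((\<lambda>s. m * v s) has_real_derivative m * F (q t)) (at t)" for t
        by (rule DERIV_cmult[OF v])
      ultimately show ?thesis
        using \<delta> by (simp add: frozen_motion_iff e mF)
    qed
    show "m * (v t)\<^sup>2 / 2 + well \<kappa> \<delta> a c (q t + a) = E" for t
    proof -
      have e: "c - (q t + a) = l - q t" by (simp add: l_def)
      show ?thesis
        using H[of t] \<kappa>e(2)[OF in_box(1)[of t]] \<kappa>e(2)[OF in_box(2)[of t]] \<delta>
        by (simp add: H_def well_def e)
    qed
  qed
qed

text \<open>A motion of this energy exists, all of them have the least period
  \<open>period_of\<close>, and a function has at most one least period; so the definite description
  is proper.\<close>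

lemma period_eq:
  assumes \<delta>: "0 < \<delta>" "4 * \<delta> \<le> c - a" and m: "0 < m" and E: "E \<in> U"
  shows "period \<kappa> \<delta> a c m E = period_of (c - a) \<delta> m E"
proof -
  have least: "least_period q (period_of (c - a) \<delta> m E)"
    if q: "frozen_motion \<kappa> \<delta> a c m q v" and en: "\<And>t. m * (v t)\<^sup>2 / 2 + well \<kappa> \<delta> a c (q t) = E" for q v
  proof -
    have e: "c - a - (q t - a) = c - q t" for t by simp
    have "least_period (\<lambda>t. q t - a) (period_of (c - a) \<delta> m E)"
    proof (rule least_period_of[OF \<delta> m E, where s = v])
      show "((\<lambda>t. q t - a) has_real_derivative v t) (at t)" for t
        using q \<delta> by (auto simp: frozen_motion_iff intro!: derivative_eq_intros)
      show "((\<lambda>t. m * v t) has_real_derivative - \<kappa>' ((q t - a) / \<delta>) / \<delta> + \<kappa>' ((c - a - (q t - a)) / \<delta>) / \<delta>) (at t)" for t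
        using q \<delta> unfolding e by (simp add: frozen_motion_iff)
      show "energy (c - a) \<delta> m (q t - a) (v t) = E" for t
        using en[of t] \<delta> by (simp add: energy_def e well_def)
    qed
    then show ?thesis by (simp add: least_period_def)
  qed
  have unique: "p = p'" if "least_period q p" "least_period q p'" for q :: "real \<Rightarrow> real" and p p'
    using that unfolding least_period_def by (metis not_less_iff_gr_or_eq)
  obtain q v where qv: "frozen_motion \<kappa> \<delta> a c m q v" "\<And>t. m * (v t)\<^sup>2 / 2 + well \<kappa> \<delta> a c (q t) = E"
    using frozen_motion_exists[OF assms] by blast
  have "(THE p. \<exists>q v. frozen_motion \<kappa> \<delta> a c m q v \<and> (\<forall>t. m * (v t)\<^sup>2 / 2 + well \<kappa> \<delta> a c (q t) = E) \<and>
      least_period q p) = period_of (c - a) \<delta> m E"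
    by (rule the_equality) (use qv least unique in blast)+
  then show ?thesis using \<delta> by (simp add: period_def)
qed

text \<open>In this form the averaged force is one expression for soft and hard walls: at
  \<open>\<delta> = 0\<close> the effective length is the length of the box, in agreement with the
  separate formula in \<open>period\<close>.\<close>

lemma averaged_force:
  assumes \<delta>: "0 \<le> \<delta>" "4 * \<delta> \<le> c - a" and ab: "a < c" and m: "0 < m" and E: "E \<in> U"
  shows "sqrt (8 * m * E) / period \<kappa> \<delta> a c m E = 2 * E / eff_length (c - a) \<delta> E"
proof -
  have E0: "0 < E" using E k by simp
  have per: "period \<kappa> \<delta> a c m E = 2 * sqrt (m / 2) * eff_length (c - a) \<delta> E / sqrt E"
  proof (cases "\<delta> = 0")
    case True
    have "sqrt (2 * m / E) = sqrt (4 * (m / 2)) / sqrt E"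
      by (simp add: real_sqrt_divide)
    then have "sqrt (2 * m / E) = 2 * sqrt (m / 2) / sqrt E"
      unfolding real_sqrt_mult by simp
    with True show ?thesis by (simp add: period_def eff_length_def)
  next
    case False
    then show ?thesis using period_eq[of \<delta> c a m E] assms by (simp add: period_of_def)
  qed
  have root: "sqrt (8 * m * E) = 4 * sqrt (m / 2) * sqrt E"
  proof -
    have "sqrt (8 * m * E) = sqrt (16 * (m / 2) * E)" by simp
    then show ?thesis unfolding real_sqrt_mult by simp
  qed
  have "0 < eff_length (c - a) \<delta> E"
    using eff_length_ge[OF \<delta>(1) E, of "c - a"] \<delta> ab by simp
  moreover have "4 * \<mu> * e / (2 * \<mu> * L / e) = 2 * (e * e) / L" if "0 < \<mu>" "0 < e" "0 < L" for \<mu> e L :: real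
    using that by (simp add: field_simps)
  ultimately show ?thesis
    unfolding per root using m E0 by simp
qed

end

subsection \<open>Regularity of the averaged field\<close>

text \<open>Continuity of the derivative is demanded in every fixed direction, which keeps the
  closure properties elementary; in finite dimension this amounts to continuity in operator norm.
  Derivatives within \<open>S\<close> cover the one-sided derivative in
  \<open>\<delta>\<close>.\<close>

definition C1_on :: "'a::real_normed_vector set \<Rightarrow> ('a \<Rightarrow> 'b::real_normed_vector) \<Rightarrow> bool" where
  "C1_on S F \<longleftrightarrow> (\<exists>D. (\<forall>p\<in>S. (F has_derivative D p) (at p within S)) \<and> (\<forall>v. continuous_on S (\<lambda>p. D p v)))"

lemma C1_on_cong:
  assumes "\<And>p. p \<in> S \<Longrightarrow> F p = G p" "C1_on S F"
  shows "C1_on S G"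
proof -
  obtain D where D: "\<forall>p\<in>S. (F has_derivative D p) (at p within S)" "\<forall>v. continuous_on S (\<lambda>p. D p v)"
    using assms(2) unfolding C1_on_def by blast
  have "(G has_derivative D p) (at p within S)" if "p \<in> S" for p
    by (rule has_derivative_transform[OF that _ D(1)[rule_format, OF that]]) (simp add: assms(1))
  with D(2) show ?thesis unfolding C1_on_def by blast
qed

lemma C1_on_imp_continuous_on: "C1_on S F \<Longrightarrow> continuous_on S F"
  unfolding C1_on_def using has_derivative_continuous_on[of S F] by blast

lemma C1_on_const: "C1_on S (\<lambda>p. c)"
  unfolding C1_on_def by (intro exI[of _ "\<lambda>_ _. 0"]) auto

lemma C1_on_ident: "C1_on S (\<lambda>p. p)"
  unfolding C1_on_def by (intro exI[of _ "\<lambda>_ v. v"]) auto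

lemma C1_on_bounded_linear:
  assumes "bounded_linear h" "C1_on S F"
  shows "C1_on S (\<lambda>p. h (F p))"
proof -
  obtain D where D: "\<forall>p\<in>S. (F has_derivative D p) (at p within S)" "\<forall>v. continuous_on S (\<lambda>p. D p v)"
    using assms(2) unfolding C1_on_def by blast
  then show ?thesis
    unfolding C1_on_def
    by (intro exI[of _ "\<lambda>p v. h (D p v)"])
      (auto intro: bounded_linear.has_derivative[OF assms(1)] bounded_linear.continuous_on[OF assms(1)])
qed

lemma C1_on_add:
  assumes "C1_on S F" "C1_on S G"
  shows "C1_on S (\<lambda>p. F p + G p)"
proof -
  obtain D where D: "\<forall>p\<in>S. (F has_derivative D p) (at p within S)" "\<forall>v. continuous_on S (\<lambda>p. D p v)"
    using assms(1) unfolding C1_on_def by blast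
  obtain D' where D': "\<forall>p\<in>S. (G has_derivative D' p) (at p within S)" "\<forall>v. continuous_on S (\<lambda>p. D' p v)"
    using assms(2) unfolding C1_on_def by blast
  from D D' show ?thesis
    unfolding C1_on_def
    by (intro exI[of _ "\<lambda>p v. D p v + D' p v"]) (auto intro!: has_derivative_add continuous_intros)
qed

lemma C1_on_minus: "C1_on S F \<Longrightarrow> C1_on S (\<lambda>p. - F p)"
  by (rule C1_on_bounded_linear[OF bounded_linear_minus[OF bounded_linear_ident]])

lemma C1_on_diff: "C1_on S F \<Longrightarrow> C1_on S G \<Longrightarrow> C1_on S (\<lambda>p. F p - G p)"
  using C1_on_add[OF _ C1_on_minus, of S F G] by simp

lemma C1_on_sum: "(\<And>i. i \<in> I \<Longrightarrow> C1_on S (F i)) \<Longrightarrow> C1_on S (\<lambda>p. \<Sum>i\<in>I. F i p)"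
  by (induction I rule: infinite_finite_induct) (auto intro: C1_on_const C1_on_add)

lemma C1_on_mult:
  fixes F G :: "'a::real_normed_vector \<Rightarrow> real"
  assumes "C1_on S F" "C1_on S G"
  shows "C1_on S (\<lambda>p. F p * G p)"
proof -
  obtain D where D: "\<forall>p\<in>S. (F has_derivative D p) (at p within S)" "\<forall>v. continuous_on S (\<lambda>p. D p v)"
    using assms(1) unfolding C1_on_def by blast
  obtain D' where D': "\<forall>p\<in>S. (G has_derivative D' p) (at p within S)" "\<forall>v. continuous_on S (\<lambda>p. D' p v)"
    using assms(2) unfolding C1_on_def by blast
  have "continuous_on S F" "continuous_on S G"
    using assms[THEN C1_on_imp_continuous_on] .
  with D D' show ?thesis
    unfolding C1_on_def
    by (intro exI[of _ "\<lambda>p v. F p * D' p v + D p v * G p"])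
      (auto intro!: has_derivative_mult continuous_intros)
qed

lemma C1_on_compose_real:
  fixes F :: "'a::real_normed_vector \<Rightarrow> real" and g g' :: "real \<Rightarrow> real"
  assumes "C1_on S F" "\<And>x. x \<in> T \<Longrightarrow> (g has_real_derivative g' x) (at x)" "continuous_on T g'"
    and T: "\<And>p. p \<in> S \<Longrightarrow> F p \<in> T"
  shows "C1_on S (\<lambda>p. g (F p))"
proof -
  obtain D where D: "\<forall>p\<in>S. (F has_derivative D p) (at p within S)" "\<forall>v. continuous_on S (\<lambda>p. D p v)"
    using assms(1) unfolding C1_on_def by blast
  have "((\<lambda>p. g (F p)) has_derivative (\<lambda>v. g' (F p) * D p v)) (at p within S)" if "p \<in> S" for p
    using has_derivative_compose[OF D(1)[rule_format, OF that] assms(2)[OF T[OF that], unfolded has_field_derivative_def]]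
    by simp
  moreover have "continuous_on S (\<lambda>p. g' (F p) * D p v)" for v
    using D(2) by (intro continuous_intros continuous_on_compose2[OF assms(3) C1_on_imp_continuous_on[OF assms(1)]])
      (use T in auto)
  ultimately show ?thesis
    unfolding C1_on_def by (intro exI[of _ "\<lambda>p v. g' (F p) * D p v"]) blast
qed

lemma C1_on_divide:
  fixes F G :: "'a::real_normed_vector \<Rightarrow> real"
  assumes "C1_on S F" "C1_on S G" "\<And>p. p \<in> S \<Longrightarrow> G p \<noteq> 0"
  shows "C1_on S (\<lambda>p. F p / G p)"
proof -
  have "C1_on S (\<lambda>p. inverse (G p))"
    by (rule C1_on_compose_real[OF assms(2), where T = "- {0}" and g' = "\<lambda>x. - (inverse x)\<^sup>2"])
      (use assms(3) in \<open>auto intro!: derivative_eq_intros continuous_intros simp: power2_eq_square\<close>)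
  from C1_on_mult[OF assms(1) this] show ?thesis
    by (simp add: divide_inverse)
qed

lemma C1_on_Pair:
  assumes "C1_on S F" "C1_on S G"
  shows "C1_on S (\<lambda>p. (F p, G p))"
proof -
  have "C1_on S (\<lambda>p. (F p, 0) + (0, G p))"
    by (intro C1_on_add C1_on_bounded_linear[OF _ assms(1), of "\<lambda>x. (x, 0)"] C1_on_bounded_linear[OF _ assms(2), of "\<lambda>x. (0, x)"])
      (auto intro!: bounded_linear_Pair bounded_linear_zero bounded_linear_ident)
  then show ?thesis by simp
qed

lemma C1_on_vec:
  fixes F :: "'n::finite \<Rightarrow> 'a::real_normed_vector \<Rightarrow> real"
  assumes "\<And>i. C1_on S (F i)"
  shows "C1_on S (\<lambda>p. \<chi> i. F i p)"
proof -
  have "C1_on S (\<lambda>p. \<Sum>i\<in>UNIV. F i p *\<^sub>R axis i (1::real))"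
    by (intro C1_on_sum C1_on_bounded_linear[OF bounded_linear_scaleR_left] assms)
  moreover have "(\<Sum>i\<in>UNIV. F i p *\<^sub>R axis i (1::real)) = (\<chi> i. F i p)" for p
    by (simp add: vec_eq_iff axis_def if_distrib cong: if_cong)
  ultimately show ?thesis by simp
qed

lemmas C1_on_fst = C1_on_bounded_linear[OF bounded_linear_fst]
  and C1_on_snd = C1_on_bounded_linear[OF bounded_linear_snd]
  and C1_on_vec_nth = C1_on_bounded_linear[OF bounded_linear_vec_nth]

text \<open>The domain is finite-dimensional, so continuity of the derivative on each basis vector
  gives continuity as a bounded linear map.\<close>

lemma C1_on_imp_C1_jointly:
  fixes F :: "real \<Rightarrow> 'h::euclidean_space \<Rightarrow> 'h"
  assumes "open U" "V \<subseteq> U" "C1_on ({0..d} \<times> U) (\<lambda>(\<delta>, h). F \<delta> h)"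
  shows "C1_jointly F d V"
proof -
  obtain D where D: "\<forall>p\<in>{0..d} \<times> U. ((\<lambda>(\<delta>, h). F \<delta> h) has_derivative D p) (at p within {0..d} \<times> U)"
    "\<forall>v. continuous_on ({0..d} \<times> U) (\<lambda>p. D p v)"
    using assms(3) unfolding C1_on_def by blast
  have eq: "blinfun_apply (Blinfun (D p)) = D p" if "p \<in> {0..d} \<times> U" for p
    using D(1) that by (intro bounded_linear_Blinfun_apply) (auto dest: has_derivative_bounded_linear)
  have "continuous_on ({0..d} \<times> U) (\<lambda>p. Blinfun (D p))"
  proof (rule continuous_on_blinfun_componentwise)
    show "continuous_on ({0..d} \<times> U) (\<lambda>p. blinfun_apply (Blinfun (D p)) i)" for i
      by (rule continuous_on_eq[OF D(2)[rule_format, of i]]) (simp add: eq)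
  qed
  moreover have "\<forall>p\<in>{0..d} \<times> U. ((\<lambda>(\<delta>, h). F \<delta> h) has_derivative blinfun_apply (Blinfun (D p))) (at p within {0..d} \<times> U)"
  proof
    fix p assume p: "p \<in> {0..d} \<times> U"
    show "((\<lambda>(\<delta>, h). F \<delta> h) has_derivative blinfun_apply (Blinfun (D p))) (at p within {0..d} \<times> U)"
      unfolding eq[OF p] by (rule D(1)[rule_format, OF p])
  qed
  ultimately show ?thesis
    unfolding C1_jointly_def using assms(1,2) by (intro exI[of _ U] exI[of _ "\<lambda>p. Blinfun (D p)"] conjI)
qed

text \<open>The derivative is bounded on the compact set \<open>{0..d} \<times> N\<close>, which
  includes \<open>\<delta> = 0\<close>: this is how regularity up to the hard wall limit yields one
  constant for all \<open>\<delta>\<close>. Convexity of \<open>N\<close> serves the mean value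
  inequality.\<close>

lemma C1_jointly_lipschitz:
  assumes "C1_jointly F d N" "compact N" "convex N"
  obtains L where "0 \<le> L"
    "\<And>\<delta> h h'. 0 \<le> \<delta> \<Longrightarrow> \<delta> \<le> d \<Longrightarrow> h \<in> N \<Longrightarrow> h' \<in> N \<Longrightarrow> norm (F \<delta> h - F \<delta> h') \<le> L * norm (h - h')"
proof -
  obtain U D where "N \<subseteq> U"
    and D: "\<And>p. p \<in> {0..d} \<times> U \<Longrightarrow> ((\<lambda>(\<delta>, h). F \<delta> h) has_derivative blinfun_apply (D p)) (at p within {0..d} \<times> U)"
    and cont: "continuous_on ({0..d} \<times> U) D"
    using assms(1) unfolding C1_jointly_def by blast
  have "bounded (D ` ({0..d} \<times> N))"
    using \<open>N \<subseteq> U\<close> by (intro compact_imp_bounded compact_continuous_image continuous_on_subset[OF cont] compact_Times assms) auto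
  then obtain L where "\<forall>x\<in>D ` ({0..d} \<times> N). norm x \<le> L"
    unfolding bounded_iff by blast
  then have L: "norm (D p) \<le> L" if "p \<in> {0..d} \<times> N" for p
    using that by blast
  show ?thesis
  proof (rule that[of "max L 0"])
    fix \<delta> h h'
    assume \<delta>: "0 \<le> \<delta>" "\<delta> \<le> d" and h: "h \<in> N" "h' \<in> N"
    show "norm (F \<delta> h - F \<delta> h') \<le> max L 0 * norm (h - h')"
    proof (rule differentiable_bound[OF assms(3) _ _ h, where f' = "\<lambda>h v. blinfun_apply (D (\<delta>, h)) (0, v)"])
      fix g assume g: "g \<in> N"
      have "((\<lambda>h. (\<delta>, h)) has_derivative (\<lambda>v. (0, v))) (at g within N)"
        by (auto intro!: derivative_eq_intros)
      moreover have "((\<lambda>(\<delta>, h). F \<delta> h) has_derivative blinfun_apply (D (\<delta>, g))) (at (\<delta>, g) within (\<lambda>h. (\<delta>, h)) ` N)"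
        by (rule has_derivative_subset[OF D]) (use g \<delta> \<open>N \<subseteq> U\<close> in auto)
      ultimately show "((\<lambda>h. F \<delta> h) has_derivative (\<lambda>v. blinfun_apply (D (\<delta>, g)) (0, v))) (at g within N)"
        using has_derivative_in_compose[of "\<lambda>h. (\<delta>, h)"] by fastforce
      show "onorm (\<lambda>v. blinfun_apply (D (\<delta>, g)) (0, v)) \<le> max L 0"
      proof (rule onorm_bound)
        fix v
        have "norm (blinfun_apply (D (\<delta>, g)) (0, v)) \<le> norm (D (\<delta>, g)) * norm (0::real, v)"
          by (rule norm_blinfun)
        also have "norm (0::real, v) = norm v" by (simp add: norm_Pair)
        also have "norm (D (\<delta>, g)) * norm v \<le> max L 0 * norm v"
          using L[of "(\<delta>, g)"] g \<delta> by (intro mult_right_mono) auto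
        finally show "norm (blinfun_apply (D (\<delta>, g)) (0, v)) \<le> max L 0 * norm v" .
      qed simp
    qed
  qed simp
qed

text \<open>With both sides indexed by one sum type every estimate is written once. Mirroring the
  right side leaves only this sign, the direction in which a particle pushes the piston.\<close>

definition side :: "'l + 'r \<Rightarrow> real" where
  "side = case_sum (\<lambda>_. 1) (\<lambda>_. -1)"

definition len :: "real \<Rightarrow> 'l + 'r \<Rightarrow> real" where
  "len Q = case_sum (\<lambda>_. Q) (\<lambda>_. 1 - Q)"

definition slow_tuple :: "real \<Rightarrow> real \<Rightarrow> ('l::finite + 'r::finite \<Rightarrow> real) \<Rightarrow> ('l, 'r) slow" where
  "slow_tuple Q W E = (Q, W, \<chi> j. E (Inl j), \<chi> j. E (Inr j))"

lemma sum_UNIV_sum: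
  fixes g :: "'l::finite + 'r::finite \<Rightarrow> real"
  shows "(\<Sum>i\<in>UNIV. g i) = (\<Sum>j\<in>UNIV. g (Inl j)) + (\<Sum>j\<in>UNIV. g (Inr j))"
  by (subst UNIV_Plus_UNIV[symmetric], subst sum.Plus) auto

context soft_core begin

definition force :: "real \<Rightarrow> real \<Rightarrow> ('l + 'r \<Rightarrow> real) \<Rightarrow> 'l + 'r \<Rightarrow> real" where
  "force \<delta> Q E i = 2 * E i / eff_length (len Q i) \<delta> (E i)"

lemma averaged_field_eq:
  fixes m1 :: "'l::finite \<Rightarrow> real" and m2 :: "'r::finite \<Rightarrow> real"
  assumes "\<And>j. 0 < m1 j" "\<And>j. 0 < m2 j" and "0 < qmin" "qmin \<le> Q" "Q \<le> 1 - qmin" "0 \<le> \<delta>" "4 * \<delta> \<le> qmin"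
    and "\<And>i. E i \<in> U"
  shows "averaged_field \<kappa> m1 m2 \<delta> (slow_tuple Q W E)
    = slow_tuple W (\<Sum>i\<in>UNIV. side i * force \<delta> Q E i) (\<lambda>i. - side i * W * force \<delta> Q E i)"
proof -
  have f1: "sqrt (8 * m1 j * E (Inl j)) / period \<kappa> \<delta> 0 Q (m1 j) (E (Inl j)) = force \<delta> Q E (Inl j)" for j
    using averaged_force[of \<delta> Q 0 "m1 j" "E (Inl j)"] assms by (simp add: force_def len_def)
  have f2: "sqrt (8 * m2 j * E (Inr j)) / period \<kappa> \<delta> Q 1 (m2 j) (E (Inr j)) = force \<delta> Q E (Inr j)" for j
    using averaged_force[of \<delta> 1 Q "m2 j" "E (Inr j)"] assms by (simp add: force_def len_def)
  show ?thesis
    by (simp add: averaged_field_def slow_tuple_def sum_UNIV_sum side_def sum_negf Let_def f1 f2 del: times_divide_eq_right)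
qed

lemma C1_on_force:
  assumes "C1_on S \<delta>" "C1_on S l" "C1_on S E" "\<And>p. p \<in> S \<Longrightarrow> E p \<in> U"
    and "\<And>p. p \<in> S \<Longrightarrow> 0 \<le> \<delta> p \<and> 2 * \<delta> p < l p"
  shows "C1_on S (\<lambda>p. 2 * E p / eff_length (l p) (\<delta> p) (E p))"
proof -
  have "C1_on S (\<lambda>p. (\<lambda>E. sqrt E * exit_time E) (E p))"
  proof (rule C1_on_compose_real[OF assms(3), where T = U and g' = "\<lambda>E. exit_time E / (2 * sqrt E) + sqrt E * exit_time' E"])
    show "((\<lambda>E. sqrt E * exit_time E) has_real_derivative exit_time E / (2 * sqrt E) + sqrt E * exit_time' E) (at E)" if "E \<in> U" for E
      using that k by (auto intro!: derivative_eq_intros exit_time_deriv simp: field_simps)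
    show "continuous_on U (\<lambda>E. exit_time E / (2 * sqrt E) + sqrt E * exit_time' E)"
      by (intro continuous_intros exit_time_cont exit_time'_cont) (use k in auto)
  qed (use assms in auto)
  then have "C1_on S (\<lambda>p. eff_length (l p) (\<delta> p) (E p))"
    unfolding eff_length_def
    by (intro C1_on_add[OF C1_on_diff[OF assms(2) C1_on_mult] C1_on_mult[OF C1_on_mult]] C1_on_const assms(1))
  moreover have "eff_length (l p) (\<delta> p) (E p) \<noteq> 0" if "p \<in> S" for p
    using eff_length_ge[of "\<delta> p" "E p" "l p"] assms(4,5)[OF that] by simp
  ultimately show ?thesis
    by (intro C1_on_divide C1_on_mult C1_on_const assms)
qed

lemma open_coordinatewise: "open {x :: real ^ 'n::finite. \<forall>j. x $ j \<in> U}"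
proof -
  have "{x :: real ^ 'n. \<forall>j. x $ j \<in> U} = (\<Inter>j. (\<lambda>x. x $ j) -` U)" by auto
  then show ?thesis by (simp add: open_INT open_vimage_vec_nth del: greaterThanLessThan_iff)
qed

definition slow_box :: "real \<Rightarrow> ('l::finite, 'r::finite) slow set" where
  "slow_box qmin = {qmin<..<1 - qmin} \<times> UNIV \<times> {x. \<forall>j. x $ j \<in> U} \<times> {x. \<forall>j. x $ j \<in> U}"

lemma open_slow_box: "open (slow_box qmin :: ('l::finite, 'r::finite) slow set)"
  unfolding slow_box_def
  by (intro open_Times open_UNIV open_greaterThanLessThan open_coordinatewise)

text \<open>\<open>averaged_field_eq\<close> replaces the field by a formula in the effective length
  that is valid at \<open>\<delta> = 0\<close> too, so no limit
  \<open>\<delta> \<rightarrow> 0\<close> has to be taken. The effective length is affine in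
  \<open>\<delta>\<close> and in the length, and of class \<open>C^1\<close> in the energy.\<close>

lemma C1_jointly_averaged_field:
  fixes m1 :: "'l::finite \<Rightarrow> real" and m2 :: "'r::finite \<Rightarrow> real"
  assumes "\<And>j. 0 < m1 j" "\<And>j. 0 < m2 j" "0 < qmin" "4 * d \<le> qmin" "V \<subseteq> slow_box qmin"
  shows "C1_jointly (averaged_field \<kappa> m1 m2) d V"
proof (rule C1_on_imp_C1_jointly[OF open_slow_box assms(5)])
  let ?S = "{0..d} \<times> (slow_box qmin :: ('l, 'r) slow set)"
  define \<delta> where "\<delta> = (\<lambda>p :: real \<times> ('l, 'r) slow. fst p)"
  define Q where "Q = (\<lambda>p :: real \<times> ('l, 'r) slow. fst (snd p))"
  define W where "W = (\<lambda>p :: real \<times> ('l, 'r) slow. fst (snd (snd p)))"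
  define E1 where "E1 = (\<lambda>p :: real \<times> ('l, 'r) slow. fst (snd (snd (snd p))))"
  define E2 where "E2 = (\<lambda>p :: real \<times> ('l, 'r) slow. snd (snd (snd (snd p))))"
  define E where "E = (\<lambda>p. case_sum (\<lambda>j. E1 p $ j) (\<lambda>j. E2 p $ j))"
  have C: "C1_on ?S \<delta>" "C1_on ?S Q" "C1_on ?S W" "C1_on ?S (\<lambda>p. E1 p $ j1)" "C1_on ?S (\<lambda>p. E2 p $ j2)" for j1 j2
    unfolding \<delta>_def Q_def W_def E1_def E2_def
    by (intro C1_on_fst C1_on_snd C1_on_vec_nth C1_on_ident)+
  have CE: "C1_on ?S (\<lambda>p. E p i)" for i
    using C by (cases i) (auto simp: E_def)
  have CL: "C1_on ?S (\<lambda>p. len (Q p) i)" for i :: "'l + 'r"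
    by (cases i) (auto simp: len_def intro!: C C1_on_diff C1_on_const)
  have S: "0 \<le> \<delta> p" "4 * \<delta> p \<le> qmin" "qmin < Q p" "Q p < 1 - qmin" "E p i \<in> U" if "p \<in> ?S" for p i
    using that assms(4) by (auto simp: slow_box_def \<delta>_def Q_def E_def E1_def E2_def split: sum.split)
  have CF: "C1_on ?S (\<lambda>p. force (\<delta> p) (Q p) (E p) i)" for i
    unfolding force_def
  proof (rule C1_on_force[OF C(1) CL CE])
    show "0 \<le> \<delta> p \<and> 2 * \<delta> p < len (Q p) i" if "p \<in> ?S" for p
      using S[OF that] assms(3) by (cases i) (auto simp: len_def)
  qed (use S in auto)
  have "C1_on ?S (\<lambda>p. slow_tuple (W p) (\<Sum>i\<in>UNIV. side i * force (\<delta> p) (Q p) (E p) i) (\<lambda>i. - side i * W p * force (\<delta> p) (Q p) (E p) i))"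
    unfolding slow_tuple_def
    by (intro C1_on_Pair C1_on_vec C1_on_sum C1_on_mult C1_on_const C CF)
  then show "C1_on ?S (\<lambda>(\<delta>, h). averaged_field \<kappa> m1 m2 \<delta> h)"
  proof (rule C1_on_cong[rotated])
    fix p assume p: "p \<in> ?S"
    have "(case p of (\<delta>, h) \<Rightarrow> averaged_field \<kappa> m1 m2 \<delta> h) = averaged_field \<kappa> m1 m2 (\<delta> p) (slow_tuple (Q p) (W p) (E p))"
      by (cases p) (simp add: slow_tuple_def \<delta>_def Q_def W_def E_def E1_def E2_def)
    also have "\<dots> = slow_tuple (W p) (\<Sum>i\<in>UNIV. side i * force (\<delta> p) (Q p) (E p) i) (\<lambda>i. - side i * W p * force (\<delta> p) (Q p) (E p) i)"
      by (rule averaged_field_eq[where qmin = qmin]) (use S[OF p] assms in auto)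
    finally show "slow_tuple (W p) (\<Sum>i\<in>UNIV. side i * force (\<delta> p) (Q p) (E p) i) (\<lambda>i. - side i * W p * force (\<delta> p) (Q p) (E p) i)
      = (case p of (\<delta>, h) \<Rightarrow> averaged_field \<kappa> m1 m2 \<delta> h)" ..
  qed
qed

end

subsection \<open>The Lyapunov functional\<close>

lemma norm_slow_tuple:
  "norm (slow_tuple Q W E) \<le> \<bar>Q\<bar> + \<bar>W\<bar> + (\<Sum>i\<in>UNIV. \<bar>E i\<bar>)"
proof -
  have "norm (Q, W, (\<chi> j. E (Inl j)), (\<chi> j. E (Inr j))) \<le> norm Q + (norm W + (norm (\<chi> j. E (Inl j)) + norm (\<chi> j. E (Inr j))))"
    by (intro order_trans[OF norm_Pair_le] add_left_mono order_refl)
  moreover have "norm (\<chi> j. E (Inl j)) \<le> (\<Sum>j\<in>UNIV. \<bar>E (Inl j)\<bar>)" "norm (\<chi> j. E (Inr j)) \<le> (\<Sum>j\<in>UNIV. \<bar>E (Inr j)\<bar>)"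
    using norm_le_l1_cart[of "\<chi> j. E (Inl j)"] norm_le_l1_cart[of "\<chi> j. E (Inr j)"] by simp_all
  ultimately show ?thesis
    by (simp add: slow_tuple_def sum_UNIV_sum)
qed

lemma slow_tuple_diff: "slow_tuple Q W E - slow_tuple Q' W' E' = slow_tuple (Q - Q') (W - W') (\<lambda>i. E i - E' i)"
  by (simp add: slow_tuple_def vec_eq_iff)

lemma slow_tuple_scaleR: "c *\<^sub>R slow_tuple Q W E = slow_tuple (c * Q) (c * W) (\<lambda>i. c * E i)"
  by (simp add: slow_tuple_def vec_eq_iff)

lemma has_vector_derivative_vec:
  assumes "\<And>j. (f j has_real_derivative f' j) (at t within S)"
  shows "((\<lambda>t. \<chi> j. f j t) has_vector_derivative (\<chi> j. f' j)) (at t within S)"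
proof -
  have "((\<lambda>t. \<Sum>j\<in>UNIV. f j t *\<^sub>R axis j (1::real)) has_vector_derivative (\<Sum>j\<in>UNIV. f' j *\<^sub>R axis j 1)) (at t within S)"
    using has_vector_derivative_scaleR[OF assms has_vector_derivative_const]
    by (intro has_vector_derivative_sum) simp
  moreover have "(\<Sum>j\<in>UNIV. g j *\<^sub>R axis j (1::real)) = (\<chi> j. g j)" for g :: "'a \<Rightarrow> real"
    by (simp add: vec_eq_iff axis_def if_distrib cong: if_cong)
  ultimately show ?thesis by simp
qed

lemma has_vector_derivative_slow_tuple:
  assumes "(Q has_real_derivative Q') (at t within S)" "(W has_real_derivative W') (at t within S)"
    and "\<And>i. ((\<lambda>t. E t i) has_real_derivative E' i) (at t within S)"
  shows "((\<lambda>t. slow_tuple (Q t) (W t) (E t)) has_vector_derivative slow_tuple Q' W' E') (at t within S)"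
  unfolding slow_tuple_def
  using assms by (intro has_vector_derivative_Pair has_vector_derivative_vec)
    (auto simp: has_real_derivative_iff_has_vector_derivative)

lemma abs_side [simp]: "\<bar>side i\<bar> = 1"
  by (cases i) (auto simp: side_def)

lemma side_mult_side [simp]: "side i * side i = 1"
  by (cases i) (auto simp: side_def)

lemma abs_sum_le_card:
  assumes "\<And>i. \<bar>g i\<bar> \<le> c"
  shows "\<bar>\<Sum>i\<in>(UNIV :: 'i::finite set). g i\<bar> \<le> real CARD('i) * c"
proof -
  have "\<bar>\<Sum>i\<in>(UNIV :: 'i set). g i\<bar> \<le> (\<Sum>i\<in>(UNIV :: 'i set). c)"
    by (rule order_trans[OF sum_abs sum_mono]) (rule assms)
  then show ?thesis by simp
qed

text \<open>
  The slow variables with the oscillation removed to first order in \<open>\<epsilon>\<close>; \<open>X i\<close> is the corrector of particle \<open>i\<close>.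
\<close>

definition corrected :: "real \<Rightarrow> real \<Rightarrow> real \<Rightarrow> ('l::finite + 'r::finite \<Rightarrow> real) \<Rightarrow> ('l + 'r \<Rightarrow> real) \<Rightarrow> ('l, 'r) slow" where
  "corrected \<epsilon> Q W E X = slow_tuple Q (W + \<epsilon> * (\<Sum>i\<in>UNIV. side i * X i)) (\<lambda>i. E i - \<epsilon> * side i * W * X i)"

lemma corrected_close:
  fixes E :: "'l::finite + 'r::finite \<Rightarrow> real"
  assumes "0 \<le> \<epsilon>" "0 \<le> C" "\<bar>W\<bar> \<le> C" "\<And>i. \<bar>X i\<bar> \<le> C"
  shows "norm (corrected \<epsilon> Q W E X - slow_tuple Q W E) \<le> real CARD('l + 'r) * (C + C\<^sup>2) * \<epsilon>"
proof -
  have "\<bar>\<Sum>i\<in>(UNIV :: ('l + 'r) set). side i * X i\<bar> \<le> real CARD('l + 'r) * C"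
    by (rule abs_sum_le_card) (simp add: abs_mult assms)
  then have 1: "\<bar>\<epsilon> * (\<Sum>i\<in>UNIV. side i * X i)\<bar> \<le> \<epsilon> * (real CARD('l + 'r) * C)"
    unfolding abs_mult using assms(1) by (simp add: mult_left_mono)
  have "\<bar>\<epsilon> * side i * W * X i\<bar> \<le> \<epsilon> * (C * C)" for i
    unfolding abs_mult using assms by (simp add: mult.assoc mult_left_mono mult_mono)
  then have 2: "(\<Sum>i\<in>(UNIV :: ('l + 'r) set). \<bar>\<epsilon> * side i * W * X i\<bar>) \<le> (\<Sum>i\<in>(UNIV :: ('l + 'r) set). \<epsilon> * (C * C))"
    by (intro sum_mono)
  have "corrected \<epsilon> Q W E X - slow_tuple Q W E = slow_tuple 0 (\<epsilon> * (\<Sum>i\<in>UNIV. side i * X i)) (\<lambda>i. - (\<epsilon> * side i * W * X i))"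
    by (simp add: corrected_def slow_tuple_diff)
  then have "norm (corrected \<epsilon> Q W E X - slow_tuple Q W E)
      \<le> \<bar>0\<bar> + \<bar>\<epsilon> * (\<Sum>i\<in>UNIV. side i * X i)\<bar> + (\<Sum>i\<in>(UNIV :: ('l + 'r) set). \<bar>- (\<epsilon> * side i * W * X i)\<bar>)"
    by (simp only: norm_slow_tuple)
  also have "\<dots> \<le> \<epsilon> * (real CARD('l + 'r) * C) + real CARD('l + 'r) * (\<epsilon> * (C * C))"
    using 1 2 by simp
  finally show ?thesis by (simp add: algebra_simps power2_eq_square)
qed

text \<open>Gronwall's inequality in differential form. With \<open>n\<close> the distance, the
  summand \<open>\<epsilon>\<^sup>2\<close> allows \<open>2 * n * (n + \<epsilon>) \<le> 3 *
  (n\<^sup>2 + \<epsilon>\<^sup>2)\<close>, the origin of the factor \<open>3\<close> in the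
  exponent. The weight decays fast enough because \<open>\<Lambda>\<close> grows at rate at least
  \<open>1 + f\<close>.\<close>

lemma weighted_square_deriv:
  fixes g h :: "real \<Rightarrow> 'a::real_inner"
  assumes g: "(g has_vector_derivative g') (at t within S)" and h: "(h has_vector_derivative h') (at t within S)"
    and \<Lambda>: "(\<Lambda> has_real_derivative \<Lambda>') (at t within S)"
    and "0 \<le> \<epsilon>" "0 \<le> K" "0 \<le> f" and \<Lambda>': "1 + f \<le> \<Lambda>'"
    and close: "norm (g' - h') \<le> \<epsilon> * K * (norm (g t - h t) + \<epsilon>) * (1 + f)"
  shows "\<exists>D\<le>0. ((\<lambda>t. exp (- (3 * K * \<epsilon> * \<Lambda> t)) * ((norm (g t - h t))\<^sup>2 + \<epsilon>\<^sup>2)) has_real_derivative D) (at t within S)"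
proof -
  define n where "n = norm (g t - h t)"
  have n: "0 \<le> n" by (simp add: n_def)
  have "((\<lambda>t. g t - h t) has_vector_derivative g' - h') (at t within S)"
    by (rule has_vector_derivative_diff[OF g h])
  from bounded_bilinear.has_vector_derivative[OF bounded_bilinear_inner this this]
  have sq: "((\<lambda>t. (norm (g t - h t))\<^sup>2) has_real_derivative 2 * inner (g t - h t) (g' - h')) (at t within S)"
    by (simp add: power2_norm_eq_inner has_real_derivative_iff_has_vector_derivative inner_commute)
  have e: "((\<lambda>t. exp (- (3 * K * \<epsilon> * \<Lambda> t))) has_real_derivative exp (- (3 * K * \<epsilon> * \<Lambda> t)) * - (3 * K * \<epsilon> * \<Lambda>')) (at t within S)"
    by (auto intro!: derivative_eq_intros \<Lambda>)
  define D where "D = exp (- (3 * K * \<epsilon> * \<Lambda> t)) * - (3 * K * \<epsilon> * \<Lambda>') * (n\<^sup>2 + \<epsilon>\<^sup>2)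
    + (2 * inner (g t - h t) (g' - h') + 0) * exp (- (3 * K * \<epsilon> * \<Lambda> t))"
  have "((\<lambda>t. exp (- (3 * K * \<epsilon> * \<Lambda> t)) * ((norm (g t - h t))\<^sup>2 + \<epsilon>\<^sup>2)) has_real_derivative D) (at t within S)"
    unfolding D_def n_def by (rule DERIV_mult[OF e DERIV_add[OF sq DERIV_const]])
  moreover have "D \<le> 0"
  proof -
    have "2 * inner (g t - h t) (g' - h') \<le> 2 * (n * norm (g' - h'))"
      using norm_cauchy_schwarz[of "g t - h t" "g' - h'"] by (simp add: n_def)
    also have "\<dots> \<le> 2 * (n * (\<epsilon> * K * (n + \<epsilon>) * (1 + f)))"
      using close n by (intro mult_left_mono) (auto simp: n_def)
    also have "\<dots> = K * \<epsilon> * (1 + f) * (2 * (n * (n + \<epsilon>)))"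
      by (simp add: algebra_simps)
    also have "\<dots> \<le> K * \<epsilon> * (1 + f) * (3 * (n\<^sup>2 + \<epsilon>\<^sup>2))"
    proof (rule mult_left_mono)
      have "0 \<le> (n - \<epsilon>)\<^sup>2" by simp
      then have "2 * (n * \<epsilon>) \<le> n\<^sup>2 + \<epsilon>\<^sup>2" by (simp add: power2_diff)
      moreover have "0 \<le> \<epsilon>\<^sup>2" by simp
      ultimately show "2 * (n * (n + \<epsilon>)) \<le> 3 * (n\<^sup>2 + \<epsilon>\<^sup>2)"
        unfolding distrib_left power2_eq_square by linarith
    qed (use assms in auto)
    also have "\<dots> \<le> 3 * K * \<epsilon> * \<Lambda>' * (n\<^sup>2 + \<epsilon>\<^sup>2)"
      using mult_left_mono[OF \<Lambda>', of "3 * K * \<epsilon> * (n\<^sup>2 + \<epsilon>\<^sup>2)"] assms(4,5) by (simp add: mult_ac)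
    finally have "2 * inner (g t - h t) (g' - h') - 3 * K * \<epsilon> * \<Lambda>' * (n\<^sup>2 + \<epsilon>\<^sup>2) \<le> 0" by simp
    then have "exp (- (3 * K * \<epsilon> * \<Lambda> t)) * (2 * inner (g t - h t) (g' - h') - 3 * K * \<epsilon> * \<Lambda>' * (n\<^sup>2 + \<epsilon>\<^sup>2)) \<le> 0"
      by (simp add: mult_le_0_iff)
    then show ?thesis by (simp add: D_def algebra_simps)
  qed
  ultimately show ?thesis by blast
qed

text \<open>
  The functional that controls the distance between the corrected and the averaged motion.  Its exponent involves a
  clock that advances at least as fast as time plus the momentum transferred to the piston.
\<close>

definition lyapunov_rate :: "'i itself \<Rightarrow> real \<Rightarrow> real \<Rightarrow> real" where
  "lyapunov_rate _ C L = real CARD('i) * (2 * C + C\<^sup>2) + L * (1 + real CARD('i) * (C + C\<^sup>2))"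

definition clock :: "real \<Rightarrow> real \<Rightarrow> ('i::finite \<Rightarrow> real) \<Rightarrow> real" where
  "clock C t X = (1 + real CARD('i) * (2 * C + 1)) * t - 2 * (\<Sum>i\<in>UNIV. X i)"

definition lyapunov ::
  "real \<Rightarrow> real \<Rightarrow> real \<Rightarrow> real \<Rightarrow> real \<Rightarrow> real \<Rightarrow> ('l::finite + 'r::finite \<Rightarrow> real) \<Rightarrow> ('l + 'r \<Rightarrow> real) \<Rightarrow> ('l, 'r) slow \<Rightarrow> real"
where
  "lyapunov C L \<epsilon> t Q W E X h = exp (- (3 * lyapunov_rate TYPE('l + 'r) C L * \<epsilon> * clock C t X)) *
     ((norm (corrected \<epsilon> Q W E X - h))\<^sup>2 + \<epsilon>\<^sup>2)"

lemma lyapunov_rate_nonneg: "0 \<le> C \<Longrightarrow> 0 \<le> L \<Longrightarrow> 0 \<le> lyapunov_rate TYPE('i) C L"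
  by (simp add: lyapunov_rate_def)

text \<open>In the corrected variables the actual forces \<open>f\<close> cancel against the
  derivatives of the correctors, so their velocity agrees with the averaged field at the uncorrected
  point up to order \<open>\<epsilon>\<^sup>2 * (1 + f)\<close>. Passing from there to the averaged
  solution costs the Lipschitz constant \<open>L\<close>. These are the two summands of
  \<open>lyapunov_rate\<close>.\<close>

lemma lyapunov_deriv:
  fixes E X :: "real \<Rightarrow> 'l::finite + 'r::finite \<Rightarrow> real" and H :: "('l, 'r) slow \<Rightarrow> ('l, 'r) slow"
  assumes \<epsilon>: "0 < \<epsilon>" "2 * C * \<epsilon> \<le> 1" and C: "0 \<le> C" "0 \<le> L"
    and Q: "(Q has_real_derivative \<epsilon> * W t) (at t within S)"
    and W: "(W has_real_derivative \<epsilon> * (\<Sum>i\<in>UNIV. side i * f i)) (at t within S)"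
    and E: "\<And>i. ((\<lambda>t. E t i) has_real_derivative - (\<epsilon> * side i * W t * f i)) (at t within S)"
    and X: "\<And>i. ((\<lambda>t. X t i) has_real_derivative D i) (at t within S)"
    and D: "\<And>i. \<bar>D i - (F i - f i)\<bar> \<le> C * \<epsilon> * (1 + f i)"
    and f: "\<And>i. 0 \<le> f i" and bounds: "\<And>i. \<bar>X t i\<bar> \<le> C" "\<bar>W t\<bar> \<le> C" "\<And>i. F i \<le> C"
    and h: "(h has_vector_derivative \<epsilon> *\<^sub>R H (h t)) (at t within S)"
    and H: "H (slow_tuple (Q t) (W t) (E t)) = slow_tuple (W t) (\<Sum>i\<in>UNIV. side i * F i) (\<lambda>i. - side i * W t * F i)"
    and lip: "norm (H (slow_tuple (Q t) (W t) (E t)) - H (h t)) \<le> L * norm (slow_tuple (Q t) (W t) (E t) - h t)"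
  shows "\<exists>D\<le>0. ((\<lambda>t. lyapunov C L \<epsilon> t (Q t) (W t) (E t) (X t) (h t)) has_real_derivative D) (at t within S)"
proof -
  define n where "n = real CARD('l + 'r)"
  have "0 < CARD('l + 'r)" by (rule zero_less_card_finite)
  then have n: "1 \<le> n" unfolding n_def by linarith
  define f0 where "f0 = (\<Sum>i\<in>UNIV. f i)"
  have f0: "0 \<le> f0" unfolding f0_def by (intro sum_nonneg f)
  have sum_f: "(\<Sum>i\<in>UNIV. 1 + f i) = n + f0"
    by (simp add: sum.distrib n_def f0_def)
  have nf: "n + f0 \<le> n * (1 + f0)"
    using mult_right_mono[OF n f0] by (simp add: distrib_left)
  define W' where "W' = \<epsilon> * (\<Sum>i\<in>UNIV. side i * f i)"
  have W'_le: "\<bar>W'\<bar> \<le> \<epsilon> * f0"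
  proof -
    have "\<bar>\<Sum>i\<in>UNIV. side i * f i\<bar> \<le> f0"
      unfolding f0_def by (rule order_trans[OF sum_abs]) (simp add: abs_mult f)
    then show ?thesis using \<epsilon> by (simp add: W'_def abs_mult mult_left_mono)
  qed
  define r where "r = (\<lambda>i. D i - (F i - f i))"
  have r: "\<bar>r i\<bar> \<le> C * \<epsilon> * (1 + f i)" for i using D by (simp add: r_def)
  define g where "g = (\<lambda>t. corrected \<epsilon> (Q t) (W t) (E t) (X t))"
  define h0 where "h0 = slow_tuple (Q t) (W t) (E t)"
  define g' where "g' = slow_tuple (\<epsilon> * W t) (W' + \<epsilon> * (\<Sum>i\<in>UNIV. side i * D i))
    (\<lambda>i. - (\<epsilon> * side i * W t * f i) - \<epsilon> * side i * (W' * X t i + W t * D i))"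
  have g: "(g has_vector_derivative g') (at t within S)"
    unfolding g_def g'_def corrected_def
  proof (rule has_vector_derivative_slow_tuple[OF Q])
    show "((\<lambda>t. W t + \<epsilon> * (\<Sum>i\<in>UNIV. side i * X t i)) has_real_derivative W' + \<epsilon> * (\<Sum>i\<in>UNIV. side i * D i)) (at t within S)"
      using W X unfolding W'_def[symmetric] by (intro DERIV_add DERIV_cmult DERIV_sum)
    show "((\<lambda>t. E t i - \<epsilon> * side i * W t * X t i) has_real_derivative
        - (\<epsilon> * side i * W t * f i) - \<epsilon> * side i * (W' * X t i + W t * D i)) (at t within S)" for i
    proof -
      have "((\<lambda>t. W t * X t i) has_real_derivative W' * X t i + D i * W t) (at t within S)"
        using W X[of i] unfolding W'_def[symmetric] by (rule DERIV_mult)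
      from DERIV_diff[OF E[of i] DERIV_cmult[OF this, of "\<epsilon> * side i"]]
      show ?thesis by (simp add: mult_ac)
    qed
  qed
  \<comment> \<open>What survives the cancellation are the errors \<open>r i\<close> of the
    correctors and the products \<open>W' * X t i\<close>, which are of second order because
    \<open>W'\<close> carries a factor \<open>\<epsilon>\<close>.\<close>
  have defect: "norm (g' - \<epsilon> *\<^sub>R H h0) \<le> \<epsilon>\<^sup>2 * (n * (2 * C + C\<^sup>2)) * (1 + f0)"
  proof -
    have sum_r: "(\<Sum>i\<in>UNIV. side i * r i) = (\<Sum>i\<in>UNIV. side i * D i) - (\<Sum>i\<in>UNIV. side i * F i) + (\<Sum>i\<in>UNIV. side i * f i)"
      by (simp add: r_def right_diff_distrib sum_subtractf)
    have "W' + \<epsilon> * (\<Sum>i\<in>UNIV. side i * D i) - \<epsilon> * (\<Sum>i\<in>UNIV. side i * F i) = \<epsilon> * (\<Sum>i\<in>UNIV. side i * r i)"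
      unfolding W'_def sum_r by (simp only: distrib_left right_diff_distrib)
    moreover have "- (\<epsilon> * side i * W t * f i) - \<epsilon> * side i * (W' * X t i + W t * D i) - \<epsilon> * (- side i * W t * F i)
        = - (\<epsilon> * side i * (W' * X t i + W t * r i))" for i
      by (simp add: r_def algebra_simps)
    ultimately have "g' - \<epsilon> *\<^sub>R H h0 = slow_tuple 0 (\<epsilon> * (\<Sum>i\<in>UNIV. side i * r i)) (\<lambda>i. - (\<epsilon> * side i * (W' * X t i + W t * r i)))"
      unfolding g'_def h0_def H slow_tuple_scaleR slow_tuple_diff by simp
    then have "norm (g' - \<epsilon> *\<^sub>R H h0) \<le> \<bar>0\<bar> + \<bar>\<epsilon> * (\<Sum>i\<in>UNIV. side i * r i)\<bar> + (\<Sum>i\<in>UNIV. \<bar>- (\<epsilon> * side i * (W' * X t i + W t * r i))\<bar>)"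
      by (simp only: norm_slow_tuple)
    also have "\<dots> \<le> \<epsilon>\<^sup>2 * C * (n + f0) + \<epsilon>\<^sup>2 * (C * (n * f0) + C\<^sup>2 * (n + f0))"
    proof -
      have "\<bar>\<Sum>i\<in>UNIV. side i * r i\<bar> \<le> (\<Sum>i\<in>UNIV. C * \<epsilon> * (1 + f i))"
        by (rule order_trans[OF sum_abs sum_mono]) (simp add: abs_mult r)
      also have "\<dots> = C * \<epsilon> * (n + f0)"
        by (simp only: sum_f flip: sum_distrib_left)
      finally have 1: "\<bar>\<epsilon> * (\<Sum>i\<in>UNIV. side i * r i)\<bar> \<le> \<epsilon>\<^sup>2 * C * (n + f0)"
        using \<epsilon> mult_left_mono[of "\<bar>\<Sum>i\<in>UNIV. side i * r i\<bar>" "C * \<epsilon> * (n + f0)" \<epsilon>]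
        by (simp add: abs_mult power2_eq_square mult_ac)
      have "\<bar>- (\<epsilon> * side i * (W' * X t i + W t * r i))\<bar> \<le> \<epsilon>\<^sup>2 * (C * f0 + C\<^sup>2 * (1 + f i))" for i
      proof -
        have "\<bar>W' * X t i\<bar> \<le> \<epsilon> * f0 * C"
          unfolding abs_mult using W'_le bounds \<epsilon> f0 by (intro mult_mono) auto
        moreover have "\<bar>W t * r i\<bar> \<le> C * (C * \<epsilon> * (1 + f i))"
          unfolding abs_mult using r bounds C \<epsilon> f[of i] by (intro mult_mono) auto
        ultimately have "\<bar>W' * X t i + W t * r i\<bar> \<le> \<epsilon> * (C * f0 + C\<^sup>2 * (1 + f i))"
          by (simp add: algebra_simps power2_eq_square)
        then have "\<epsilon> * \<bar>W' * X t i + W t * r i\<bar> \<le> \<epsilon> * (\<epsilon> * (C * f0 + C\<^sup>2 * (1 + f i)))"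
          using \<epsilon> by (intro mult_left_mono) auto
        then show ?thesis using \<epsilon> by (simp add: abs_mult power2_eq_square mult.assoc)
      qed
      then have "(\<Sum>i\<in>UNIV. \<bar>- (\<epsilon> * side i * (W' * X t i + W t * r i))\<bar>) \<le> (\<Sum>i\<in>UNIV. \<epsilon>\<^sup>2 * (C * f0 + C\<^sup>2 * (1 + f i)))"
        by (intro sum_mono)
      also have "\<dots> = \<epsilon>\<^sup>2 * (C * (n * f0) + C\<^sup>2 * (n + f0))"
        by (simp only: sum_f sum.distrib flip: sum_distrib_left) (simp add: n_def f0_def)
      finally show ?thesis using 1 by simp
    qed
    also have "\<dots> \<le> \<epsilon>\<^sup>2 * C * (n * (1 + f0)) + \<epsilon>\<^sup>2 * (C * (n * (1 + f0)) + C\<^sup>2 * (n * (1 + f0)))"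
      using nf C n f0 by (intro add_mono mult_left_mono) auto
    also have "\<dots> = \<epsilon>\<^sup>2 * (n * (2 * C + C\<^sup>2)) * (1 + f0)"
      by (simp add: algebra_simps)
    finally show ?thesis .
  qed
  define K where "K = lyapunov_rate TYPE('l + 'r) C L"
  have K: "0 \<le> K" unfolding K_def by (rule lyapunov_rate_nonneg[OF C])
  have close: "norm (g' - \<epsilon> *\<^sub>R H (h t)) \<le> \<epsilon> * K * (norm (g t - h t) + \<epsilon>) * (1 + f0)"
  proof -
    have "norm (g t - h0) \<le> n * (C + C\<^sup>2) * \<epsilon>"
      unfolding g_def h0_def n_def using \<epsilon> by (intro corrected_close C bounds) auto
    then have "norm (h0 - h t) \<le> norm (g t - h t) + n * (C + C\<^sup>2) * \<epsilon>"
      using norm_triangle_ineq4[of "g t - h t" "g t - h0"] by simp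
    then have "L * norm (h0 - h t) \<le> L * (norm (g t - h t) + n * (C + C\<^sup>2) * \<epsilon>)"
      using C(2) by (rule mult_left_mono)
    with lip have "norm (H h0 - H (h t)) \<le> L * (norm (g t - h t) + n * (C + C\<^sup>2) * \<epsilon>)"
      unfolding h0_def[symmetric] by linarith
    also have "\<dots> \<le> L * ((1 + n * (C + C\<^sup>2)) * (norm (g t - h t) + \<epsilon>))"
      using C \<epsilon> n by (intro mult_left_mono) (auto simp: algebra_simps)
    finally have 1: "\<epsilon> * norm (H h0 - H (h t)) \<le> \<epsilon> * (L * ((1 + n * (C + C\<^sup>2)) * (norm (g t - h t) + \<epsilon>)))"
      using \<epsilon> by (intro mult_left_mono) auto
    have "norm (g' - \<epsilon> *\<^sub>R H (h t)) = norm ((g' - \<epsilon> *\<^sub>R H h0) + \<epsilon> *\<^sub>R (H h0 - H (h t)))"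
      by (simp add: algebra_simps)
    also have "\<dots> \<le> norm (g' - \<epsilon> *\<^sub>R H h0) + \<epsilon> * norm (H h0 - H (h t))"
      by (rule order_trans[OF norm_triangle_ineq]) (use \<epsilon> in simp)
    also have "\<dots> \<le> \<epsilon>\<^sup>2 * (n * (2 * C + C\<^sup>2)) * (1 + f0) + \<epsilon> * (L * ((1 + n * (C + C\<^sup>2)) * (norm (g t - h t) + \<epsilon>)))"
      using defect 1 by linarith
    also have "\<dots> \<le> \<epsilon> * (norm (g t - h t) + \<epsilon>) * (n * (2 * C + C\<^sup>2)) * (1 + f0)
        + \<epsilon> * (norm (g t - h t) + \<epsilon>) * (L * (1 + n * (C + C\<^sup>2))) * (1 + f0)"
    proof (rule add_mono)
      have "\<epsilon>\<^sup>2 \<le> \<epsilon> * (norm (g t - h t) + \<epsilon>)" using \<epsilon> by (simp add: power2_eq_square)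
      then show "\<epsilon>\<^sup>2 * (n * (2 * C + C\<^sup>2)) * (1 + f0) \<le> \<epsilon> * (norm (g t - h t) + \<epsilon>) * (n * (2 * C + C\<^sup>2)) * (1 + f0)"
        using C n f0 by (intro mult_right_mono) auto
      have "0 \<le> \<epsilon> * (norm (g t - h t) + \<epsilon>) * (L * (1 + n * (C + C\<^sup>2)))"
        using C n \<epsilon> by (intro mult_nonneg_nonneg add_nonneg_nonneg) auto
      then have "\<epsilon> * (norm (g t - h t) + \<epsilon>) * (L * (1 + n * (C + C\<^sup>2))) * 1 \<le> \<epsilon> * (norm (g t - h t) + \<epsilon>) * (L * (1 + n * (C + C\<^sup>2))) * (1 + f0)"
        using f0 by (intro mult_left_mono) auto
      then show "\<epsilon> * (L * ((1 + n * (C + C\<^sup>2)) * (norm (g t - h t) + \<epsilon>))) \<le> \<epsilon> * (norm (g t - h t) + \<epsilon>) * (L * (1 + n * (C + C\<^sup>2))) * (1 + f0)"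
        by (simp add: mult_ac)
    qed
    also have "\<dots> = \<epsilon> * K * (norm (g t - h t) + \<epsilon>) * (1 + f0)"
      unfolding K_def lyapunov_rate_def n_def by (simp add: algebra_simps)
    finally show ?thesis .
  qed
  have clk: "((\<lambda>t. clock C t (X t)) has_real_derivative (1 + n * (2 * C + 1)) - 2 * (\<Sum>i\<in>UNIV. D i)) (at t within S)"
    unfolding clock_def n_def using X by (auto intro!: derivative_eq_intros)
  \<comment> \<open>\<open>2 * C * \<epsilon> \<le> 1\<close> makes the error of a corrector at most
    \<open>(1 + f i) / 2\<close>. This is why the clock subtracts the correctors twice: of the
    resulting \<open>2 * f i\<close>, one half absorbs the error and the other remains.\<close>
  have clk': "1 + f0 \<le> (1 + n * (2 * C + 1)) - 2 * (\<Sum>i\<in>UNIV. D i)"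
  proof -
    have "2 * D i \<le> 2 * C + 1 - f i" for i
    proof -
      define z where "z = C * \<epsilon> * (1 + f i)"
      have "\<bar>D i - (F i - f i)\<bar> \<le> z"
        using D[of i] by (simp add: z_def)
      moreover have "2 * z \<le> 1 + f i"
        using mult_right_mono[OF \<epsilon>(2), of "1 + f i"] f[of i] by (simp add: z_def mult.assoc)
      ultimately show ?thesis using bounds(3)[of i] by linarith
    qed
    then have "(\<Sum>i\<in>UNIV. 2 * D i) \<le> (\<Sum>i\<in>UNIV. 2 * C + 1 - f i)"
      by (rule sum_mono)
    also have "\<dots> = n * (2 * C + 1) - f0"
      by (simp add: sum_subtractf n_def f0_def)
    finally show ?thesis by (simp flip: sum_distrib_left)
  qed
  show ?thesis
    using weighted_square_deriv[OF g h clk less_imp_le[OF \<epsilon>(1)] K f0 clk' close]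
    unfolding lyapunov_def K_def g_def .
qed

text \<open>The kick in \<open>W\<close> is cancelled by the drop \<open>\<Delta>\<close> of the
  corrector, and the change of energy is cancelled to first order, so the corrected variables jump
  by at most \<open>\<epsilon>\<^sup>2 * \<Delta> * K\<close>, with \<open>K\<close> the rate. The
  squared distance plus \<open>\<epsilon>\<^sup>2\<close> grows at most by the factor
  \<open>exp (2 * \<epsilon> * \<Delta> * K)\<close>, while the clock advances by
  \<open>2 * \<Delta>\<close> and multiplies the weight by
  \<open>exp (- 6 * \<epsilon> * \<Delta> * K)\<close>.\<close>

lemma lyapunov_collision:
  fixes E X :: "'l::finite + 'r::finite \<Rightarrow> real"
  assumes \<epsilon>: "0 < \<epsilon>" and C: "0 \<le> C" "0 \<le> L" and \<Delta>: "0 \<le> \<Delta>" "\<Delta> \<le> C" and X: "\<And>i. \<bar>X i\<bar> \<le> C"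
  shows "lyapunov C L \<epsilon> t Q (W + \<epsilon> * side i * \<Delta>) (E(i := E i - \<epsilon> * side i * \<Delta> * (W + \<epsilon> * side i * \<Delta> / 2))) (X(i := X i - \<Delta>)) h
    \<le> lyapunov C L \<epsilon> t Q W E X h"
proof -
  define n where "n = real CARD('l + 'r)"
  have "0 < CARD('l + 'r)" by (rule zero_less_card_finite)
  then have n: "1 \<le> n" unfolding n_def by linarith
  define K where "K = lyapunov_rate TYPE('l + 'r) C L"
  have "n * (2 * C) \<le> K"
  proof -
    have "n * (2 * C) \<le> n * (2 * C + C\<^sup>2)" using n by (intro mult_left_mono) auto
    moreover have "0 \<le> L * (1 + n * (C + C\<^sup>2))" using C n by (intro mult_nonneg_nonneg add_nonneg_nonneg) auto
    ultimately show ?thesis unfolding K_def lyapunov_rate_def n_def[symmetric] by linarith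
  qed
  moreover have "C \<le> n * C" using mult_right_mono[OF n C(1)] by simp
  ultimately have K: "C + n * C \<le> K" by (simp add: algebra_simps)
  have "0 \<le> K" unfolding K_def by (rule lyapunov_rate_nonneg[OF C])
  define W2 where "W2 = W + \<epsilon> * side i * \<Delta>"
  define E2 where "E2 = E(i := E i - \<epsilon> * side i * \<Delta> * (W + \<epsilon> * side i * \<Delta> / 2))"
  define X2 where "X2 = X(i := X i - \<Delta>)"
  have sum_upd: "(\<Sum>j\<in>UNIV. c j * X2 j) = (\<Sum>j\<in>UNIV. c j * X j) - c i * \<Delta>" for c :: "'l + 'r \<Rightarrow> real"
  proof -
    have "(\<Sum>j\<in>UNIV. c j * X2 j) = (\<Sum>j\<in>UNIV. c j * X j - (if j = i then c i * \<Delta> else 0))"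
      by (rule sum.cong) (auto simp: X2_def right_diff_distrib)
    then show ?thesis by (simp add: sum_subtractf)
  qed
  define e where "e = (\<lambda>j. if j = i then \<epsilon>\<^sup>2 * \<Delta> * (\<Delta> / 2 - X i) else - (\<epsilon>\<^sup>2 * \<Delta> * (side j * side i * X j)))"
  have e: "(E2 j - \<epsilon> * side j * W2 * X2 j) - (E j - \<epsilon> * side j * W * X j) = e j" for j
  proof (cases "j = i")
    case True
    have s: "side i * (side i * z) = z" for z
      using side_mult_side[of i] by (simp flip: mult.assoc)
    show ?thesis
      using True by (simp add: e_def E2_def W2_def X2_def algebra_simps power2_eq_square s)
  qed (simp add: e_def E2_def W2_def X2_def algebra_simps power2_eq_square)
  have "\<bar>e j\<bar> \<le> \<epsilon>\<^sup>2 * \<Delta> * (C + (if j = i then C else 0))" for j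
  proof (cases "j = i")
    case True
    have "\<bar>\<Delta> / 2 - X i\<bar> \<le> C + C" using X[of i] \<Delta> by linarith
    then show ?thesis using True \<Delta> by (simp add: e_def abs_mult mult_left_mono)
  next
    case False
    then show ?thesis using X[of j] \<Delta> by (simp add: e_def abs_mult mult_left_mono)
  qed
  then have "(\<Sum>j\<in>UNIV. \<bar>e j\<bar>) \<le> (\<Sum>j\<in>UNIV. \<epsilon>\<^sup>2 * \<Delta> * (C + (if j = i then C else 0)))"
    by (rule sum_mono)
  also have "\<dots> = \<epsilon>\<^sup>2 * \<Delta> * (C + n * C)"
    by (simp add: sum.distrib n_def flip: sum_distrib_left)
  also have "\<dots> \<le> \<epsilon>\<^sup>2 * \<Delta> * K"
    using K \<Delta> by (intro mult_left_mono) auto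
  finally have sum_e: "(\<Sum>j\<in>UNIV. \<bar>e j\<bar>) \<le> \<epsilon>\<^sup>2 * \<Delta> * K" .
  have "corrected \<epsilon> Q W2 E2 X2 - corrected \<epsilon> Q W E X = slow_tuple 0 0 e"
    unfolding corrected_def slow_tuple_diff e sum_upd by (simp add: W2_def algebra_simps)
  then have jump: "norm (corrected \<epsilon> Q W2 E2 X2 - corrected \<epsilon> Q W E X) \<le> \<epsilon>\<^sup>2 * \<Delta> * K"
    using norm_slow_tuple[of 0 0 e] sum_e by simp
  define a where "a = norm (corrected \<epsilon> Q W E X - h)"
  define x where "x = \<epsilon> * \<Delta> * K"
  have x: "0 \<le> x" using \<epsilon> \<Delta> \<open>0 \<le> K\<close> by (simp add: x_def)
  have "norm (corrected \<epsilon> Q W2 E2 X2 - h) \<le> a + \<epsilon> * x"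
    using jump norm_triangle_ineq[of "corrected \<epsilon> Q W2 E2 X2 - corrected \<epsilon> Q W E X" "corrected \<epsilon> Q W E X - h"]
    by (simp add: a_def x_def power2_eq_square mult_ac)
  then have "(norm (corrected \<epsilon> Q W2 E2 X2 - h))\<^sup>2 + \<epsilon>\<^sup>2 \<le> (a + \<epsilon> * x)\<^sup>2 + \<epsilon>\<^sup>2"
    by (simp add: power_mono)
  also have "\<dots> \<le> (a\<^sup>2 + \<epsilon>\<^sup>2) * (1 + 2 * x + 2 * x\<^sup>2)"
  proof -
    have "0 \<le> (a - \<epsilon>)\<^sup>2" by simp
    then have "2 * (a * \<epsilon>) \<le> a\<^sup>2 + \<epsilon>\<^sup>2" by (simp add: power2_diff)
    then have "2 * (a * \<epsilon>) * x \<le> (a\<^sup>2 + \<epsilon>\<^sup>2) * x" using x by (rule mult_right_mono)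
    moreover have "0 \<le> (a\<^sup>2 + \<epsilon>\<^sup>2) * x" "0 \<le> a\<^sup>2 * x\<^sup>2" "0 \<le> \<epsilon>\<^sup>2 * x\<^sup>2"
      using x by auto
    moreover have "(a + \<epsilon> * x)\<^sup>2 + \<epsilon>\<^sup>2 = a\<^sup>2 + \<epsilon>\<^sup>2 + 2 * (a * \<epsilon>) * x + \<epsilon>\<^sup>2 * x\<^sup>2"
      by (simp add: power2_sum power_mult_distrib)
    moreover have "(a\<^sup>2 + \<epsilon>\<^sup>2) * (1 + 2 * x + 2 * x\<^sup>2)
        = a\<^sup>2 + \<epsilon>\<^sup>2 + 2 * ((a\<^sup>2 + \<epsilon>\<^sup>2) * x) + 2 * (a\<^sup>2 * x\<^sup>2) + 2 * (\<epsilon>\<^sup>2 * x\<^sup>2)"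
      by (simp add: algebra_simps)
    ultimately show ?thesis by linarith
  qed
  also have "\<dots> \<le> (a\<^sup>2 + \<epsilon>\<^sup>2) * exp (2 * x)"
    using exp_lower_Taylor_quadratic[of "2 * x"] x by (intro mult_left_mono) (auto simp: power_mult_distrib)
  finally have main: "(norm (corrected \<epsilon> Q W2 E2 X2 - h))\<^sup>2 + \<epsilon>\<^sup>2 \<le> (a\<^sup>2 + \<epsilon>\<^sup>2) * exp (2 * x)" .
  have clk: "clock C t X2 = clock C t X + 2 * \<Delta>"
    using sum_upd[of "\<lambda>_. 1"] by (simp add: clock_def)
  have "lyapunov C L \<epsilon> t Q W2 E2 X2 h \<le> exp (- (3 * K * \<epsilon> * clock C t X2)) * ((a\<^sup>2 + \<epsilon>\<^sup>2) * exp (2 * x))"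
    unfolding lyapunov_def K_def[symmetric] using main by (intro mult_left_mono) auto
  also have "\<dots> = exp (2 * x - 3 * K * \<epsilon> * clock C t X2) * (a\<^sup>2 + \<epsilon>\<^sup>2)"
    by (simp add: exp_diff exp_minus field_simps)
  also have "\<dots> \<le> exp (- (3 * K * \<epsilon> * clock C t X)) * (a\<^sup>2 + \<epsilon>\<^sup>2)"
    using x by (intro mult_right_mono) (auto simp: clk x_def algebra_simps)
  also have "\<dots> = lyapunov C L \<epsilon> t Q W E X h"
    by (simp add: lyapunov_def K_def a_def)
  finally show ?thesis
    unfolding W2_def E2_def X2_def .
qed

text \<open>The clock differs from a multiple of time by bounded correctors, so as long as
  \<open>\<epsilon> * t \<le> T\<close> undoing the exponential weight costs a bounded factor.
  Initially the averaged motion starts at the uncorrected variables, at distance of order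
  \<open>\<epsilon>\<close> from the corrected ones; at the end the correction is removed at the
  same cost.\<close>

lemma lyapunov_imp_close:
  fixes E0 X0 E X :: "'l::finite + 'r::finite \<Rightarrow> real"
  assumes le: "lyapunov C L \<epsilon> t Q W E X h \<le> lyapunov C L \<epsilon> 0 Q0 W0 E0 X0 (slow_tuple Q0 W0 E0)"
    and \<epsilon>: "0 < \<epsilon>" "\<epsilon> \<le> 1" and C: "0 \<le> C" "0 \<le> L" and t: "\<epsilon> * t \<le> T"
    and bounds: "\<bar>W0\<bar> \<le> C" "\<bar>W\<bar> \<le> C" "\<And>i. \<bar>X0 i\<bar> \<le> C" "\<And>i. \<bar>X i\<bar> \<le> C"
    and n: "n = real CARD('l + 'r)"
  shows "norm (slow_tuple Q W E - h)
    \<le> (sqrt (exp (3 * lyapunov_rate TYPE('l + 'r) C L * ((1 + n * (2 * C + 1)) * T + 4 * n * C)) * ((n * (C + C\<^sup>2))\<^sup>2 + 1)) + n * (C + C\<^sup>2)) * \<epsilon>"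
proof -
  define K where "K = lyapunov_rate TYPE('l + 'r) C L"
  have "0 \<le> K" unfolding K_def by (rule lyapunov_rate_nonneg[OF C])
  have n0: "0 \<le> n" by (simp add: n)
  define a where "a = norm (corrected \<epsilon> Q W E X - h)"
  define a0 where "a0 = norm (corrected \<epsilon> Q0 W0 E0 X0 - slow_tuple Q0 W0 E0)"
  define B where "B = exp (3 * K * ((1 + n * (2 * C + 1)) * T + 4 * n * C)) * ((n * (C + C\<^sup>2))\<^sup>2 + 1)"
  have a0: "a0 \<le> n * (C + C\<^sup>2) * \<epsilon>"
    unfolding a0_def n using \<epsilon> by (intro corrected_close C bounds) auto
  have sumX: "\<bar>\<Sum>i\<in>UNIV. X0 i\<bar> \<le> n * C" "\<bar>\<Sum>i\<in>UNIV. X i\<bar> \<le> n * C"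
    unfolding n by (rule abs_sum_le_card[OF bounds(3)] abs_sum_le_card[OF bounds(4)])+
  have "\<epsilon> * (clock C t X - clock C 0 X0) \<le> (1 + n * (2 * C + 1)) * T + 4 * n * C"
  proof -
    have "clock C t X - clock C 0 X0 \<le> (1 + n * (2 * C + 1)) * t + 4 * (n * C)"
      using sumX unfolding clock_def n[symmetric] by linarith
    then have "\<epsilon> * (clock C t X - clock C 0 X0) \<le> \<epsilon> * ((1 + n * (2 * C + 1)) * t + 4 * (n * C))"
      using \<epsilon> by (intro mult_left_mono) auto
    also have "\<dots> = (1 + n * (2 * C + 1)) * (\<epsilon> * t) + \<epsilon> * (4 * (n * C))"
      by (simp add: algebra_simps)
    also have "\<dots> \<le> (1 + n * (2 * C + 1)) * T + 1 * (4 * (n * C))"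
      using t \<epsilon> C n0 by (intro add_mono mult_left_mono mult_right_mono) auto
    finally show ?thesis by simp
  qed
  then have "3 * K * (\<epsilon> * (clock C t X - clock C 0 X0)) \<le> 3 * K * ((1 + n * (2 * C + 1)) * T + 4 * n * C)"
    using \<open>0 \<le> K\<close> by (intro mult_left_mono) auto
  then have ex: "exp (3 * K * \<epsilon> * clock C t X - 3 * K * \<epsilon> * clock C 0 X0) \<le> exp (3 * K * ((1 + n * (2 * C + 1)) * T + 4 * n * C))"
    by (simp add: right_diff_distrib mult.assoc)
  have le': "exp (- (3 * K * \<epsilon> * clock C t X)) * (a\<^sup>2 + \<epsilon>\<^sup>2) \<le> exp (- (3 * K * \<epsilon> * clock C 0 X0)) * (a0\<^sup>2 + \<epsilon>\<^sup>2)"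
    using le by (simp add: lyapunov_def K_def a_def a0_def)
  have "a\<^sup>2 + \<epsilon>\<^sup>2 = exp (3 * K * \<epsilon> * clock C t X) * (exp (- (3 * K * \<epsilon> * clock C t X)) * (a\<^sup>2 + \<epsilon>\<^sup>2))"
    by (simp add: exp_minus)
  also have "\<dots> \<le> exp (3 * K * \<epsilon> * clock C t X) * (exp (- (3 * K * \<epsilon> * clock C 0 X0)) * (a0\<^sup>2 + \<epsilon>\<^sup>2))"
    using le' by (rule mult_left_mono) simp
  also have "\<dots> = exp (3 * K * \<epsilon> * clock C t X - 3 * K * \<epsilon> * clock C 0 X0) * (a0\<^sup>2 + \<epsilon>\<^sup>2)"
    by (simp add: exp_diff exp_minus field_simps)
  also have "\<dots> \<le> exp (3 * K * ((1 + n * (2 * C + 1)) * T + 4 * n * C)) * ((n * (C + C\<^sup>2) * \<epsilon>)\<^sup>2 + \<epsilon>\<^sup>2)"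
    using a0 ex by (intro mult_mono add_right_mono power_mono) (auto simp: a0_def)
  also have "\<dots> = B * \<epsilon>\<^sup>2"
  proof -
    have "(c * \<epsilon>)\<^sup>2 + \<epsilon>\<^sup>2 = (c\<^sup>2 + 1) * \<epsilon>\<^sup>2" for c
      by (simp add: power_mult_distrib distrib_right)
    from this[of "n * (C + C\<^sup>2)"] show ?thesis
      unfolding B_def by (simp only: mult.assoc[of "exp _"])
  qed
  finally have "a\<^sup>2 \<le> B * \<epsilon>\<^sup>2"
    using zero_le_power2[of \<epsilon>] by linarith
  then have "a \<le> sqrt (B * \<epsilon>\<^sup>2)"
    by (rule real_le_rsqrt)
  also have "\<dots> = sqrt B * \<epsilon>"
    using \<epsilon> by (simp add: real_sqrt_mult)
  finally have "a \<le> sqrt B * \<epsilon>" .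
  moreover have "norm (corrected \<epsilon> Q W E X - slow_tuple Q W E) \<le> n * (C + C\<^sup>2) * \<epsilon>"
    unfolding n using \<epsilon> by (intro corrected_close C bounds) auto
  moreover have "norm (slow_tuple Q W E - h) \<le> a + norm (corrected \<epsilon> Q W E X - slow_tuple Q W E)"
    using norm_triangle_ineq4[of "corrected \<epsilon> Q W E X - h" "corrected \<epsilon> Q W E X - slow_tuple Q W E"]
    by (simp add: a_def)
  ultimately show ?thesis
    unfolding B_def K_def by (simp add: distrib_right)
qed

subsection \<open>Soft core dynamics\<close>

text \<open>Positions and velocities are measured from the fixed wall of the particle towards the piston.\<close>

definition gas_pos :: "('l, 'r) phase \<Rightarrow> 'l + 'r \<Rightarrow> real" where
  "gas_pos z = case_sum (pos1 z) (\<lambda>j. 1 - pos2 z j)"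

definition gas_vel :: "('l, 'r) phase \<Rightarrow> 'l + 'r \<Rightarrow> real" where
  "gas_vel z = case_sum (vel1 z) (\<lambda>j. - vel2 z j)"

definition gas_mass :: "('l \<Rightarrow> real) \<Rightarrow> ('r \<Rightarrow> real) \<Rightarrow> 'l + 'r \<Rightarrow> real" where
  "gas_mass m1 m2 = case_sum m1 m2"

definition gas_energy :: "(real \<Rightarrow> real) \<Rightarrow> ('l \<Rightarrow> real) \<Rightarrow> ('r \<Rightarrow> real) \<Rightarrow> real \<Rightarrow> ('l, 'r) phase \<Rightarrow> 'l + 'r \<Rightarrow> real" where
  "gas_energy \<kappa> m1 m2 \<delta> z = case_sum (energy1 \<kappa> m1 \<delta> z) (energy2 \<kappa> m2 \<delta> z)"

lemma slow_vars_eq: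
  "slow_vars \<kappa> m1 m2 \<epsilon> \<delta> z = slow_tuple (piston_pos z) (piston_vel z / \<epsilon>) (gas_energy \<kappa> m1 m2 \<delta> z)"
  by (simp add: slow_vars_def slow_tuple_def gas_energy_def)

lemma gas_energy_hard: "gas_energy \<kappa> m1 m2 0 z i = gas_mass m1 m2 i * (gas_vel z i)\<^sup>2 / 2"
  by (cases i) (auto simp: gas_energy_def gas_mass_def gas_vel_def energy1_def energy2_def well_def)

text \<open>A compact convex box that will contain \<open>V\<close>: the Lipschitz bound for the
  averaged field needs convexity, which \<open>V\<close> may lack.\<close>

definition slow_range :: "real \<Rightarrow> real \<Rightarrow> real \<Rightarrow> real \<Rightarrow> ('l::finite, 'r::finite) slow set" where
  "slow_range qmin w ka kb = {qmin..1 - qmin} \<times> {- w..w} \<times> cbox (\<chi> j. ka) (\<chi> j. kb) \<times> cbox (\<chi> j. ka) (\<chi> j. kb)"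

lemma slow_tuple_in_range:
  "slow_tuple Q W E \<in> slow_range qmin w ka kb \<longleftrightarrow>
     qmin \<le> Q \<and> Q \<le> 1 - qmin \<and> \<bar>W\<bar> \<le> w \<and> (\<forall>i. ka \<le> E i \<and> E i \<le> kb)"
proof -
  have "(\<forall>i. ka \<le> E i \<and> E i \<le> kb) \<longleftrightarrow> (\<forall>j. ka \<le> E (Inl j) \<and> E (Inl j) \<le> kb) \<and> (\<forall>j. ka \<le> E (Inr j) \<and> E (Inr j) \<le> kb)"
    by (metis sum.exhaust)
  then show ?thesis
    by (auto simp: slow_tuple_def slow_range_def mem_box_cart abs_le_iff)
qed

lemma compact_slow_range: "compact (slow_range qmin w ka kb)"
  unfolding slow_range_def by (intro compact_Times compact_Icc compact_cbox)

lemma convex_slow_range: "convex (slow_range qmin w ka kb)"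
  unfolding slow_range_def by (intro convex_Times convex_real_interval convex_box)

lemma len_bounds: "qmin \<le> Q \<Longrightarrow> Q \<le> 1 - qmin \<Longrightarrow> qmin \<le> len Q i \<and> len Q i \<le> 1 - qmin"
  by (cases i) (auto simp: len_def)

text \<open>
  \<open>X0\<close> and \<open>X\<close> are the corrector values at the two end points; they are defined differently for soft and
  hard walls, and only their bound matters.
\<close>

definition lyapunov_controlled ::
  "(real \<Rightarrow> real) \<Rightarrow> ('l::finite + 'r::finite) list \<Rightarrow> ('l \<Rightarrow> real) \<Rightarrow> ('r \<Rightarrow> real) \<Rightarrow> real \<Rightarrow> ('l, 'r) slow set \<Rightarrow> real \<Rightarrow> bool"
where
  "lyapunov_controlled \<kappa> ord m1 m2 \<delta> N C \<longleftrightarrow>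
     (\<forall>L \<epsilon> M R \<tau> z h.
        0 \<le> L \<longrightarrow> 0 < \<epsilon> \<longrightarrow> \<epsilon> \<le> 1 \<longrightarrow> 2 * C * \<epsilon> \<le> 1 \<longrightarrow> M * \<epsilon>\<^sup>2 = 1 \<longrightarrow>
        piston_motion \<kappa> ord M m1 m2 \<delta> R z \<longrightarrow> 0 \<le> \<tau> \<longrightarrow> \<tau> \<le> R \<longrightarrow>
        (\<forall>t\<in>{0..\<tau>}. slow_vars \<kappa> m1 m2 \<epsilon> \<delta> (z t) \<in> N) \<longrightarrow> (\<forall>t\<in>{0..\<tau>}. h t \<in> N) \<longrightarrow>
        (\<forall>t\<in>{0..\<tau>}. (h has_vector_derivative \<epsilon> *\<^sub>R averaged_field \<kappa> m1 m2 \<delta> (h t)) (at t within {0..\<tau>})) \<longrightarrow>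
        (\<forall>x\<in>N. \<forall>y\<in>N. norm (averaged_field \<kappa> m1 m2 \<delta> x - averaged_field \<kappa> m1 m2 \<delta> y) \<le> L * norm (x - y)) \<longrightarrow>
        (\<exists>X0 X. (\<forall>i. \<bar>X0 i\<bar> \<le> C) \<and> (\<forall>i. \<bar>X i\<bar> \<le> C) \<and>
           lyapunov C L \<epsilon> \<tau> (piston_pos (z \<tau>)) (piston_vel (z \<tau>) / \<epsilon>) (gas_energy \<kappa> m1 m2 \<delta> (z \<tau>)) X (h \<tau>)
           \<le> lyapunov C L \<epsilon> 0 (piston_pos (z 0)) (piston_vel (z 0) / \<epsilon>) (gas_energy \<kappa> m1 m2 \<delta> (z 0)) X0 (h 0)))"

context soft_core begin

lemma cbox_subset_energies:
  assumes "k0 < ka" "kb < k1"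
  shows "cbox (\<chi> j. ka) (\<chi> j. kb) \<subseteq> {x :: real ^ 'n::finite. \<forall>j. x $ j \<in> U}"
proof
  fix x :: "real ^ 'n"
  assume "x \<in> cbox (\<chi> j. ka) (\<chi> j. kb)"
  then have "ka \<le> x $ j" "x $ j \<le> kb" for j by (auto simp: mem_box_cart)
  then show "x \<in> {x. \<forall>j. x $ j \<in> U}"
    using assms by (auto intro: less_le_trans le_less_trans)
qed

lemma slow_range_subset_box:
  assumes "0 < qmin" "k0 < ka" "kb < k1"
  shows "slow_range qmin w ka kb \<subseteq> slow_box (qmin / 2)"
  unfolding slow_range_def slow_box_def using assms
  by (intro Sigma_mono cbox_subset_energies) auto

lemma gas_energy_soft:
  "\<delta> \<noteq> 0 \<Longrightarrow> gas_energy \<kappa> m1 m2 \<delta> z i = energy (len (piston_pos z) i) \<delta> (gas_mass m1 m2 i) (gas_pos z i) (gas_vel z i)"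
  by (cases i) (auto simp: gas_energy_def gas_mass_def gas_vel_def gas_pos_def len_def energy1_def energy2_def well_def energy_def)

lemma potential_update:
  "potential \<kappa> \<delta> (z\<lparr>piston_pos := x\<rparr>) = (\<Sum>j\<in>UNIV. well \<kappa> \<delta> 0 x (pos1 z j)) + (\<Sum>j\<in>UNIV. well \<kappa> \<delta> x 1 (pos2 z j))"
  "potential \<kappa> \<delta> (z\<lparr>pos1 := p\<rparr>) = (\<Sum>j\<in>UNIV. well \<kappa> \<delta> 0 (piston_pos z) (p j)) + (\<Sum>j\<in>UNIV. well \<kappa> \<delta> (piston_pos z) 1 (pos2 z j))"
  "potential \<kappa> \<delta> (z\<lparr>pos2 := q\<rparr>) = (\<Sum>j\<in>UNIV. well \<kappa> \<delta> 0 (piston_pos z) (pos1 z j)) + (\<Sum>j\<in>UNIV. well \<kappa> \<delta> (piston_pos z) 1 (q j))"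
  by (simp_all add: potential_def)

text \<open>Evaluates the partial derivatives that the definition leaves as \<open>deriv\<close>.
  After mirroring the right side all gas particles obey one equation, and the piston receives the
  forces \<open>f i\<close> with the sign \<open>side i\<close>.\<close>

lemma soft_core_motion_equations:
  fixes z :: "real \<Rightarrow> ('l::finite, 'r::finite) phase"
  assumes motion: "soft_core_motion \<kappa> M m1 m2 \<delta> R z" and \<delta>: "\<delta> \<noteq> 0" and t: "t \<in> {0..R}"
  defines "f \<equiv> \<lambda>i. - \<kappa>' ((len (piston_pos (z t)) i - gas_pos (z t) i) / \<delta>) / \<delta>"
    and "w \<equiv> \<lambda>i. - \<kappa>' (gas_pos (z t) i / \<delta>) / \<delta>"
  shows "((\<lambda>s. piston_pos (z s)) has_real_derivative piston_vel (z t)) (at t within {0..R})"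
    and "((\<lambda>s. M * piston_vel (z s)) has_real_derivative (\<Sum>i\<in>UNIV. side i * f i)) (at t within {0..R})"
    and "((\<lambda>s. gas_pos (z s) i) has_real_derivative gas_vel (z t) i) (at t within {0..R})"
    and "((\<lambda>s. gas_mass m1 m2 i * gas_vel (z s) i) has_real_derivative w i - f i) (at t within {0..R})"
proof -
  note m = motion[unfolded soft_core_motion_def, rule_format, OF t]
  show "((\<lambda>s. piston_pos (z s)) has_real_derivative piston_vel (z t)) (at t within {0..R})"
    using m by blast
  show "((\<lambda>s. gas_pos (z s) i) has_real_derivative gas_vel (z t) i) (at t within {0..R})"
    using m by (cases i) (auto simp: gas_pos_def gas_vel_def intro!: derivative_eq_intros)
  define Q where "Q = piston_pos (z t)"
  have left: "((\<lambda>x. well \<kappa> \<delta> 0 x q) has_real_derivative \<kappa>' ((x - q) / \<delta>) / \<delta>) (at x)" for x q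
  proof -
    have "((\<lambda>x. \<kappa> ((x - q) / \<delta>)) has_real_derivative \<kappa>' ((x - q) / \<delta>) * (1 / \<delta>)) (at x)"
      by (rule DERIV_chain2[OF \<kappa>_deriv]) (use \<delta> in \<open>auto intro!: derivative_eq_intros\<close>)
    from DERIV_add[OF DERIV_const this, of "\<kappa> ((q - 0) / \<delta>)"] show ?thesis
      using \<delta> by (simp add: well_def)
  qed
  have right: "((\<lambda>x. well \<kappa> \<delta> x 1 q) has_real_derivative - \<kappa>' ((q - x) / \<delta>) / \<delta>) (at x)" for x q
  proof -
    have "((\<lambda>x. \<kappa> ((q - x) / \<delta>)) has_real_derivative \<kappa>' ((q - x) / \<delta>) * (- 1 / \<delta>)) (at x)"
      by (rule DERIV_chain2[OF \<kappa>_deriv]) (use \<delta> in \<open>auto intro!: derivative_eq_intros\<close>)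
    from DERIV_add[OF this DERIV_const, of "\<kappa> ((1 - q) / \<delta>)"] show ?thesis
      using \<delta> by (simp add: well_def)
  qed
  have "((\<lambda>x. potential \<kappa> \<delta> ((z t)\<lparr>piston_pos := x\<rparr>)) has_real_derivative
      (\<Sum>j\<in>UNIV. \<kappa>' ((Q - pos1 (z t) j) / \<delta>) / \<delta>) + (\<Sum>j\<in>UNIV. - \<kappa>' ((pos2 (z t) j - Q) / \<delta>) / \<delta>)) (at Q)"
    unfolding potential_update by (intro DERIV_add DERIV_sum left right)
  from DERIV_imp_deriv[OF this]
  have "- deriv (\<lambda>x. potential \<kappa> \<delta> ((z t)\<lparr>piston_pos := x\<rparr>)) Q = (\<Sum>i\<in>UNIV. side i * f i)"
    by (simp add: sum_UNIV_sum f_def side_def len_def gas_pos_def Q_def sum_negf)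
  then show "((\<lambda>s. M * piston_vel (z s)) has_real_derivative (\<Sum>i\<in>UNIV. side i * f i)) (at t within {0..R})"
    using m by (simp add: Q_def)
  show "((\<lambda>s. gas_mass m1 m2 i * gas_vel (z s) i) has_real_derivative w i - f i) (at t within {0..R})"
  proof (cases i)
    case (Inl j)
    have d: "((\<lambda>x. well \<kappa> \<delta> 0 Q (((pos1 (z t))(j := x)) k)) has_real_derivative
        (if k = j then \<kappa>' ((pos1 (z t) j - 0) / \<delta>) / \<delta> - \<kappa>' ((Q - pos1 (z t) j) / \<delta>) / \<delta> else 0)) (at (pos1 (z t) j))" for k
      using well_deriv[OF \<delta>, of 0 Q "pos1 (z t) j"] by simp
    have "((\<lambda>x. potential \<kappa> \<delta> ((z t)\<lparr>pos1 := (pos1 (z t))(j := x)\<rparr>)) has_real_derivative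
        (\<Sum>k\<in>UNIV. if k = j then \<kappa>' ((pos1 (z t) j - 0) / \<delta>) / \<delta> - \<kappa>' ((Q - pos1 (z t) j) / \<delta>) / \<delta> else 0) + 0) (at (pos1 (z t) j))"
      unfolding potential_update Q_def by (intro DERIV_add DERIV_sum DERIV_const d[unfolded Q_def])
    from DERIV_imp_deriv[OF this]
    have "- deriv (\<lambda>x. potential \<kappa> \<delta> ((z t)\<lparr>pos1 := (pos1 (z t))(j := x)\<rparr>)) (pos1 (z t) j) = w i - f i"
      by (simp add: Inl w_def f_def len_def gas_pos_def Q_def)
    moreover have "((\<lambda>s. m1 j * vel1 (z s) j) has_real_derivative
      - deriv (\<lambda>x. potential \<kappa> \<delta> ((z t)\<lparr>pos1 := (pos1 (z t))(j := x)\<rparr>)) (pos1 (z t) j)) (at t within {0..R})"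
      using m by blast
    ultimately show ?thesis
      by (simp add: Inl gas_mass_def gas_vel_def)
  next
    case (Inr j)
    have d: "((\<lambda>x. well \<kappa> \<delta> Q 1 (((pos2 (z t))(j := x)) k)) has_real_derivative
        (if k = j then \<kappa>' ((pos2 (z t) j - Q) / \<delta>) / \<delta> - \<kappa>' ((1 - pos2 (z t) j) / \<delta>) / \<delta> else 0)) (at (pos2 (z t) j))" for k
      using well_deriv[OF \<delta>, of Q 1 "pos2 (z t) j"] by simp
    have "((\<lambda>x. potential \<kappa> \<delta> ((z t)\<lparr>pos2 := (pos2 (z t))(j := x)\<rparr>)) has_real_derivative
        0 + (\<Sum>k\<in>UNIV. if k = j then \<kappa>' ((pos2 (z t) j - Q) / \<delta>) / \<delta> - \<kappa>' ((1 - pos2 (z t) j) / \<delta>) / \<delta> else 0)) (at (pos2 (z t) j))"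
      unfolding potential_update Q_def by (intro DERIV_add DERIV_sum DERIV_const d[unfolded Q_def])
    from DERIV_imp_deriv[OF this]
    have dv: "deriv (\<lambda>x. potential \<kappa> \<delta> ((z t)\<lparr>pos2 := (pos2 (z t))(j := x)\<rparr>)) (pos2 (z t) j) = w i - f i"
      by (simp add: Inr w_def f_def len_def gas_pos_def Q_def)
    have "((\<lambda>s. m2 j * vel2 (z s) j) has_real_derivative
      - deriv (\<lambda>x. potential \<kappa> \<delta> ((z t)\<lparr>pos2 := (pos2 (z t))(j := x)\<rparr>)) (pos2 (z t) j)) (at t within {0..R})"
      using m by blast
    from DERIV_minus[OF this, unfolded dv] show ?thesis
      by (simp add: Inr gas_mass_def gas_vel_def)
  qed
qed

lemma force_bounds:
  assumes "0 < qmin" "0 \<le> \<delta>" "4 * \<delta> \<le> qmin" "qmin \<le> len Q i" "E i \<in> U"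
  shows "0 \<le> force \<delta> Q E i" "force \<delta> Q E i \<le> 4 * k1 / qmin"
proof -
  have "qmin / 2 \<le> eff_length (len Q i) \<delta> (E i)"
    using eff_length_ge[OF assms(2,5), of "len Q i"] assms by simp
  then show "0 \<le> force \<delta> Q E i" "force \<delta> Q E i \<le> 4 * k1 / qmin"
    using assms k frac_le[of "2 * k1" "2 * E i" "qmin / 2" "eff_length (len Q i) \<delta> (E i)"]
    by (auto simp: force_def)
qed

lemma soft_core_averaging:
  fixes m1 :: "'l::finite \<Rightarrow> real" and m2 :: "'r::finite \<Rightarrow> real"
  assumes m: "\<And>j. 0 < m1 j" "\<And>j. 0 < m2 j" and qmin: "0 < qmin" and ka: "k0 < ka" "kb < k1" and w: "0 \<le> w"
  obtains C0 where "0 \<le> C0"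
    "\<And>ord \<delta> C. 0 < \<delta> \<Longrightarrow> 4 * \<delta> \<le> qmin \<Longrightarrow> C0 \<le> C \<Longrightarrow> lyapunov_controlled \<kappa> ord m1 m2 \<delta> (slow_range qmin w ka kb) C"
proof -
  have m': "0 < gas_mass m1 m2 i" for i
    using m by (cases i) (auto simp: gas_mass_def)
  obtain c where c: "\<And>i. 0 \<le> c i" "\<And>i. corrector_bound (gas_mass m1 m2 i) qmin (c i)"
    using corrector_bound_exists[OF m' qmin] by metis
  \<comment> \<open>The summands bound the correctors together with their error rate (the piston
    moves at speed at most \<open>\<epsilon> * w\<close>), the slow velocity, and the averaged
    force, which is at most \<open>2 * k1 / (qmin / 2)\<close> as the effective length is at least
    \<open>qmin / 2\<close>.\<close>
  define C0 where "C0 = Max (range c) * (1 + w) + w + 4 * k1 / qmin"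
  have cmax: "c i \<le> Max (range c)" for i by simp
  have M0: "0 \<le> Max (range c)" using c(1) cmax order_trans by blast
  have "0 \<le> Max (range c) * w" "0 \<le> 4 * k1 / qmin"
    using M0 w qmin k by auto
  then have C0_ge: "Max (range c) \<le> C0" "Max (range c) * w \<le> C0" "w \<le> C0" "4 * k1 / qmin \<le> C0"
    using M0 w unfolding C0_def distrib_left by linarith+
  have C0: "0 \<le> C0" using C0_ge(3) w by simp
  show ?thesis
  proof (rule that[OF C0], unfold lyapunov_controlled_def, intro allI impI)
    fix ord \<delta> C L \<epsilon> M R \<tau> z h
    assume \<delta>: "0 < \<delta>" "4 * \<delta> \<le> qmin"
      and C: "C0 \<le> C" and L: "0 \<le> L" and \<epsilon>: "0 < \<epsilon>" "\<epsilon> \<le> 1" "2 * C * \<epsilon> \<le> 1" and M: "M * \<epsilon>\<^sup>2 = 1"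
      and motion': "piston_motion \<kappa> ord M m1 m2 \<delta> R z" and \<tau>: "0 \<le> \<tau>" "\<tau> \<le> R"
      and range: "\<forall>t\<in>{0..\<tau>}. slow_vars \<kappa> m1 m2 \<epsilon> \<delta> (z t) \<in> slow_range qmin w ka kb" "\<forall>t\<in>{0..\<tau>}. h t \<in> slow_range qmin w ka kb"
      and h: "\<forall>t\<in>{0..\<tau>}. (h has_vector_derivative \<epsilon> *\<^sub>R averaged_field \<kappa> m1 m2 \<delta> (h t)) (at t within {0..\<tau>})"
      and lip: "\<forall>x\<in>slow_range qmin w ka kb. \<forall>y\<in>slow_range qmin w ka kb.
         norm (averaged_field \<kappa> m1 m2 \<delta> x - averaged_field \<kappa> m1 m2 \<delta> y) \<le> L * norm (x - y)"
    have motion: "soft_core_motion \<kappa> M m1 m2 \<delta> R z"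
      using motion' \<delta> by (simp add: piston_motion_def)
    define Q where "Q = (\<lambda>t. piston_pos (z t))"
    define W where "W = (\<lambda>t. piston_vel (z t) / \<epsilon>)"
    define E where "E = (\<lambda>t. gas_energy \<kappa> m1 m2 \<delta> (z t))"
    define X where "X = (\<lambda>t i. corrector (len (Q t) i) \<delta> (gas_mass m1 m2 i) (gas_pos (z t) i) (gas_vel (z t) i))"
    define \<Phi> where "\<Phi> = (\<lambda>t. lyapunov C L \<epsilon> t (Q t) (W t) (E t) (X t) (h t))"
    have slow: "slow_vars \<kappa> m1 m2 \<epsilon> \<delta> (z t) = slow_tuple (Q t) (W t) (E t)" for t
      by (simp add: slow_vars_eq Q_def W_def E_def)
    have r: "qmin \<le> Q t" "Q t \<le> 1 - qmin" "\<bar>W t\<bar> \<le> w" "E t i \<in> U" "h t \<in> slow_range qmin w ka kb"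
      "slow_tuple (Q t) (W t) (E t) \<in> slow_range qmin w ka kb" if "t \<in> {0..\<tau>}" for t i
    proof -
      have t: "slow_tuple (Q t) (W t) (E t) \<in> slow_range qmin w ka kb" and "h t \<in> slow_range qmin w ka kb"
        using range that unfolding slow by auto
      then show "qmin \<le> Q t" "Q t \<le> 1 - qmin" "\<bar>W t\<bar> \<le> w" "E t i \<in> U" "h t \<in> slow_range qmin w ka kb"
        "slow_tuple (Q t) (W t) (E t) \<in> slow_range qmin w ka kb"
        using ka unfolding slow_tuple_in_range by (auto intro: less_le_trans le_less_trans)
    qed
    have len: "qmin \<le> len (Q t) i" "len (Q t) i \<le> 1" if "t \<in> {0..\<tau>}" for t and i :: "'l + 'r"
      using len_bounds[of qmin "Q t" i] r(1,2)[OF that] qmin by auto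
    have Een: "E t i = energy (len (Q t) i) \<delta> (gas_mass m1 m2 i) (gas_pos (z t) i) (gas_vel (z t) i)" for t i
      using \<delta> by (simp add: E_def Q_def gas_energy_soft)
    have Xb: "\<bar>X t i\<bar> \<le> C" if "t \<in> {0..\<tau>}" for t i
    proof -
      have "\<bar>X t i\<bar> \<le> c i"
        unfolding X_def using c(2)[of i, unfolded corrector_bound_def, THEN conjunct1, rule_format, OF len[OF that, of i] \<delta>]
          r(4)[OF that, of i, unfolded Een] by blast
      also have "c i \<le> Max (range c)" by (rule cmax)
      also have "\<dots> \<le> C0" by (rule C0_ge)
      finally show ?thesis using C by simp
    qed
    have deriv: "\<exists>D\<le>0. (\<Phi> has_real_derivative D) (at t within {0..\<tau>})" if t: "t \<in> {0..\<tau>}" for t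
    proof -
      have tR: "t \<in> {0..R}" and sub: "{0..\<tau>} \<subseteq> {0..R}" using t \<tau> by auto
      define f where "f = (\<lambda>i. - \<kappa>' ((len (Q t) i - gas_pos (z t) i) / \<delta>) / \<delta>)"
      define wf where "wf = (\<lambda>i. - \<kappa>' (gas_pos (z t) i / \<delta>) / \<delta>)"
      have \<delta>0: "\<delta> \<noteq> 0" using \<delta> by simp
      note eqs = DERIV_subset[OF soft_core_motion_equations(1)[OF motion \<delta>0 tR] sub]
        DERIV_subset[OF soft_core_motion_equations(2)[OF motion \<delta>0 tR] sub]
        DERIV_subset[OF soft_core_motion_equations(3)[OF motion \<delta>0 tR] sub]
        DERIV_subset[OF soft_core_motion_equations(4)[OF motion \<delta>0 tR] sub]
      have eq4: "((\<lambda>s. gas_mass m1 m2 i * gas_vel (z s) i) has_real_derivative wf i - f i) (at t within {0..\<tau>})" for i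
        unfolding wf_def f_def Q_def by (rule eqs(4))
      have V: "piston_vel (z t) = \<epsilon> * W t" for t using \<epsilon> by (simp add: W_def)
      have Qd: "(Q has_real_derivative \<epsilon> * W t) (at t within {0..\<tau>})"
        using eqs(1) unfolding Q_def by (simp add: V)
      have Wd: "(W has_real_derivative \<epsilon> * (\<Sum>i\<in>UNIV. side i * f i)) (at t within {0..\<tau>})"
      proof -
        have "\<epsilon> * (M * piston_vel (z t)) = W t" for t
          using M \<epsilon> by (simp add: W_def power2_eq_square field_simps)
        then show ?thesis
          using DERIV_cmult[OF eqs(2), of \<epsilon>] unfolding f_def Q_def by simp
      qed
      have lend: "((\<lambda>t. len (Q t) i) has_real_derivative \<epsilon> * side i * W t) (at t within {0..\<tau>})" for i :: "'l + 'r"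
        using Qd by (cases i) (auto simp: len_def side_def intro!: derivative_eq_intros)
      have Ed: "((\<lambda>t. E t i) has_real_derivative - (\<epsilon> * side i * W t * f i)) (at t within {0..\<tau>})" for i
        unfolding Een
        using energy_curve[OF \<delta>(1) lend[of i] eqs(3)[of i] eq4[of i] _ _ m'[of i]] by (simp add: f_def wf_def)
      have "\<exists>D. ((\<lambda>t. X t i) has_real_derivative D) (at t within {0..\<tau>}) \<and>
          \<bar>D - (force \<delta> (Q t) (E t) i - f i)\<bar> \<le> C * \<epsilon> * (1 + f i)" for i
      proof -
        have f0: "0 \<le> f i" unfolding f_def using \<kappa>'_nonpos[of "(len (Q t) i - gas_pos (z t) i) / \<delta>"] \<delta> by (simp add: divide_nonpos_pos)
        obtain D where D: "((\<lambda>t. X t i) has_real_derivative D) (at t within {0..\<tau>})"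
          "\<bar>D - (2 * E t i / eff_length (len (Q t) i) \<delta> (E t i) - f i)\<bar> \<le> c i * \<bar>\<epsilon> * side i * W t\<bar> * (1 + f i)"
          unfolding X_def
          using c(2)[of i, unfolded corrector_bound_def, THEN conjunct2, rule_format, OF t _ \<delta> _ Een lend[of i] eqs(3)[of i] eq4[of i]]
            len r(4) unfolding Een wf_def f_def by blast
        have "c i * \<bar>\<epsilon> * side i * W t\<bar> \<le> C * \<epsilon>"
        proof -
          have "c i * \<bar>W t\<bar> \<le> Max (range c) * w"
            using cmax c(1) r(3)[OF t] M0 by (intro mult_mono) auto
          also have "\<dots> \<le> C"
            using C C0_ge(2) by simp
          finally show ?thesis using \<epsilon> by (simp add: abs_mult mult_ac mult_left_mono)
        qed
        then have "c i * \<bar>\<epsilon> * side i * W t\<bar> * (1 + f i) \<le> C * \<epsilon> * (1 + f i)"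
          using f0 by (intro mult_right_mono) auto
        with D show ?thesis by (auto simp: force_def)
      qed
      then obtain D where D: "\<And>i. ((\<lambda>t. X t i) has_real_derivative D i) (at t within {0..\<tau>})"
        "\<And>i. \<bar>D i - (force \<delta> (Q t) (E t) i - f i)\<bar> \<le> C * \<epsilon> * (1 + f i)"
        by metis
      show ?thesis
        unfolding \<Phi>_def
      proof (rule lyapunov_deriv[OF \<epsilon>(1,3) _ L Qd Wd Ed D])
        show "0 \<le> C" using C0 C by simp
        show "0 \<le> f i" for i
          unfolding f_def using \<kappa>'_nonpos[of "(len (Q t) i - gas_pos (z t) i) / \<delta>"] \<delta> by (simp add: divide_nonpos_pos)
        show "\<bar>X t i\<bar> \<le> C" for i by (rule Xb[OF t])
        show "\<bar>W t\<bar> \<le> C" using r(3)[OF t] C C0_ge(3) by simp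
        show "force \<delta> (Q t) (E t) i \<le> C" for i
        proof -
          have "force \<delta> (Q t) (E t) i \<le> 4 * k1 / qmin"
            using force_bounds(2)[where E = "E t", OF qmin _ \<delta>(2) len(1)[OF t]] r(4)[OF t] \<delta> by simp
          also have "\<dots> \<le> C0" by (rule C0_ge)
          finally show ?thesis using C by simp
        qed
        show "(h has_vector_derivative \<epsilon> *\<^sub>R averaged_field \<kappa> m1 m2 \<delta> (h t)) (at t within {0..\<tau>})" using h t by blast
        show "averaged_field \<kappa> m1 m2 \<delta> (slow_tuple (Q t) (W t) (E t)) =
            slow_tuple (W t) (\<Sum>i\<in>UNIV. side i * force \<delta> (Q t) (E t) i) (\<lambda>i. - side i * W t * force \<delta> (Q t) (E t) i)"
          by (rule averaged_field_eq[OF m qmin]) (use r[OF t] \<delta> in auto)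
        show "norm (averaged_field \<kappa> m1 m2 \<delta> (slow_tuple (Q t) (W t) (E t)) - averaged_field \<kappa> m1 m2 \<delta> (h t))
            \<le> L * norm (slow_tuple (Q t) (W t) (E t) - h t)"
          using lip r(5,6)[OF t] by blast
      qed
    qed
    have "\<Phi> \<tau> \<le> \<Phi> 0"
    proof (rule DERIV_nonpos_imp_decreasing_open[OF \<tau>(1)])
      show "continuous_on {0..\<tau>} \<Phi>"
        using deriv by (meson DERIV_continuous continuous_on_eq_continuous_within)
      show "\<exists>D. (\<Phi> has_real_derivative D) (at t) \<and> D \<le> 0" if "0 < t" "t < \<tau>" for t
        using deriv[of t] that at_within_Icc_at[of 0 t \<tau>] by auto
    qed
    then show "\<exists>X0 X :: 'l + 'r \<Rightarrow> real. (\<forall>i. \<bar>X0 i\<bar> \<le> C) \<and> (\<forall>i. \<bar>X i\<bar> \<le> C) \<and>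
         lyapunov C L \<epsilon> \<tau> (piston_pos (z \<tau>)) (piston_vel (z \<tau>) / \<epsilon>) (gas_energy \<kappa> m1 m2 \<delta> (z \<tau>)) X (h \<tau>)
         \<le> lyapunov C L \<epsilon> 0 (piston_pos (z 0)) (piston_vel (z 0) / \<epsilon>) (gas_energy \<kappa> m1 m2 \<delta> (z 0)) X0 (h 0)"
      using Xb[of 0] Xb[of \<tau>] \<tau> unfolding \<Phi>_def Q_def W_def E_def
      by (intro exI[of _ "X 0"] exI[of _ "X \<tau>"]) auto
  qed
qed

end

subsection \<open>Hard core dynamics\<close>

lemma admissible_iff:
  "admissible z \<longleftrightarrow> (\<forall>i. 0 \<le> gas_pos z i \<and> gas_pos z i \<le> len (piston_pos z) i)"
proof
  assume "admissible z"
  then show "\<forall>i. 0 \<le> gas_pos z i \<and> gas_pos z i \<le> len (piston_pos z) i"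
    by (auto simp: admissible_def gas_pos_def len_def split: sum.split)
next
  assume *: "\<forall>i. 0 \<le> gas_pos z i \<and> gas_pos z i \<le> len (piston_pos z) i"
  show "admissible z"
    unfolding admissible_def
  proof (intro conjI allI)
    show "0 \<le> pos1 z j" "pos1 z j \<le> piston_pos z" for j
      using *[rule_format, of "Inl j"] by (auto simp: gas_pos_def len_def)
    show "piston_pos z \<le> pos2 z j" "pos2 z j \<le> 1" for j
      using *[rule_format, of "Inr j"] by (auto simp: gas_pos_def len_def)
  qed
qed

lemma hits_piston_iff:
  "hits_piston z i \<longleftrightarrow> gas_pos z i = len (piston_pos z) i \<and> side i * piston_vel z < gas_vel z i"
  by (cases i) (auto simp: hits_piston_def gas_pos_def gas_vel_def len_def side_def)

lemma hits_wall_iff: "hits_wall z i \<longleftrightarrow> gas_pos z i = 0 \<and> gas_vel z i < 0"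
  by (cases i) (auto simp: hits_wall_def gas_pos_def gas_vel_def)

lemma free_flight_simps:
  "piston_pos (free_flight s z) = piston_pos z + s * piston_vel z"
  "piston_vel (free_flight s z) = piston_vel z"
  "gas_pos (free_flight s z) i = gas_pos z i + s * gas_vel z i"
  "gas_vel (free_flight s z) = gas_vel z"
  by (simp_all add: free_flight_def gas_pos_def gas_vel_def split: sum.split)

lemma free_flight_add: "free_flight s (free_flight r z) = free_flight (s + r) z"
  by (simp add: free_flight_def fun_eq_iff algebra_simps)

lemma free_flight_0: "free_flight 0 z = z"
  by (simp add: free_flight_def)

lemma elastic_eq:
  assumes "0 < m" "0 < m'"
  shows "elastic m m' v v' = v - 2 * m' / (m + m') * (v - v')"
proof -
  have "(m + m') * v - 2 * m' * (v - v') = (m - m') * v + 2 * m' * v'"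
    by (simp add: algebra_simps)
  then have "elastic m m' v v' = ((m + m') * v - 2 * m' * (v - v')) / (m + m')"
    by (simp add: elastic_def)
  also have "\<dots> = v - 2 * m' / (m + m') * (v - v')"
    using assms by (simp add: diff_divide_distrib)
  finally show ?thesis .
qed

text \<open>Momentum transferred to the piston by a collision with particle \<open>i\<close>, in the direction away from its wall.\<close>

definition transfer :: "real \<Rightarrow> ('l \<Rightarrow> real) \<Rightarrow> ('r \<Rightarrow> real) \<Rightarrow> ('l, 'r) phase \<Rightarrow> 'l + 'r \<Rightarrow> real" where
  "transfer M m1 m2 z i = 2 * gas_mass m1 m2 i * M / (gas_mass m1 m2 i + M) * (gas_vel z i - side i * piston_vel z)"

lemma collide_piston_simps:
  assumes "\<And>i. 0 < gas_mass m1 m2 i" "0 < M" "hits_piston z i"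
  defines "z' \<equiv> collide_piston M m1 m2 i z"
  shows "piston_pos z' = piston_pos z" "gas_pos z' = gas_pos z"
    "piston_vel z' = piston_vel z + side i * transfer M m1 m2 z i / M"
    "gas_vel z' = (gas_vel z)(i := gas_vel z i - transfer M m1 m2 z i / gas_mass m1 m2 i)"
proof -
  define m where "m = gas_mass m1 m2 i"
  have m: "0 < m" using assms(1) by (simp add: m_def)
  have 1: "2 * m / (M + m) * (V - v) = - (2 * m * M / (m + M) * (v - V) / M)" for v V
  proof -
    have "2 * m / (M + m) * (V - v) = - (2 * m / (m + M) * (v - V))"
      by (metis add.commute minus_diff_eq mult_minus_right)
    then show ?thesis using \<open>0 < M\<close> by simp
  qed
  have 2: "2 * M / (m + M) * (v - V) = 2 * m * M / (m + M) * (v - V) / m" for v V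
    using m by simp
  show "piston_pos z' = piston_pos z" "gas_pos z' = gas_pos z"
    using assms(3) by (auto simp: z'_def collide_piston_def gas_pos_def split: sum.split)
  show "piston_vel z' = piston_vel z + side i * transfer M m1 m2 z i / M"
  proof (cases i)
    case (Inl j)
    then have "piston_vel z' = elastic M m (piston_vel z) (vel1 z j)"
      using assms(3) by (simp add: z'_def collide_piston_def m_def gas_mass_def)
    also have "\<dots> = piston_vel z + 2 * m * M / (m + M) * (vel1 z j - piston_vel z) / M"
      unfolding elastic_eq[OF \<open>0 < M\<close> m] 1 by simp
    finally show ?thesis using Inl by (simp add: transfer_def m_def side_def gas_vel_def)
  next
    case (Inr j)
    then have "piston_vel z' = elastic M m (piston_vel z) (vel2 z j)"
      using assms(3) by (simp add: z'_def collide_piston_def m_def gas_mass_def)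
    also have "\<dots> = piston_vel z + 2 * m * M / (m + M) * (vel2 z j - piston_vel z) / M"
      unfolding elastic_eq[OF \<open>0 < M\<close> m] 1 by simp
    also have "\<dots> = piston_vel z - 2 * m * M / (m + M) * (- vel2 z j + piston_vel z) / M"
      by (simp add: algebra_simps add_divide_distrib diff_divide_distrib)
    finally show ?thesis using Inr by (simp add: transfer_def m_def side_def gas_vel_def)
  qed
  show "gas_vel z' = (gas_vel z)(i := gas_vel z i - transfer M m1 m2 z i / gas_mass m1 m2 i)"
  proof (cases i)
    case (Inl j)
    have "elastic m M (vel1 z j) (piston_vel z) = vel1 z j - 2 * m * M / (m + M) * (vel1 z j - piston_vel z) / m"
      unfolding elastic_eq[OF m \<open>0 < M\<close>] 2 ..
    then show ?thesis
      using Inl assms(3)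
      by (auto simp: z'_def collide_piston_def m_def gas_mass_def gas_vel_def transfer_def side_def fun_eq_iff split: sum.split)
  next
    case (Inr j)
    have "elastic m M (vel2 z j) (piston_vel z) = vel2 z j - 2 * m * M / (m + M) * (vel2 z j - piston_vel z) / m"
      unfolding elastic_eq[OF m \<open>0 < M\<close>] 2 ..
    then have "- elastic m M (vel2 z j) (piston_vel z) = - vel2 z j - 2 * m * M / (m + M) * (- vel2 z j + piston_vel z) / m"
      by (simp add: algebra_simps add_divide_distrib diff_divide_distrib)
    then show ?thesis
      using Inr assms(3)
      by (auto simp: z'_def collide_piston_def m_def gas_mass_def gas_vel_def transfer_def side_def fun_eq_iff split: sum.split)
  qed
qed

definition kinetic :: "('l \<Rightarrow> real) \<Rightarrow> ('r \<Rightarrow> real) \<Rightarrow> ('l, 'r) phase \<Rightarrow> 'l + 'r \<Rightarrow> real" where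
  "kinetic m1 m2 z i = gas_mass m1 m2 i * (gas_vel z i)\<^sup>2 / 2"

text \<open>The virial over the length, without wall corrections. It vanishes at the fixed wall and
  equals the momentum at the piston, so a reflection leaves it unchanged and a collision lowers it
  by exactly the momentum transferred.\<close>

definition hard_corrector :: "('l \<Rightarrow> real) \<Rightarrow> ('r \<Rightarrow> real) \<Rightarrow> ('l, 'r) phase \<Rightarrow> 'l + 'r \<Rightarrow> real" where
  "hard_corrector m1 m2 z i = gas_mass m1 m2 i * gas_vel z i * gas_pos z i / len (piston_pos z) i"

definition hard_lyapunov ::
  "('l::finite \<Rightarrow> real) \<Rightarrow> ('r::finite \<Rightarrow> real) \<Rightarrow> real \<Rightarrow> real \<Rightarrow> real \<Rightarrow> real \<Rightarrow> ('l, 'r) phase \<Rightarrow> ('l, 'r) slow \<Rightarrow> real" where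
  "hard_lyapunov m1 m2 C L \<epsilon> t z h =
     lyapunov C L \<epsilon> t (piston_pos z) (piston_vel z / \<epsilon>) (kinetic m1 m2 z) (hard_corrector m1 m2 z) h"

text \<open>The first summand is the kinetic energy of the piston when
  \<open>M * \<epsilon>\<^sup>2 = 1\<close>. Elastic collisions conserve the sum, which bounds the
  states between the collisions of one pass; these are not points of the trajectory, and their slow
  variables need not lie in the given range.\<close>

definition total_energy :: "('l::finite \<Rightarrow> real) \<Rightarrow> ('r::finite \<Rightarrow> real) \<Rightarrow> real \<Rightarrow> ('l, 'r) phase \<Rightarrow> real" where
  "total_energy m1 m2 \<epsilon> z = (piston_vel z / \<epsilon>)\<^sup>2 / 2 + (\<Sum>i\<in>UNIV. kinetic m1 m2 z i)"

text \<open>With total energy at most \<open>H\<close>, the momentum of a particle is at most the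
  mass of the gas plus \<open>2 * H\<close>, and the speed of the piston is at most
  \<open>1 + 2 * H\<close>. A transfer is at most twice the mass of the particle times the sum of
  both speeds; its bound covers the correctors as well.\<close>

definition hard_bound :: "('l::finite \<Rightarrow> real) \<Rightarrow> ('r::finite \<Rightarrow> real) \<Rightarrow> real \<Rightarrow> real" where
  "hard_bound m1 m2 H = 2 * ((\<Sum>i\<in>UNIV. gas_mass m1 m2 i) + 2 * H) + 2 * ((\<Sum>i\<in>UNIV. gas_mass m1 m2 i) * (1 + 2 * H))"

lemma abs_le_one_plus_square: "\<bar>x\<bar> \<le> 1 + x\<^sup>2" for x :: real
proof -
  have "0 \<le> (\<bar>x\<bar> - 1)\<^sup>2" by simp
  then have "2 * \<bar>x\<bar> \<le> 1 + x\<^sup>2" by (simp add: power2_diff)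
  then show ?thesis using abs_ge_zero[of x] by linarith
qed

section \<open>Effect of a sequence of collisions on the functional\<close>

context
  fixes m1 :: "'l::finite \<Rightarrow> real" and m2 :: "'r::finite \<Rightarrow> real" and qmin H \<epsilon> M :: real
  assumes m: "\<And>i. 0 < gas_mass m1 m2 i" and qmin: "0 < qmin" and \<epsilon>: "0 < \<epsilon>" "\<epsilon> \<le> 1" and M: "M * \<epsilon>\<^sup>2 = 1"
begin

private lemma M_pos: "0 < M"
  using M \<epsilon> by (metis zero_less_mult_pos2 zero_less_one zero_less_power)

text \<open>The invariant of a sequence of collisions: it refers to the conserved total energy
  instead of the individual slow variables.\<close>

private definition tame :: "('l, 'r) phase \<Rightarrow> bool" where
  "tame z \<longleftrightarrow> qmin \<le> piston_pos z \<and> piston_pos z \<le> 1 - qmin \<and> admissible z \<and> total_energy m1 m2 \<epsilon> z \<le> H"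

private lemma kinetic_nonneg: "0 \<le> kinetic m1 m2 z i"
  using less_imp_le[OF m[of i]] by (simp add: kinetic_def)

private lemma kinetic_le: "kinetic m1 m2 z i \<le> total_energy m1 m2 \<epsilon> z"
proof -
  have "kinetic m1 m2 z i \<le> (\<Sum>i\<in>UNIV. kinetic m1 m2 z i)"
    by (rule member_le_sum) (auto simp: kinetic_nonneg)
  then show ?thesis by (simp add: total_energy_def add_increasing)
qed

private lemma mass_le: "gas_mass m1 m2 i \<le> (\<Sum>i\<in>UNIV. gas_mass m1 m2 i)"
  by (rule member_le_sum) (use less_imp_le[OF m] in auto)

private lemma momentum_le:
  assumes "total_energy m1 m2 \<epsilon> z \<le> H"
  shows "gas_mass m1 m2 i * \<bar>gas_vel z i\<bar> \<le> (\<Sum>i\<in>UNIV. gas_mass m1 m2 i) + 2 * H"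
proof -
  have "gas_mass m1 m2 i * \<bar>gas_vel z i\<bar> \<le> gas_mass m1 m2 i * (1 + (gas_vel z i)\<^sup>2)"
    using less_imp_le[OF m[of i]] by (intro mult_left_mono abs_le_one_plus_square)
  also have "\<dots> = gas_mass m1 m2 i + 2 * kinetic m1 m2 z i"
    by (simp add: kinetic_def distrib_left)
  finally show ?thesis
    using mass_le[of i] kinetic_le[of z i] assms by linarith
qed

private lemma hard_corrector_le:
  assumes "tame z"
  shows "\<bar>hard_corrector m1 m2 z i\<bar> \<le> hard_bound m1 m2 H"
proof -
  have H: "0 \<le> H" "total_energy m1 m2 \<epsilon> z \<le> H"
    using assms kinetic_le[of z i] kinetic_nonneg[of z i] by (auto simp: tame_def)
  have l: "qmin \<le> len (piston_pos z) i" and pos: "0 \<le> gas_pos z i" "gas_pos z i \<le> len (piston_pos z) i"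
    using assms len_bounds[of qmin "piston_pos z" i] by (auto simp: tame_def admissible_iff)
  have "\<bar>hard_corrector m1 m2 z i\<bar> = gas_mass m1 m2 i * \<bar>gas_vel z i\<bar> * (gas_pos z i / len (piston_pos z) i)"
    using less_imp_le[OF m[of i]] pos l qmin by (simp add: hard_corrector_def abs_mult)
  also have "\<dots> \<le> gas_mass m1 m2 i * \<bar>gas_vel z i\<bar> * 1"
    using less_imp_le[OF m[of i]] pos l qmin by (intro mult_left_mono) auto
  also have "\<dots> \<le> (\<Sum>i\<in>UNIV. gas_mass m1 m2 i) + 2 * H"
    using momentum_le[OF H(2), of i] by simp
  finally have "\<bar>hard_corrector m1 m2 z i\<bar> \<le> (\<Sum>i\<in>UNIV. gas_mass m1 m2 i) + 2 * H" .
  moreover have "0 \<le> (\<Sum>i\<in>UNIV. gas_mass m1 m2 i)"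
    by (intro sum_nonneg less_imp_le[OF m])
  moreover from this have "0 \<le> (\<Sum>i\<in>UNIV. gas_mass m1 m2 i) * (1 + 2 * H)"
    using H by (intro mult_nonneg_nonneg) auto
  moreover have "x \<le> 2 * a + 2 * c" if "x \<le> a" "0 \<le> a" "0 \<le> c" for x a c :: real
    using that by linarith
  ultimately show ?thesis
    using H unfolding hard_bound_def by (metis abs_ge_zero order_trans)
qed

private lemma transfer_bounds:
  assumes "tame z" "hits_piston z i"
  shows "0 \<le> transfer M m1 m2 z i" "transfer M m1 m2 z i \<le> hard_bound m1 m2 H"
proof -
  define mi where "mi = gas_mass m1 m2 i"
  define u where "u = gas_vel z i - side i * piston_vel z"
  have mi: "0 < mi" using m by (simp add: mi_def)
  have u: "0 \<le> u" using assms(2) by (simp add: hits_piston_iff u_def)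
  have H: "total_energy m1 m2 \<epsilon> z \<le> H" using assms by (simp add: tame_def)
  show "0 \<le> transfer M m1 m2 z i"
    using mi u M_pos unfolding transfer_def u_def[symmetric] mi_def[symmetric] by simp
  have "(piston_vel z / \<epsilon>)\<^sup>2 / 2 \<le> H"
    using H sum_nonneg[of UNIV "kinetic m1 m2 z"] kinetic_nonneg by (simp add: total_energy_def)
  then have W: "\<bar>piston_vel z / \<epsilon>\<bar> \<le> 1 + 2 * H"
    using abs_le_one_plus_square[of "piston_vel z / \<epsilon>"] by linarith
  have "\<bar>piston_vel z\<bar> = \<epsilon> * \<bar>piston_vel z / \<epsilon>\<bar>" using \<epsilon> by simp
  also have "\<dots> \<le> 1 * \<bar>piston_vel z / \<epsilon>\<bar>" using \<epsilon> by (intro mult_right_mono) auto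
  finally have V: "\<bar>piston_vel z\<bar> \<le> 1 + 2 * H" using W by simp
  have "M / (mi + M) \<le> 1" using mi M_pos by simp
  then have "2 * mi * u * (M / (mi + M)) \<le> 2 * mi * u * 1"
    using mi u by (intro mult_left_mono) auto
  then have t: "transfer M m1 m2 z i \<le> 2 * (mi * u)"
    by (simp add: transfer_def mi_def u_def mult_ac)
  have "mi * u \<le> mi * (\<bar>gas_vel z i\<bar> + \<bar>piston_vel z\<bar>)"
  proof (rule mult_left_mono)
    have "\<bar>side i * piston_vel z\<bar> = \<bar>piston_vel z\<bar>" by (simp add: abs_mult)
    then show "u \<le> \<bar>gas_vel z i\<bar> + \<bar>piston_vel z\<bar>" unfolding u_def by linarith
  qed (use mi in simp)
  also have "\<dots> \<le> ((\<Sum>i\<in>UNIV. gas_mass m1 m2 i) + 2 * H) + (\<Sum>i\<in>UNIV. gas_mass m1 m2 i) * (1 + 2 * H)"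
    unfolding distrib_left[of mi]
  proof (rule add_mono)
    show "mi * \<bar>gas_vel z i\<bar> \<le> (\<Sum>i\<in>UNIV. gas_mass m1 m2 i) + 2 * H"
      unfolding mi_def by (rule momentum_le[OF H])
    show "mi * \<bar>piston_vel z\<bar> \<le> (\<Sum>i\<in>UNIV. gas_mass m1 m2 i) * (1 + 2 * H)"
      unfolding mi_def using V mass_le[of i] less_imp_le[OF m[of i]] sum_nonneg[of UNIV "gas_mass m1 m2"] less_imp_le[OF m]
      by (intro mult_mono) auto
  qed
  finally have "2 * (mi * u) \<le> hard_bound m1 m2 H"
    unfolding hard_bound_def distrib_left[symmetric, of 2] by simp
  with t show "transfer M m1 m2 z i \<le> hard_bound m1 m2 H" by simp
qed

text \<open>At the piston \<open>gas_pos\<close> equals \<open>len\<close>, so the corrector is the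
  momentum and drops by the transfer. Since \<open>1 / M = \<epsilon>\<^sup>2\<close>, the slow
  velocity changes as \<open>lyapunov_collision\<close> requires.\<close>

private lemma collide_piston_lyapunov:
  assumes z: "tame z" and C: "hard_bound m1 m2 H \<le> C" and L: "0 \<le> L"
  shows "tame (collide_piston M m1 m2 i z)"
    "hard_lyapunov m1 m2 C L \<epsilon> t (collide_piston M m1 m2 i z) h \<le> hard_lyapunov m1 m2 C L \<epsilon> t z h"
proof -
  have "tame (collide_piston M m1 m2 i z) \<and>
    hard_lyapunov m1 m2 C L \<epsilon> t (collide_piston M m1 m2 i z) h \<le> hard_lyapunov m1 m2 C L \<epsilon> t z h"
  proof (cases "hits_piston z i")
    case False
    then show ?thesis using z by (simp add: collide_piston_def)
  next
    case True
    define z' where "z' = collide_piston M m1 m2 i z"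
    define mi where "mi = gas_mass m1 m2 i"
    define \<Delta> where "\<Delta> = transfer M m1 m2 z i"
    define W where "W = piston_vel z / \<epsilon>"
    note s = collide_piston_simps[OF m M_pos True, folded z'_def, folded mi_def \<Delta>_def]
    have mi: "0 < mi" using m by (simp add: mi_def)
    have \<Delta>: "0 \<le> \<Delta>" "\<Delta> \<le> C"
      using transfer_bounds[OF z True] C by (auto simp: \<Delta>_def)
    have M': "1 / M = \<epsilon>\<^sup>2" using M M_pos by (simp add: field_simps)
    have W': "piston_vel z' / \<epsilon> = W + \<epsilon> * side i * \<Delta>"
    proof -
      have "piston_vel z' = piston_vel z + side i * \<Delta> * (1 / M)" by (simp add: s)
      then show ?thesis unfolding M' using \<epsilon> by (simp add: W_def field_simps power2_eq_square)
    qed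
    have ki: "kinetic m1 m2 z' i = kinetic m1 m2 z i - \<epsilon> * side i * \<Delta> * (W + \<epsilon> * side i * \<Delta> / 2)"
    proof -
      define u where "u = gas_vel z i"
      have "mi * (u - \<Delta> / mi)\<^sup>2 / 2 = mi * u\<^sup>2 / 2 - \<Delta> * (u - \<Delta> / (2 * mi))"
        using mi by (simp add: power2_diff power_divide field_simps power2_eq_square)
      \<comment> \<open>Elasticity: up to the orientation \<open>side i\<close>, the mean of the
        particle's velocities before and after the collision equals that of the piston's. The energy
        exchanged is the transfer times this common velocity.\<close>
      moreover have "u - \<Delta> / (2 * mi) = side i * piston_vel z + \<Delta> / (2 * M)"
      proof -
        have "\<Delta> / (2 * mi) + \<Delta> / (2 * M) = u - side i * piston_vel z"
          unfolding \<Delta>_def transfer_def mi_def[symmetric] u_def[symmetric]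
          using mi M_pos by (simp add: divide_simps) (simp add: algebra_simps)
        then show ?thesis by simp
      qed
      moreover have "\<Delta> * (side i * piston_vel z + \<Delta> / (2 * M)) = \<epsilon> * side i * \<Delta> * (W + \<epsilon> * side i * \<Delta> / 2)"
      proof -
        have "\<Delta> / (2 * M) = \<Delta> * \<epsilon>\<^sup>2 / 2" unfolding M'[symmetric] by simp
        moreover have "piston_vel z = \<epsilon> * W" using \<epsilon> by (simp add: W_def)
        moreover have s2: "side i * (side i * x) = x" for x using side_mult_side[of i] by (simp flip: mult.assoc)
        ultimately have "\<Delta> * (side i * piston_vel z + \<Delta> / (2 * M)) = \<Delta> * (side i * (\<epsilon> * W) + \<Delta> * \<epsilon>\<^sup>2 / 2)"
          by (simp only:)
        also have "\<dots> = \<epsilon> * side i * \<Delta> * (W + \<epsilon> * side i * \<Delta> / 2)"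
          using s2 by (simp add: algebra_simps power2_eq_square)
        finally show ?thesis .
      qed
      ultimately show ?thesis
        by (simp add: kinetic_def s mi_def[symmetric] u_def)
    qed
    have kin: "kinetic m1 m2 z' = (kinetic m1 m2 z)(i := kinetic m1 m2 z i - \<epsilon> * side i * \<Delta> * (W + \<epsilon> * side i * \<Delta> / 2))"
    proof
      fix j
      show "kinetic m1 m2 z' j = ((kinetic m1 m2 z)(i := kinetic m1 m2 z i - \<epsilon> * side i * \<Delta> * (W + \<epsilon> * side i * \<Delta> / 2))) j"
        using ki by (cases "j = i") (auto simp: kinetic_def s)
    qed
    have "len (piston_pos z) i \<noteq> 0"
      using z len_bounds[of qmin "piston_pos z" i] qmin by (auto simp: tame_def)
    then have cor: "hard_corrector m1 m2 z' = (hard_corrector m1 m2 z)(i := hard_corrector m1 m2 z i - \<Delta>)"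
      using True mi by (auto simp: hard_corrector_def s fun_eq_iff hits_piston_iff mi_def[symmetric] right_diff_distrib)
    have "(\<Sum>j\<in>UNIV. kinetic m1 m2 z' j) = (\<Sum>j\<in>UNIV. kinetic m1 m2 z j
        - (if j = i then \<epsilon> * side i * \<Delta> * (W + \<epsilon> * side i * \<Delta> / 2) else 0))"
      unfolding kin by (rule sum.cong) auto
    also have "\<dots> = (\<Sum>j\<in>UNIV. kinetic m1 m2 z j) - \<epsilon> * side i * \<Delta> * (W + \<epsilon> * side i * \<Delta> / 2)"
      by (simp add: sum_subtractf)
    finally have "total_energy m1 m2 \<epsilon> z' = total_energy m1 m2 \<epsilon> z"
      unfolding total_energy_def W' W_def[symmetric] by (simp add: power2_sum field_simps power2_eq_square)
    then have "tame z'"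
      using z by (simp add: tame_def admissible_iff s)
    moreover have "hard_lyapunov m1 m2 C L \<epsilon> t z' h \<le> hard_lyapunov m1 m2 C L \<epsilon> t z h"
      unfolding hard_lyapunov_def W' kin cor s(1) W_def[symmetric]
    proof (rule lyapunov_collision[OF \<epsilon>(1) _ L \<Delta>])
      show "0 \<le> C" using \<Delta> by simp
      show "\<bar>hard_corrector m1 m2 z j\<bar> \<le> C" for j
        using hard_corrector_le[OF z, of j] C by simp
    qed
    ultimately show ?thesis by (simp add: z'_def)
  qed
  then show "tame (collide_piston M m1 m2 i z)"
    "hard_lyapunov m1 m2 C L \<epsilon> t (collide_piston M m1 m2 i z) h \<le> hard_lyapunov m1 m2 C L \<epsilon> t z h"
    by auto
qed

text \<open>Kinetic energies are even in the velocity, and the corrector contains the factor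
  \<open>gas_pos\<close>, which is zero at the fixed wall.\<close>

private lemma reflect_walls_lyapunov:
  assumes z: "tame z"
  shows "tame (reflect_walls z)" "hard_lyapunov m1 m2 C L \<epsilon> t (reflect_walls z) h = hard_lyapunov m1 m2 C L \<epsilon> t z h"
proof -
  have s: "piston_pos (reflect_walls z) = piston_pos z" "piston_vel (reflect_walls z) = piston_vel z"
    "gas_pos (reflect_walls z) = gas_pos z"
    by (auto simp: reflect_walls_def gas_pos_def)
  have v: "gas_vel (reflect_walls z) i = (if hits_wall z i then - gas_vel z i else gas_vel z i)" for i
    by (cases i) (auto simp: reflect_walls_def gas_vel_def)
  have kin: "kinetic m1 m2 (reflect_walls z) = kinetic m1 m2 z"
    by (auto simp: kinetic_def v fun_eq_iff)
  have cor: "hard_corrector m1 m2 (reflect_walls z) = hard_corrector m1 m2 z"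
    by (auto simp: hard_corrector_def v s fun_eq_iff hits_wall_iff)
  show "tame (reflect_walls z)"
    using z by (simp add: tame_def admissible_iff s total_energy_def kin)
  show "hard_lyapunov m1 m2 C L \<epsilon> t (reflect_walls z) h = hard_lyapunov m1 m2 C L \<epsilon> t z h"
    by (simp add: hard_lyapunov_def s kin cor)
qed

private lemma collision_pass_lyapunov:
  assumes z: "tame z" and C: "hard_bound m1 m2 H \<le> C" and L: "0 \<le> L"
  shows "tame ((collision_pass ord M m1 m2 ^^ n) z) \<and>
    hard_lyapunov m1 m2 C L \<epsilon> t ((collision_pass ord M m1 m2 ^^ n) z) h \<le> hard_lyapunov m1 m2 C L \<epsilon> t z h"
proof (induction n)
  case 0
  then show ?case using z by simp
next
  case (Suc n)
  have fold: "tame (fold (collide_piston M m1 m2) is x) \<and>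
    hard_lyapunov m1 m2 C L \<epsilon> t (fold (collide_piston M m1 m2) is x) h \<le> hard_lyapunov m1 m2 C L \<epsilon> t x h" if "tame x" for "is" x
    using that
  proof (induction "is" arbitrary: x)
    case (Cons i "is")
    show ?case
      using Cons.IH[OF collide_piston_lyapunov(1)[OF Cons.prems C L]] collide_piston_lyapunov(2)[OF Cons.prems C L, of t i h]
      by (auto intro: order_trans)
  qed simp
  define x where "x = (collision_pass ord M m1 m2 ^^ n) z"
  have x: "tame x" "hard_lyapunov m1 m2 C L \<epsilon> t x h \<le> hard_lyapunov m1 m2 C L \<epsilon> t z h"
    using Suc by (auto simp: x_def)
  have "(collision_pass ord M m1 m2 ^^ Suc n) z = reflect_walls (fold (collide_piston M m1 m2) ord x)"
    by (simp add: collision_pass_def x_def)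
  then show ?case
    using fold[OF x(1), of ord] reflect_walls_lyapunov x(2) by (auto intro: order_trans)
qed

lemma after_collisions_lyapunov:
  assumes "after_collisions ord M m1 m2 z z'" and "qmin \<le> piston_pos z" "piston_pos z \<le> 1 - qmin" "admissible z"
    and "total_energy m1 m2 \<epsilon> z \<le> H" and C: "hard_bound m1 m2 H \<le> C" and L: "0 \<le> L"
  shows "hard_lyapunov m1 m2 C L \<epsilon> t z' h \<le> hard_lyapunov m1 m2 C L \<epsilon> t z h"
    "piston_pos z' = piston_pos z" "gas_pos z' = gas_pos z"
proof -
  obtain n where n: "z' = (collision_pass ord M m1 m2 ^^ n) z"
    using assms(1) unfolding after_collisions_def by blast
  have "tame z" using assms by (simp add: tame_def)
  from collision_pass_lyapunov[OF this C L]
  show "hard_lyapunov m1 m2 C L \<epsilon> t z' h \<le> hard_lyapunov m1 m2 C L \<epsilon> t z h"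
    unfolding n by blast
  have collide: "piston_pos (collide_piston M m1 m2 i x) = piston_pos x \<and> gas_pos (collide_piston M m1 m2 i x) = gas_pos x" for i and x :: "('l, 'r) phase"
    by (auto simp: collide_piston_def gas_pos_def split: sum.split)
  have fold: "piston_pos (fold (collide_piston M m1 m2) is x) = piston_pos x \<and> gas_pos (fold (collide_piston M m1 m2) is x) = gas_pos x"
    for "is" and x :: "('l, 'r) phase"
    by (induction "is" arbitrary: x) (auto simp: collide)
  have "piston_pos ((collision_pass ord M m1 m2 ^^ n) z) = piston_pos z \<and> gas_pos ((collision_pass ord M m1 m2 ^^ n) z) = gas_pos z" for n
    by (induction n) (auto simp: collision_pass_def reflect_walls_def fold gas_pos_def[of "reflect_walls _", unfolded reflect_walls_def, simplified, folded gas_pos_def] simp flip: gas_pos_def)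
  then show "piston_pos z' = piston_pos z" "gas_pos z' = gas_pos z"
    unfolding n by auto
qed

lemma hard_corrector_bound:
  assumes "qmin \<le> piston_pos z" "piston_pos z \<le> 1 - qmin" "admissible z" "total_energy m1 m2 \<epsilon> z \<le> H"
  shows "\<bar>hard_corrector m1 m2 z i\<bar> \<le> hard_bound m1 m2 H"
  by (rule hard_corrector_le) (use assms in \<open>simp add: tame_def\<close>)

end

lemma gas_energy_0: "gas_energy \<kappa> m1 m2 0 z = kinetic m1 m2 z"
  by (auto simp: gas_energy_hard kinetic_def)

lemma slow_vars_hard:
  "slow_vars \<kappa> m1 m2 \<epsilon> 0 z = slow_tuple (piston_pos z) (piston_vel z / \<epsilon>) (kinetic m1 m2 z)"
  by (simp add: slow_vars_eq gas_energy_0)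

lemma total_energy_le:
  fixes z :: "('l::finite, 'r::finite) phase"
  assumes "slow_vars \<kappa> m1 m2 \<epsilon> 0 z \<in> slow_range qmin w ka kb"
  shows "total_energy m1 m2 \<epsilon> z \<le> w\<^sup>2 / 2 + real CARD('l + 'r) * kb"
proof -
  have W: "\<bar>piston_vel z / \<epsilon>\<bar> \<le> w" and E: "kinetic m1 m2 z i \<le> kb" for i
    using assms unfolding slow_vars_hard slow_tuple_in_range by auto
  have "(piston_vel z / \<epsilon>)\<^sup>2 \<le> w\<^sup>2"
    using W by (metis abs_ge_zero order_trans power2_abs power_mono)
  moreover have "(\<Sum>i\<in>(UNIV :: ('l + 'r) set). kinetic m1 m2 z i) \<le> (\<Sum>i\<in>(UNIV :: ('l + 'r) set). kb)"
    by (intro sum_mono E)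
  ultimately show ?thesis
    unfolding total_energy_def by simp
qed

context soft_core begin

lemma eff_length_0 [simp]: "eff_length l 0 E = l"
  by (simp add: eff_length_def)

text \<open>Between collisions \<open>lyapunov_deriv\<close> applies with zero force; collisions do
  not increase the functional by \<open>after_collisions_lyapunov\<close>. Both are combined by
  \<open>locally_antimono_imp_le\<close>, whose left condition is a flight ending at
  \<open>t\<close> and whose right condition is the collisions at \<open>t\<close> followed by a
  flight.\<close>

lemma hard_core_averaging:
  fixes m1 :: "'l::finite \<Rightarrow> real" and m2 :: "'r::finite \<Rightarrow> real"
  assumes m: "\<And>j. 0 < m1 j" "\<And>j. 0 < m2 j" and qmin: "0 < qmin" and ka: "k0 < ka" "kb < k1" and w: "0 \<le> w"
    and kb: "0 \<le> kb"
  obtains C0 where "0 \<le> C0" "\<And>ord C. C0 \<le> C \<Longrightarrow> lyapunov_controlled \<kappa> ord m1 m2 0 (slow_range qmin w ka kb) C"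
proof -
  have m': "0 < gas_mass m1 m2 i" for i
    using m by (cases i) (auto simp: gas_mass_def)
  define H where "H = w\<^sup>2 / 2 + real CARD('l + 'r) * kb"
  define C1 where "C1 = hard_bound m1 m2 H"
  have H0: "0 \<le> H" using kb by (simp add: H_def)
  have C1: "0 \<le> C1"
    using H0 sum_nonneg[of UNIV "gas_mass m1 m2"] less_imp_le[OF m'] by (simp add: C1_def hard_bound_def)
  \<comment> \<open>In this order: the correctors, their error rate caused by the moving piston, the
    slow velocity, and the averaged force.\<close>
  define C0 where "C0 = C1 + C1 * w / qmin + w + 4 * k1 / qmin"
  have "0 \<le> C1 * w / qmin" "0 \<le> 4 * k1 / qmin"
    using C1 w qmin k by auto
  then have C0_ge: "C1 \<le> C0" "C1 * w / qmin \<le> C0" "w \<le> C0" "4 * k1 / qmin \<le> C0"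
    using C1 w unfolding C0_def by linarith+
  have C0: "0 \<le> C0" using C0_ge(3) w by simp
  show ?thesis
  proof (rule that[OF C0], unfold lyapunov_controlled_def, intro allI impI)
    fix ord C L \<epsilon> M R \<tau> z h
    assume C: "C0 \<le> C" and L: "0 \<le> L" and \<epsilon>: "0 < \<epsilon>" "\<epsilon> \<le> 1" "2 * C * \<epsilon> \<le> 1" and M: "M * \<epsilon>\<^sup>2 = 1"
      and motion': "piston_motion \<kappa> ord M m1 m2 0 R z" and \<tau>: "0 \<le> \<tau>" "\<tau> \<le> R"
      and range: "\<forall>t\<in>{0..\<tau>}. slow_vars \<kappa> m1 m2 \<epsilon> 0 (z t) \<in> slow_range qmin w ka kb" "\<forall>t\<in>{0..\<tau>}. h t \<in> slow_range qmin w ka kb"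
      and h: "\<forall>t\<in>{0..\<tau>}. (h has_vector_derivative \<epsilon> *\<^sub>R averaged_field \<kappa> m1 m2 0 (h t)) (at t within {0..\<tau>})"
      and lip: "\<forall>x\<in>slow_range qmin w ka kb. \<forall>y\<in>slow_range qmin w ka kb.
         norm (averaged_field \<kappa> m1 m2 0 x - averaged_field \<kappa> m1 m2 0 y) \<le> L * norm (x - y)"
    have motion: "hard_core_motion ord M m1 m2 R z"
      using motion' by (simp add: piston_motion_def)
    have C': "0 \<le> C" "C1 \<le> C" "C1 * w / qmin \<le> C" "w \<le> C" "4 * k1 / qmin \<le> C"
      using C C0 C0_ge by linarith+
    define good where "good = (\<lambda>x. slow_vars \<kappa> m1 m2 \<epsilon> 0 x \<in> slow_range qmin w ka kb \<and> admissible x)"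
    have good: "qmin \<le> piston_pos x" "piston_pos x \<le> 1 - qmin" "\<bar>piston_vel x / \<epsilon>\<bar> \<le> w" "kinetic m1 m2 x i \<in> U"
      "admissible x" "total_energy m1 m2 \<epsilon> x \<le> H" "\<bar>hard_corrector m1 m2 x i\<bar> \<le> C1" if "good x" for x i
    proof -
      have r: "slow_vars \<kappa> m1 m2 \<epsilon> 0 x \<in> slow_range qmin w ka kb" and "admissible x"
        using that by (auto simp: good_def)
      then show 1: "qmin \<le> piston_pos x" "piston_pos x \<le> 1 - qmin" "\<bar>piston_vel x / \<epsilon>\<bar> \<le> w" "kinetic m1 m2 x i \<in> U" "admissible x"
        using ka unfolding slow_vars_hard slow_tuple_in_range by (auto intro: less_le_trans le_less_trans)
      show 2: "total_energy m1 m2 \<epsilon> x \<le> H"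
        unfolding H_def by (rule total_energy_le[OF r])
      show "\<bar>hard_corrector m1 m2 x i\<bar> \<le> C1"
        unfolding C1_def by (rule hard_corrector_bound[OF m' qmin \<epsilon>(1,2) M 1(1,2,5) 2])
    qed
    define \<Phi> where "\<Phi> = (\<lambda>t x. hard_lyapunov m1 m2 C L \<epsilon> t x (h t))"
    \<comment> \<open>Flights are parametrised from a reference time \<open>c\<close>, so that the
      statement serves both flights rewound from their end point and flights started after
      collisions.\<close>
    have flight: "\<Phi> d (free_flight (d - c) x) \<le> \<Phi> a (free_flight (a - c) x)"
      if ad: "0 \<le> a" "a \<le> d" "d \<le> \<tau>" and x: "\<And>t. a \<le> t \<Longrightarrow> t \<le> d \<Longrightarrow> good (free_flight (t - c) x)" for a c d x
    proof -
      define y where "y = (\<lambda>t. free_flight (t - c) x)"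
      define V where "V = piston_vel x"
      define Q where "Q = (\<lambda>t. piston_pos x + (t - c) * V)"
      define X where "X = (\<lambda>t i. gas_mass m1 m2 i * gas_vel x i * (gas_pos x i + (t - c) * gas_vel x i) / len (Q t) i)"
      have y: "piston_pos (y t) = Q t" "piston_vel (y t) = V" "kinetic m1 m2 (y t) = kinetic m1 m2 x" "hard_corrector m1 m2 (y t) = X t" for t
        by (auto simp: y_def Q_def V_def X_def free_flight_simps kinetic_def hard_corrector_def fun_eq_iff)
      have yg: "good (y t)" if "t \<in> {a..d}" for t
        using x that by (simp add: y_def)
      have \<Phi>_eq: "\<Phi> t (y t) = lyapunov C L \<epsilon> t (Q t) (V / \<epsilon>) (kinetic m1 m2 x) (X t) (h t)" for t
        by (simp add: \<Phi>_def hard_lyapunov_def y)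
      have deriv: "\<exists>D\<le>0. ((\<lambda>t. \<Phi> t (y t)) has_real_derivative D) (at t within {a..d})" if t: "t \<in> {a..d}" for t
      proof -
        have Q: "qmin \<le> Q t" "Q t \<le> 1 - qmin" and W: "\<bar>V / \<epsilon>\<bar> \<le> w" and E: "kinetic m1 m2 x i \<in> U"
          and Xb: "\<bar>X t i\<bar> \<le> C1" for i
          using good[OF yg[OF t]] by (auto simp: y)
        have len: "qmin \<le> len (Q t) i" "len (Q t) i \<noteq> 0" for i :: "'l + 'r"
          using len_bounds[OF Q, of i] qmin by auto
        have lend: "((\<lambda>t. len (Q t) i) has_real_derivative side i * V) (at t within {a..d})" for i :: "'l + 'r"
          by (cases i) (auto simp: len_def side_def Q_def intro!: derivative_eq_intros)
        define D where "D = (\<lambda>i. (gas_mass m1 m2 i * gas_vel x i * gas_vel x i * len (Q t) i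
          - gas_mass m1 m2 i * gas_vel x i * (gas_pos x i + (t - c) * gas_vel x i) * (side i * V)) / (len (Q t) i * len (Q t) i))"
        have Xd: "((\<lambda>t. X t i) has_real_derivative D i) (at t within {a..d})" for i
        proof -
          have "((\<lambda>t. gas_mass m1 m2 i * gas_vel x i * (gas_pos x i + (t - c) * gas_vel x i)) has_real_derivative
              gas_mass m1 m2 i * gas_vel x i * gas_vel x i) (at t within {a..d})"
            by (auto intro!: derivative_eq_intros)
          from DERIV_divide[OF this lend len(2)] show ?thesis
            unfolding X_def D_def .
        qed
        have F: "force 0 (Q t) (kinetic m1 m2 x) i = gas_mass m1 m2 i * gas_vel x i * gas_vel x i / len (Q t) i" for i
          by (simp add: force_def kinetic_def power2_eq_square)
        have DF: "\<bar>D i - (force 0 (Q t) (kinetic m1 m2 x) i - 0)\<bar> \<le> C * \<epsilon> * (1 + 0)" for i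
        proof -
          have "D i - (force 0 (Q t) (kinetic m1 m2 x) i - 0) = - (X t i * (side i * V) / len (Q t) i)"
            unfolding D_def F X_def using len(2)[of i] by (simp add: diff_divide_distrib)
          moreover have "\<bar>X t i * (side i * V) / len (Q t) i\<bar> \<le> C1 * (\<epsilon> * w) / qmin"
          proof -
            have "\<bar>V\<bar> \<le> \<epsilon> * w" using W \<epsilon> by (simp add: abs_divide pos_divide_le_eq mult.commute)
            then have "\<bar>X t i * (side i * V)\<bar> \<le> C1 * (\<epsilon> * w)"
              unfolding abs_mult[of "X t i"] using Xb C1 by (intro mult_mono) (auto simp: abs_mult)
            then show ?thesis
              unfolding abs_divide using len(1)[of i] qmin C1 \<epsilon> w by (intro frac_le) auto
          qed
          moreover have "C1 * (\<epsilon> * w) / qmin = C1 * w / qmin * \<epsilon>" by simp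
          moreover have "\<dots> \<le> C * \<epsilon>" using C'(3) \<epsilon> by (intro mult_right_mono) auto
          ultimately show ?thesis by simp
        qed
        have Fle: "force 0 (Q t) (kinetic m1 m2 x) i \<le> C" for i
          using force_bounds(2)[where E = "kinetic m1 m2 x", OF qmin order_refl _ len(1) E, of i] C'(5) qmin by simp
        show ?thesis
          unfolding \<Phi>_eq
        proof (rule lyapunov_deriv[where f = "\<lambda>_. 0" and W = "\<lambda>_. V / \<epsilon>" and E = "\<lambda>_. kinetic m1 m2 x", OF \<epsilon>(1,3) C'(1) L _ _ _ Xd DF _ _ _ Fle])
          show "(Q has_real_derivative \<epsilon> * (V / \<epsilon>)) (at t within {a..d})"
            unfolding Q_def using \<epsilon> by (auto intro!: derivative_eq_intros)
          show "\<bar>X t i\<bar> \<le> C" for i using Xb[of i] C'(2) by simp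
          show "\<bar>V / \<epsilon>\<bar> \<le> C" using W C'(4) by simp
          show "(h has_vector_derivative \<epsilon> *\<^sub>R averaged_field \<kappa> m1 m2 0 (h t)) (at t within {a..d})"
            by (rule has_vector_derivative_within_subset[OF h[rule_format]]) (use t ad in auto)
          show "averaged_field \<kappa> m1 m2 0 (slow_tuple (Q t) (V / \<epsilon>) (kinetic m1 m2 x)) =
            slow_tuple (V / \<epsilon>) (\<Sum>i\<in>UNIV. side i * force 0 (Q t) (kinetic m1 m2 x) i) (\<lambda>i. - side i * (V / \<epsilon>) * force 0 (Q t) (kinetic m1 m2 x) i)"
            by (rule averaged_field_eq[OF m qmin Q]) (use E qmin in auto)
          show "norm (averaged_field \<kappa> m1 m2 0 (slow_tuple (Q t) (V / \<epsilon>) (kinetic m1 m2 x)) - averaged_field \<kappa> m1 m2 0 (h t))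
            \<le> L * norm (slow_tuple (Q t) (V / \<epsilon>) (kinetic m1 m2 x) - h t)"
            using yg[OF t] range(2) t ad by (intro lip[rule_format]) (auto simp: good_def slow_vars_hard y)
        qed auto
      qed
      have "\<Phi> d (y d) \<le> \<Phi> a (y a)"
      proof (rule DERIV_nonpos_imp_decreasing_open[OF ad(2)])
        show "continuous_on {a..d} (\<lambda>t. \<Phi> t (y t))"
          using deriv by (meson DERIV_continuous continuous_on_eq_continuous_within)
        show "\<exists>D. ((\<lambda>t. \<Phi> t (y t)) has_real_derivative D) (at t) \<and> D \<le> 0" if "a < t" "t < d" for t
          using deriv[of t] that at_within_Icc_at[of a t d] by auto
      qed
      then show ?thesis by (simp add: y_def)
    qed
    have zg: "good (z t)" if "0 \<le> t" "t \<le> \<tau>" for t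
      using range(1) motion that \<tau> by (auto simp: good_def hard_core_motion_def)
    have "\<Phi> \<tau> (z \<tau>) \<le> \<Phi> 0 (z 0)"
    proof (rule locally_antimono_imp_le[OF \<tau>(1)])
      fix t assume t: "0 < t" "t \<le> \<tau>"
      then obtain \<eta> where \<eta>: "0 < \<eta>" "\<And>s. s \<in> {0..<t} \<Longrightarrow> t - \<eta> < s \<Longrightarrow> z t = free_flight (t - s) (z s)"
        using motion \<tau> unfolding hard_core_motion_def by force
      \<comment> \<open>By left continuity \<open>z t\<close> carries the velocities from before
        \<open>t\<close>, so the flight that ends at \<open>t\<close> is recovered by flying
        backwards from \<open>z t\<close>.\<close>
      have rewind: "z s = free_flight (s - t) (z t)" if "s \<in> {0..t}" "t - \<eta> < s" for s
        using \<eta>(2)[of s] that by (cases "s = t") (auto simp: free_flight_add free_flight_0)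
      have "\<Phi> t (z t) \<le> \<Phi> s (z s)" if "s \<in> {0..<t}" "t - \<eta> < s" for s
      proof -
        have "\<Phi> t (free_flight (t - t) (z t)) \<le> \<Phi> s (free_flight (s - t) (z t))"
        proof (rule flight)
          show "good (free_flight (u - t) (z t))" if u: "s \<le> u" "u \<le> t" for u
            using rewind[of u] zg[of u] u \<open>s \<in> {0..<t}\<close> \<open>t - \<eta> < s\<close> t by auto
        qed (use that t in auto)
        then show ?thesis
          using rewind[of s] that by (simp add: free_flight_0)
      qed
      then show "\<exists>\<eta>>0. \<forall>s\<in>{0..<t}. t - \<eta> < s \<longrightarrow> \<Phi> t (z t) \<le> \<Phi> s (z s)"
        using \<eta>(1) by blast
    next
      fix t assume t: "0 \<le> t" "t < \<tau>"
      then obtain z' \<eta> where z': "after_collisions ord M m1 m2 (z t) z'" and "0 < \<eta>"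
        and \<eta>: "\<And>s. s \<in> {t<..R} \<Longrightarrow> s < t + \<eta> \<Longrightarrow> z s = free_flight (s - t) z'"
        using motion \<tau> unfolding hard_core_motion_def by force
      have g: "good (z t)" using zg t by simp
      note ac = after_collisions_lyapunov[OF m' qmin \<epsilon>(1,2) M z' good(1,2,5,6)[OF g] C'(2)[unfolded C1_def] L]
      have "\<Phi> s (z s) \<le> \<Phi> t (z t)" if s: "s \<in> {t<..\<tau>}" "s < t + \<eta>" for s
      proof -
        have zs: "z s = free_flight (s - t) z'" using \<eta>[of s] s \<tau> by simp
        have "\<Phi> s (free_flight (s - t) z') \<le> \<Phi> t (free_flight (t - t) z')"
        proof (rule flight)
          fix u assume u: "t \<le> u" "u \<le> s"
          show "good (free_flight (u - t) z')"
          proof (cases "u = t")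
            case True
            \<comment> \<open>The state just after the collisions is in general not a value of
              \<open>z\<close>. Its velocities are those of \<open>z s\<close> at the later time
              \<open>s\<close>, and its positions those of \<open>z t\<close>, which together give
              the bounds.\<close>
            have "good (z s)" using zg s t by simp
            then have "\<bar>piston_vel z' / \<epsilon>\<bar> \<le> w" "\<forall>i. ka \<le> kinetic m1 m2 z' i \<and> kinetic m1 m2 z' i \<le> kb"
              unfolding zs good_def slow_vars_hard slow_tuple_in_range
              by (auto simp: free_flight_simps kinetic_def)
            then have "good z'"
              using good(1,2,5)[OF g] by (simp add: good_def slow_vars_hard slow_tuple_in_range ac(2,3) admissible_iff)
            then show ?thesis using True by (simp add: free_flight_0)
          next
            case False
            then show ?thesis using \<eta>[of u] zg[of u] u s t \<tau> by auto
          qed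
        qed (use s t in auto)
        also have "\<dots> \<le> \<Phi> t (z t)"
          unfolding \<Phi>_def using ac(1) by (simp add: free_flight_0)
        finally show ?thesis unfolding zs .
      qed
      then show "\<exists>\<eta>>0. \<forall>s\<in>{t<..\<tau>}. s < t + \<eta> \<longrightarrow> \<Phi> s (z s) \<le> \<Phi> t (z t)"
        using \<open>0 < \<eta>\<close> by blast
    qed
    moreover have "\<bar>hard_corrector m1 m2 (z 0) i\<bar> \<le> C" "\<bar>hard_corrector m1 m2 (z \<tau>) i\<bar> \<le> C" for i
      using good(7)[OF zg, of 0 i] good(7)[OF zg, of \<tau> i] \<tau> C' by auto
    ultimately show "\<exists>X0 X :: 'l + 'r \<Rightarrow> real. (\<forall>i. \<bar>X0 i\<bar> \<le> C) \<and> (\<forall>i. \<bar>X i\<bar> \<le> C) \<and>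
         lyapunov C L \<epsilon> \<tau> (piston_pos (z \<tau>)) (piston_vel (z \<tau>) / \<epsilon>) (gas_energy \<kappa> m1 m2 0 (z \<tau>)) X (h \<tau>)
         \<le> lyapunov C L \<epsilon> 0 (piston_pos (z 0)) (piston_vel (z 0) / \<epsilon>) (gas_energy \<kappa> m1 m2 0 (z 0)) X0 (h 0)"
      by (intro exI[of _ "hard_corrector m1 m2 (z 0)"] exI[of _ "hard_corrector m1 m2 (z \<tau>)"])
        (simp add: \<Phi>_def hard_lyapunov_def gas_energy_0)
  qed
qed

text \<open>Serves the end point of the time interval: before the stopping time the slow variables
  are in \<open>V\<close>, and by continuity the closed set \<open>V\<close> still contains them at
  that time.\<close>

lemma continuous_on_slow_vars:
  fixes z :: "real \<Rightarrow> ('l::finite, 'r::finite) phase"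
  assumes motion: "soft_core_motion \<kappa> M m1 m2 \<delta> R z" and "\<delta> \<noteq> 0" "M \<noteq> 0" and m: "\<And>i. gas_mass m1 m2 i \<noteq> 0"
  shows "continuous_on {0..R} (\<lambda>t. slow_vars \<kappa> m1 m2 \<epsilon> \<delta> (z t))"
proof -
  note eqs = soft_core_motion_equations[OF motion assms(2)]
  have Q: "continuous_on {0..R} (\<lambda>t. piston_pos (z t))"
    by (rule DERIV_continuous_on[OF eqs(1)])
  have "continuous_on {0..R} (\<lambda>t. M * piston_vel (z t) / M)"
    by (intro continuous_on_divide DERIV_continuous_on[OF eqs(2)] continuous_on_const) (use assms in auto)
  then have V: "continuous_on {0..R} (\<lambda>t. piston_vel (z t))"
    using assms by simp
  have r: "continuous_on {0..R} (\<lambda>t. gas_pos (z t) i)" for i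
    by (rule DERIV_continuous_on[OF eqs(3)])
  have "continuous_on {0..R} (\<lambda>t. gas_mass m1 m2 i * gas_vel (z t) i / gas_mass m1 m2 i)" for i
    by (intro continuous_on_divide DERIV_continuous_on[OF eqs(4)] continuous_on_const) (use m in auto)
  then have s: "continuous_on {0..R} (\<lambda>t. gas_vel (z t) i)" for i
    using m by simp
  have l: "continuous_on {0..R} (\<lambda>t. len (piston_pos (z t)) i)" for i :: "'l + 'r"
    by (cases i) (auto simp: len_def intro!: continuous_intros Q)
  have E: "continuous_on {0..R} (\<lambda>t. gas_energy \<kappa> m1 m2 \<delta> (z t) i)" for i
    unfolding gas_energy_soft[OF assms(2)] energy_def using assms(2)
    by (auto intro!: continuous_intros continuous_on_compose2[OF \<kappa>_cont[of UNIV]] r s l)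
  show ?thesis
    unfolding slow_vars_eq slow_tuple_def divide_inverse
    by (intro continuous_on_Pair continuous_on_vec_lambda continuous_on_mult continuous_on_const Q V E)
qed

end

subsection \<open>Averaging\<close>

lemma closed_left_limit:
  fixes G :: "real \<Rightarrow> 'a::real_normed_vector"
  assumes "closed V" "a < t" "continuous (at t within {a..t}) G" "\<And>s. a < s \<Longrightarrow> s < t \<Longrightarrow> G s \<in> V"
  shows "G t \<in> V"
proof (rule Lim_in_closed_set[OF assms(1)])
  show "(G \<longlongrightarrow> G t) (at_left t)"
    using assms(3) at_within_Icc_at_left[OF assms(2)] by (simp add: continuous_within)
  show "\<forall>\<^sub>F s in at_left t. G s \<in> V"
    using assms(2,4) eventually_at_left_real[of a t] by (auto elim: eventually_mono)
qed simp

text \<open>Just before \<open>t\<close> the trajectory is a single free flight ending in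
  \<open>z t\<close>, so the slow variables are left continuous there although collisions make them
  jump.\<close>

lemma hard_core_left_limit:
  assumes "hard_core_motion ord M m1 m2 R z" "0 < t" "t \<le> R" "closed V"
    and V: "\<And>s. 0 \<le> s \<Longrightarrow> s < t \<Longrightarrow> slow_vars \<kappa> m1 m2 \<epsilon> 0 (z s) \<in> V"
  shows "slow_vars \<kappa> m1 m2 \<epsilon> 0 (z t) \<in> V"
proof -
  obtain \<eta> where \<eta>: "0 < \<eta>" "\<And>s. s \<in> {0..<t} \<Longrightarrow> t - \<eta> < s \<Longrightarrow> z t = free_flight (t - s) (z s)"
    using assms(1-3) unfolding hard_core_motion_def by force
  define G where "G = (\<lambda>s. slow_vars \<kappa> m1 m2 \<epsilon> 0 (free_flight (s - t) (z t)))"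
  define a where "a = max 0 (t - \<eta>)"
  have "G t \<in> V"
  proof (rule closed_left_limit[OF assms(4)])
    show "a < t" using assms(2) \<eta>(1) by (simp add: a_def)
    have "kinetic m1 m2 (free_flight s x) = kinetic m1 m2 x" for s x
      by (simp add: kinetic_def[abs_def] free_flight_simps)
    then show "continuous (at t within {a..t}) G"
      unfolding G_def slow_vars_hard slow_tuple_def free_flight_simps
      by (auto intro!: continuous_intros)
    show "G s \<in> V" if "a < s" "s < t" for s
    proof -
      have "z s = free_flight (s - t) (z t)"
        using \<eta>(2)[of s] that by (simp add: a_def free_flight_add free_flight_0)
      then show ?thesis using V[of s] that by (simp add: G_def a_def)
    qed
  qed
  then show ?thesis by (simp add: G_def free_flight_0)
qed

lemma compact_subset_open_interval:
  fixes K :: "real set"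
  assumes "compact K" "K \<subseteq> {a<..<b}" "a < b"
  obtains c d where "a < c" "c \<le> d" "d < b" "K \<subseteq> {c..d}"
proof (cases "K = {}")
  case True
  then show ?thesis using that[of "(a + b) / 2" "(a + b) / 2"] assms(3) by auto
next
  case False
  obtain c where c: "c \<in> K" "\<forall>x\<in>K. c \<le> x" using compact_attains_inf[OF assms(1) False] by blast
  obtain d where d: "d \<in> K" "\<forall>x\<in>K. x \<le> d" using compact_attains_sup[OF assms(1) False] by blast
  have "a < c" "c \<le> d" "d < b" "K \<subseteq> {c..d}" using c d assms(2) by auto
  then show ?thesis by (rule that)
qed

theorem theorem3p1p2:
  fixes \<kappa> :: "real \<Rightarrow> real"
    and m1 :: "'l::finite \<Rightarrow> real" and m2 :: "'r::finite \<Rightarrow> real"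
    and ord :: "('l + 'r) list"
    and V :: "('l, 'r) slow set"
    and A B K :: "real set"
  assumes "core_potential \<kappa>"
    and "\<And>j. m1 j > 0" and "\<And>j. m2 j > 0"
    and "distinct ord" and "set ord = UNIV"
    and "compact V"
    and "compact A" and "A \<subseteq> {0<..<1}"
    and "compact B"
    and "compact K" and "K \<subseteq> {0<..<\<kappa> 0}"
    and "\<And>Q W E1 E2. (Q, W, E1, E2) \<in> V \<Longrightarrow>
           Q \<in> A \<and> W \<in> B \<and> (\<forall>j. E1 $ j \<in> K) \<and> (\<forall>j. E2 $ j \<in> K)"
  shows "\<exists>\<delta>0>0.
    C1_jointly (averaged_field \<kappa> m1 m2) \<delta>0 V \<and>
    (\<forall>T>0. \<exists>C. \<exists>\<epsilon>1>0. \<forall>M>0. \<forall>\<epsilon>. \<epsilon> = M powr (-1/2) \<and> \<epsilon> \<le> \<epsilon>1 \<longrightarrow>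
      (\<forall>\<delta>\<in>{0..\<delta>0}. \<forall>S z hbar.
         piston_motion \<kappa> ord M m1 m2 \<delta> (S / \<epsilon>) z \<and>
         slow_vars \<kappa> m1 m2 \<epsilon> \<delta> (z 0) \<in> V \<and>
         averaged_motion \<kappa> m1 m2 \<delta> S hbar \<and>
         hbar 0 = slow_vars \<kappa> m1 m2 \<epsilon> \<delta> (z 0) \<longrightarrow>
         (\<forall>\<tau>\<in>{0..S}.
            ereal \<tau> \<le> min (ereal T)
              (stopping_time V \<epsilon> hbar (\<lambda>t. slow_vars \<kappa> m1 m2 \<epsilon> \<delta> (z t))) \<longrightarrow>
            norm (slow_vars \<kappa> m1 m2 \<epsilon> \<delta> (z (\<tau> / \<epsilon>)) - hbar \<tau>) \<le> C * \<epsilon>)))"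
proof -
  obtain \<kappa>' \<kappa>'' where \<kappa>: "\<And>x. (\<kappa> has_real_derivative \<kappa>' x) (at x)"
    "\<And>x. (\<kappa>' has_real_derivative \<kappa>'' x) (at x)" "continuous_on UNIV \<kappa>''"
    "\<And>x. 1 \<le> x \<Longrightarrow> \<kappa> x = 0" "\<And>x. x < 1 \<Longrightarrow> \<kappa>' x < 0"
    using assms(1) unfolding core_potential_def by blast
  have "\<kappa> 1 < \<kappa> 0"
  proof (rule DERIV_neg_imp_decreasing_open[of 0 1 \<kappa>])
    show "\<exists>D. (\<kappa> has_real_derivative D) (at x) \<and> D < 0" if "x < 1" for x
      using \<kappa>(1)[of x] \<kappa>(5)[OF that] by blast
    show "continuous_on {0..1} \<kappa>"
      by (rule DERIV_continuous_on[OF has_field_derivative_at_within[OF \<kappa>(1)]])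
  qed simp
  then have "0 < \<kappa> 0" using \<kappa>(4)[of 1] by simp
  obtain q1 q2 where q: "0 < q1" "q1 \<le> q2" "q2 < 1" "A \<subseteq> {q1..q2}"
    using compact_subset_open_interval[OF assms(7,8) zero_less_one] by blast
  obtain ka kb where ka: "0 < ka" "ka \<le> kb" "kb < \<kappa> 0" "K \<subseteq> {ka..kb}"
    using compact_subset_open_interval[OF assms(10,11) \<open>0 < \<kappa> 0\<close>] by blast
  obtain w0 where w0: "\<forall>x\<in>B. \<bar>x\<bar> \<le> w0"
    using compact_imp_bounded[OF assms(9)] unfolding bounded_iff real_norm_def by blast
  define w where "w = max w0 0"
  define qmin where "qmin = min q1 (1 - q2)"
  \<comment> \<open>Margins on both sides put the energies of \<open>V\<close>, which lie in
    \<open>{ka..kb}\<close>, into the open interval from \<open>k0\<close> to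
    \<open>k1\<close>.\<close>
  define k0 where "k0 = ka / 2"
  define k1 where "k1 = (kb + \<kappa> 0) / 2"
  have qmin: "0 < qmin" "qmin < 1" using q by (auto simp: qmin_def)
  have kk: "0 < k0" "k0 < ka" "kb < k1" "k1 < \<kappa> 0" "k0 < k1" using ka by (auto simp: k0_def k1_def)
  have "k0 / 4 < k0 / 2" using kk by simp
  obtain \<alpha> \<alpha>' where \<alpha>: "\<And>x. (\<alpha> has_real_derivative \<alpha>' x) (at x)" "continuous_on UNIV \<alpha>'"
    "\<And>x. x \<le> k0 / 4 \<Longrightarrow> \<alpha> x = 0" "\<And>x. k0 / 2 \<le> x \<Longrightarrow> \<alpha> x = 1" "\<And>x. 0 \<le> \<alpha> x \<and> \<alpha> x \<le> 1"
    "\<And>x. x \<le> k0 / 4 \<Longrightarrow> \<alpha>' x = 0"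
    by (rule smooth_cutoff[OF \<open>k0 / 4 < k0 / 2\<close>]) (erule that; assumption)
  interpret soft_core \<kappa> \<kappa>' \<kappa>'' k0 k1 \<alpha> \<alpha>'
    by unfold_locales (use \<kappa> kk \<alpha> in auto)
  define N where "N = (slow_range qmin w ka kb :: ('l, 'r) slow set)"
  have VN: "V \<subseteq> N"
  proof
    fix x assume "x \<in> V"
    obtain Q W E1 E2 where x: "x = (Q, W, E1, E2)" by (cases x)
    note v = assms(12)[OF \<open>x \<in> V\<close>[unfolded x]]
    have "q1 \<le> Q" "Q \<le> q2" using v q(4) by auto
    then have "qmin \<le> Q" "Q \<le> 1 - qmin" unfolding qmin_def by linarith+
    moreover have "\<bar>W\<bar> \<le> w" using v w0 unfolding w_def by (meson max.coboundedI1)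
    moreover have "ka \<le> E1 $ j \<and> E1 $ j \<le> kb" "ka \<le> E2 $ j' \<and> E2 $ j' \<le> kb" for j j'
      using v ka(4) by fastforce+
    ultimately show "x \<in> N"
      unfolding N_def slow_range_def x by (auto simp: mem_box_cart abs_le_iff)
  qed
  have Nbox: "N \<subseteq> slow_box (qmin / 2)"
    unfolding N_def by (rule slow_range_subset_box[OF qmin(1) kk(2,3)])
  \<comment> \<open>The averaged field is differentiated on a neighbourhood in which the piston may
    come as close as \<open>qmin / 2\<close> to the fixed walls;
    \<open>4 * \<delta>0 \<le> qmin / 2\<close> is the condition there.\<close>
  define \<delta>0 where "\<delta>0 = qmin / 8"
  have \<delta>0: "0 < \<delta>0" "4 * \<delta>0 \<le> qmin / 2" "4 * \<delta>0 \<le> qmin" using qmin by (auto simp: \<delta>0_def)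
  have C1: "C1_jointly (averaged_field \<kappa> m1 m2) \<delta>0 X" if "X \<subseteq> N" for X
    by (rule C1_jointly_averaged_field[of _ _ "qmin / 2"]) (use assms(2,3) qmin \<delta>0 that Nbox in auto)
  have cN: "compact N" "convex N"
    unfolding N_def by (rule compact_slow_range, rule convex_slow_range)
  obtain L where L: "0 \<le> L" "\<And>\<delta> x y. 0 \<le> \<delta> \<Longrightarrow> \<delta> \<le> \<delta>0 \<Longrightarrow> x \<in> N \<Longrightarrow> y \<in> N \<Longrightarrow>
      norm (averaged_field \<kappa> m1 m2 \<delta> x - averaged_field \<kappa> m1 m2 \<delta> y) \<le> L * norm (x - y)"
    by (rule C1_jointly_lipschitz[OF C1[OF order_refl] cN]) (erule that; assumption)
  have w: "0 \<le> w" by (simp add: w_def)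
  obtain Cs where Cs: "0 \<le> Cs"
    "\<And>ord \<delta> C. 0 < \<delta> \<Longrightarrow> 4 * \<delta> \<le> qmin \<Longrightarrow> Cs \<le> C \<Longrightarrow> lyapunov_controlled \<kappa> ord m1 m2 \<delta> N C"
    unfolding N_def using soft_core_averaging[of m1 m2 qmin ka kb w, OF assms(2,3) qmin(1) kk(2,3) w] by blast
  obtain Ch where Ch: "0 \<le> Ch" "\<And>ord C. Ch \<le> C \<Longrightarrow> lyapunov_controlled \<kappa> ord m1 m2 0 N C"
    unfolding N_def using hard_core_averaging[of m1 m2 qmin ka kb w, OF assms(2,3) qmin(1) kk(2,3) w] ka by auto
  define C where "C = Cs + Ch + w"
  have C: "Cs \<le> C" "Ch \<le> C" "w \<le> C" "0 \<le> C" using Cs(1) Ch(1) w by (auto simp: C_def)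
  define n where "n = real CARD('l + 'r)"
  define CT where "CT = (\<lambda>T. sqrt (exp (3 * lyapunov_rate TYPE('l + 'r) C L * ((1 + n * (2 * C + 1)) * T + 4 * n * C)) * ((n * (C + C\<^sup>2))\<^sup>2 + 1)) + n * (C + C\<^sup>2))"
  \<comment> \<open>Ensures \<open>\<epsilon> \<le> 1\<close> and
    \<open>2 * C * \<epsilon> \<le> 1\<close>; it is independent of \<open>T\<close>.\<close>
  define \<epsilon>1 where "\<epsilon>1 = 1 / (2 * C + 1)"
  have \<epsilon>1: "0 < \<epsilon>1" "\<epsilon>1 \<le> 1" "2 * C * \<epsilon>1 \<le> 1" using C by (auto simp: \<epsilon>1_def)
  have m': "gas_mass m1 m2 i \<noteq> 0" for i
    using less_imp_neq[OF assms(2)] less_imp_neq[OF assms(3)] by (cases i) (auto simp: gas_mass_def)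
  have main: "norm (slow_vars \<kappa> m1 m2 \<epsilon> \<delta> (z (\<tau> / \<epsilon>)) - hbar \<tau>) \<le> CT T * \<epsilon>"
    if M: "0 < M" and \<epsilon>: "\<epsilon> = M powr (-1/2)" "\<epsilon> \<le> \<epsilon>1" and \<delta>: "\<delta> \<in> {0..\<delta>0}"
      and motion: "piston_motion \<kappa> ord M m1 m2 \<delta> (S / \<epsilon>) z" and z0: "slow_vars \<kappa> m1 m2 \<epsilon> \<delta> (z 0) \<in> V"
      and avg: "averaged_motion \<kappa> m1 m2 \<delta> S hbar" and h0: "hbar 0 = slow_vars \<kappa> m1 m2 \<epsilon> \<delta> (z 0)"
      and \<tau>: "\<tau> \<in> {0..S}" and stop: "ereal \<tau> \<le> min (ereal T) (stopping_time V \<epsilon> hbar (\<lambda>t. slow_vars \<kappa> m1 m2 \<epsilon> \<delta> (z t)))"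
    for T M \<epsilon> \<delta> S z hbar \<tau>
  proof -
    have \<epsilon>0: "0 < \<epsilon>" "\<epsilon> \<le> 1" using M \<epsilon> \<epsilon>1 by auto
    have "2 * C * \<epsilon> \<le> 2 * C * \<epsilon>1" using \<epsilon>(2) C by (intro mult_left_mono) auto
    then have \<epsilon>C: "2 * C * \<epsilon> \<le> 1" using \<epsilon>1(3) by simp
    have "\<epsilon>\<^sup>2 = M powr (-1)"
      using M by (simp add: \<epsilon>(1) power2_eq_square flip: powr_add)
    then have M\<epsilon>: "M * \<epsilon>\<^sup>2 = 1" using M by (simp add: powr_minus field_simps)
    have T: "\<tau> \<le> T" and stop': "ereal \<tau> \<le> stopping_time V \<epsilon> hbar (\<lambda>t. slow_vars \<kappa> m1 m2 \<epsilon> \<delta> (z t))"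
      using stop by auto
    \<comment> \<open>The stopping time is an infimum, so membership in \<open>V\<close> is
      immediate only strictly before \<open>\<tau>\<close>; the end point is reached through left
      limits.\<close>
    have before: "hbar s \<in> V \<and> slow_vars \<kappa> m1 m2 \<epsilon> \<delta> (z (s / \<epsilon>)) \<in> V" if s: "0 \<le> s" "s < \<tau>" for s
    proof (rule ccontr)
      assume "\<not> ?thesis"
      then have "stopping_time V \<epsilon> hbar (\<lambda>t. slow_vars \<kappa> m1 m2 \<epsilon> \<delta> (z t)) \<le> ereal s"
        unfolding stopping_time_def using s by (intro Inf_lower) auto
      then have "ereal \<tau> \<le> ereal s" using stop' order_trans by blast
      then show False using s by simp
    qed
    \<comment> \<open>The averaged motion in the time of the particles, whence the factor
      \<open>\<epsilon>\<close> in its equation.\<close>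
    define h where "h = (\<lambda>t. hbar (\<epsilon> * t))"
    define t1 where "t1 = \<tau> / \<epsilon>"
    have t1: "0 \<le> t1" "t1 \<le> S / \<epsilon>" "\<epsilon> * t1 = \<tau>"
      using \<tau> \<epsilon>0 by (auto simp: t1_def divide_right_mono)
    have hd: "(hbar has_vector_derivative averaged_field \<kappa> m1 m2 \<delta> (hbar s)) (at s within {0..S})" if "s \<in> {0..S}" for s
      using avg that by (simp add: averaged_motion_def)
    have closedV: "closed V" using assms(6) by (rule compact_imp_closed)
    have z_before: "slow_vars \<kappa> m1 m2 \<epsilon> \<delta> (z t) \<in> V" if "0 \<le> t" "t < t1" for t
    proof -
      have "\<epsilon> * t < \<tau>" using that \<epsilon>0 by (simp add: t1_def pos_less_divide_eq mult.commute)
      then show ?thesis using before[of "\<epsilon> * t"] that \<epsilon>0 by simp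
    qed
    have z_end: "slow_vars \<kappa> m1 m2 \<epsilon> \<delta> (z t1) \<in> V"
    proof (cases "t1 = 0")
      case True
      then show ?thesis using z0 by simp
    next
      case False
      then have "0 < t1" using t1 by simp
      show ?thesis
      proof (cases "\<delta> = 0")
        case True
        show ?thesis
          unfolding True
          by (rule hard_core_left_limit[OF _ \<open>0 < t1\<close> t1(2) closedV])
            (use motion z_before True in \<open>auto simp: piston_motion_def\<close>)
      next
        case False
        then have soft: "soft_core_motion \<kappa> M m1 m2 \<delta> (S / \<epsilon>) z"
          using motion by (simp add: piston_motion_def)
        have "M \<noteq> 0" using M by simp
        note cont = continuous_on_slow_vars[OF soft False this m', of \<epsilon>]
        show ?thesis
        proof (rule closed_left_limit[OF closedV \<open>0 < t1\<close>])
          have "continuous_on {0..t1} (\<lambda>t. slow_vars \<kappa> m1 m2 \<epsilon> \<delta> (z t))"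
            by (rule continuous_on_subset[OF cont]) (use t1 in auto)
          then show "continuous (at t1 within {0..t1}) (\<lambda>t. slow_vars \<kappa> m1 m2 \<epsilon> \<delta> (z t))"
            using t1 by (simp add: continuous_on_eq_continuous_within)
        qed (use z_before in auto)
      qed
    qed
    have h_end: "hbar \<tau> \<in> V"
    proof (cases "\<tau> = 0")
      case True
      then show ?thesis using h0 z0 by simp
    next
      case False
      then have "0 < \<tau>" using \<tau> by simp
      show ?thesis
      proof (rule closed_left_limit[OF closedV \<open>0 < \<tau>\<close>])
        have "(hbar has_vector_derivative averaged_field \<kappa> m1 m2 \<delta> (hbar \<tau>)) (at \<tau> within {0..\<tau>})"
          by (rule has_vector_derivative_within_subset[OF hd[OF \<tau>]]) (use \<tau> in auto)
        then show "continuous (at \<tau> within {0..\<tau>}) hbar"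
          by (rule has_vector_derivative_continuous)
      qed (use before in auto)
    qed
    have in_range: "slow_vars \<kappa> m1 m2 \<epsilon> \<delta> (z t) \<in> N \<and> h t \<in> N"
      if t: "0 \<le> t" "t \<le> t1" for t
    proof -
      have "slow_vars \<kappa> m1 m2 \<epsilon> \<delta> (z t) \<in> V"
        using z_before[of t] z_end t by (cases "t = t1") auto
      moreover have "h t \<in> V"
      proof (cases "t = t1")
        case True
        then show ?thesis using h_end t1 by (simp add: h_def)
      next
        case False
        then have "\<epsilon> * t < \<epsilon> * t1" using t \<epsilon>0 by simp
        then show ?thesis using before[of "\<epsilon> * t"] t \<epsilon>0 t1 by (simp add: h_def)
      qed
      ultimately show ?thesis using VN by auto
    qed
    have h_deriv: "(h has_vector_derivative \<epsilon> *\<^sub>R averaged_field \<kappa> m1 m2 \<delta> (h t)) (at t within {0..t1})" if t: "t \<in> {0..t1}" for t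
    proof -
      have "\<epsilon> * t \<le> \<epsilon> * t1" using t \<epsilon>0 by (intro mult_left_mono) auto
      then have et: "\<epsilon> * t \<in> {0..S}" using t \<epsilon>0 t1 \<tau> by simp
      have sub: "(\<lambda>t. \<epsilon> * t) ` {0..t1} \<subseteq> {0..S}"
      proof
        fix s assume "s \<in> (\<lambda>t. \<epsilon> * t) ` {0..t1}"
        then obtain u where s: "s = \<epsilon> * u" and "u \<in> {0..t1}" by blast
        then have u: "0 \<le> u" "u \<le> t1" by simp_all
        then have "\<epsilon> * u \<le> \<epsilon> * t1" using \<epsilon>0 by (intro mult_left_mono) auto
        then show "s \<in> {0..S}" using s u \<epsilon>0 t1 \<tau> by simp
      qed
      have "((\<lambda>t. \<epsilon> * t) has_vector_derivative \<epsilon>) (at t within {0..t1})"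
        by (auto intro!: derivative_eq_intros)
      moreover have "(hbar has_vector_derivative averaged_field \<kappa> m1 m2 \<delta> (hbar (\<epsilon> * t))) (at (\<epsilon> * t) within (\<lambda>t. \<epsilon> * t) ` {0..t1})"
        by (rule has_vector_derivative_within_subset[OF hd[OF et] sub])
      ultimately show ?thesis
        using vector_diff_chain_within[of "\<lambda>t. \<epsilon> * t" \<epsilon> t "{0..t1}" hbar] by (simp add: h_def o_def)
    qed
    have lip: "norm (averaged_field \<kappa> m1 m2 \<delta> x - averaged_field \<kappa> m1 m2 \<delta> y) \<le> L * norm (x - y)"
      if "x \<in> N" "y \<in> N" for x y
      using L(2)[of \<delta> x y] that \<delta> by simp
    have controlled: "lyapunov_controlled \<kappa> ord m1 m2 \<delta> N C"
    proof (cases "\<delta> = 0")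
      case True
      show ?thesis
        unfolding True by (rule Ch(2)[OF C(2)])
    next
      case False
      then show ?thesis
        using \<delta> \<delta>0 by (intro Cs(2)[OF _ _ C(1)]) auto
    qed
    have "\<exists>X0 X. (\<forall>i. \<bar>X0 i\<bar> \<le> C) \<and> (\<forall>i. \<bar>X i\<bar> \<le> C) \<and>
         lyapunov C L \<epsilon> t1 (piston_pos (z t1)) (piston_vel (z t1) / \<epsilon>) (gas_energy \<kappa> m1 m2 \<delta> (z t1)) X (h t1)
         \<le> lyapunov C L \<epsilon> 0 (piston_pos (z 0)) (piston_vel (z 0) / \<epsilon>) (gas_energy \<kappa> m1 m2 \<delta> (z 0)) X0 (h 0)"
      by (rule controlled[unfolded lyapunov_controlled_def, rule_format, OF L(1) \<epsilon>0 \<epsilon>C M\<epsilon> motion t1(1,2) _ _ h_deriv lip])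
        (use in_range in auto)
    then obtain X0 X :: "'l + 'r \<Rightarrow> real" where X: "\<And>i. \<bar>X0 i\<bar> \<le> C" "\<And>i. \<bar>X i\<bar> \<le> C"
      and le: "lyapunov C L \<epsilon> t1 (piston_pos (z t1)) (piston_vel (z t1) / \<epsilon>) (gas_energy \<kappa> m1 m2 \<delta> (z t1)) X (h t1)
         \<le> lyapunov C L \<epsilon> 0 (piston_pos (z 0)) (piston_vel (z 0) / \<epsilon>) (gas_energy \<kappa> m1 m2 \<delta> (z 0)) X0 (h 0)"
      by blast
    have W: "\<bar>piston_vel (z t) / \<epsilon>\<bar> \<le> C" if "0 \<le> t" "t \<le> t1" for t
    proof -
      have "\<bar>piston_vel (z t) / \<epsilon>\<bar> \<le> w"
        using in_range[OF that] unfolding N_def slow_vars_eq slow_tuple_in_range by blast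
      then show ?thesis using C(3) by simp
    qed
    have h_0: "h 0 = slow_vars \<kappa> m1 m2 \<epsilon> \<delta> (z 0)" using h0 by (simp add: h_def)
    have "\<epsilon> * t1 \<le> T" using T t1(3) by simp
    from lyapunov_imp_close[OF le[unfolded h_0 slow_vars_eq] \<epsilon>0 C(4) L(1) this W[OF order_refl t1(1)] W[OF t1(1) order_refl] X n_def]
    have "norm (slow_vars \<kappa> m1 m2 \<epsilon> \<delta> (z t1) - h t1) \<le> CT T * \<epsilon>"
      unfolding CT_def slow_vars_eq .
    then show ?thesis by (simp add: h_def t1(3) t1_def[symmetric])
  qed
  have rate: "\<exists>C. \<exists>\<epsilon>1>0. \<forall>M>0. \<forall>\<epsilon>. \<epsilon> = M powr (-1/2) \<and> \<epsilon> \<le> \<epsilon>1 \<longrightarrow>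
      (\<forall>\<delta>\<in>{0..\<delta>0}. \<forall>S z hbar.
         piston_motion \<kappa> ord M m1 m2 \<delta> (S / \<epsilon>) z \<and>
         slow_vars \<kappa> m1 m2 \<epsilon> \<delta> (z 0) \<in> V \<and>
         averaged_motion \<kappa> m1 m2 \<delta> S hbar \<and>
         hbar 0 = slow_vars \<kappa> m1 m2 \<epsilon> \<delta> (z 0) \<longrightarrow>
         (\<forall>\<tau>\<in>{0..S}.
            ereal \<tau> \<le> min (ereal T)
              (stopping_time V \<epsilon> hbar (\<lambda>t. slow_vars \<kappa> m1 m2 \<epsilon> \<delta> (z t))) \<longrightarrow>
            norm (slow_vars \<kappa> m1 m2 \<epsilon> \<delta> (z (\<tau> / \<epsilon>)) - hbar \<tau>) \<le> C * \<epsilon>))" for T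
    by (intro exI[of _ "CT T"] exI[of _ \<epsilon>1] conjI allI impI ballI \<epsilon>1(1) main) auto
  show ?thesis
    by (intro exI[of _ \<delta>0] conjI allI impI \<delta>0(1) C1[OF VN] rate)
qed

end
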